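(* Up to isomorphism, there are exactly $17$ real nilpotent Lie algebras of dimension $6$ that admit an open respectful decomposition $(H,V)$ with $\dim V=2$ and $\dim H=4$.
   Context: All Lie algebras are real and finite dimensional. For vector subspaces $A,B$ of a Lie algebra, $[A,B]$ denotes the linear span of all brackets $[a,b]$, $a\in A$, $b\in B$. An ordered pair $(H,V)$ of complementary vector subspaces of a Lie algebra $\mathfrak g$ (so $\mathfrak g=H\oplus V$ as a vector space) is a respectful decomposition of $\mathfrak g$ if $[V,H]\subseteq H$. It is open if neither $H$ nor $V$ is a Lie subalgebra of $\mathfrak g$. *)

theory Defs
  imports "HOL-Analysis.Analysis"
begin

text \<open>
  A real Lie algebra is a bracket on the vector space given by a whole type of class
  \<^class>\<open>real_vector\<close>.
\<close>

locale lie_algebra =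
  fixes bracket :: "'a::real_vector \<Rightarrow> 'a \<Rightarrow> 'a"
  assumes bilinear_bracket: "bilinear bracket"
    and bracket_self: "bracket x x = 0"
    and jacobi: "bracket x (bracket y z) + bracket y (bracket z x) + bracket z (bracket x y) = 0"

definition bracket_span :: "('a::real_vector \<Rightarrow> 'a \<Rightarrow> 'a) \<Rightarrow> 'a set \<Rightarrow> 'a set \<Rightarrow> 'a set" where
  "bracket_span bracket A B = span {bracket a b | a b. a \<in> A \<and> b \<in> B}"

primrec lower_central_series :: "('a::real_vector \<Rightarrow> 'a \<Rightarrow> 'a) \<Rightarrow> nat \<Rightarrow> 'a set" where
  "lower_central_series bracket 0 = UNIV"
| "lower_central_series bracket (Suc n) = bracket_span bracket UNIV (lower_central_series bracket n)"

definition nilpotent_lie_algebra :: "('a::real_vector \<Rightarrow> 'a \<Rightarrow> 'a) \<Rightarrow> bool" where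
  "nilpotent_lie_algebra bracket \<longleftrightarrow>
     lie_algebra bracket \<and> (\<exists>n. lower_central_series bracket n = {0})"

definition lie_subalgebra :: "('a::real_vector \<Rightarrow> 'a \<Rightarrow> 'a) \<Rightarrow> 'a set \<Rightarrow> bool" where
  "lie_subalgebra bracket S \<longleftrightarrow> subspace S \<and> bracket_span bracket S S \<subseteq> S"

definition complementary_subspaces :: "'a::real_vector set \<Rightarrow> 'a set \<Rightarrow> bool" where
  "complementary_subspaces H V \<longleftrightarrow>
     subspace H \<and> subspace V \<and> H \<inter> V = {0} \<and> {h + v | h v. h \<in> H \<and> v \<in> V} = UNIV"

definition respectful_decomposition ::
  "('a::real_vector \<Rightarrow> 'a \<Rightarrow> 'a) \<Rightarrow> 'a set \<Rightarrow> 'a set \<Rightarrow> bool" where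
  "respectful_decomposition bracket H V \<longleftrightarrow>
     complementary_subspaces H V \<and> bracket_span bracket V H \<subseteq> H"

definition open_respectful_decomposition ::
  "('a::real_vector \<Rightarrow> 'a \<Rightarrow> 'a) \<Rightarrow> 'a set \<Rightarrow> 'a set \<Rightarrow> bool" where
  "open_respectful_decomposition bracket H V \<longleftrightarrow>
     respectful_decomposition bracket H V \<and>
     \<not> lie_subalgebra bracket H \<and> \<not> lie_subalgebra bracket V"

definition lie_isomorphic ::
  "('a::real_vector \<Rightarrow> 'a \<Rightarrow> 'a) \<Rightarrow> ('b::real_vector \<Rightarrow> 'b \<Rightarrow> 'b) \<Rightarrow> bool" where
  "lie_isomorphic bracket bracket' \<longleftrightarrow>
     (\<exists>f. linear f \<and> bij f \<and> (\<forall>x y. f (bracket x y) = bracket' (f x) (f y)))"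

definition nilpotent_6_with_open_4_2 :: "('a::real_vector \<Rightarrow> 'a \<Rightarrow> 'a) \<Rightarrow> bool" where
  "nilpotent_6_with_open_4_2 bracket \<longleftrightarrow>
     dim (UNIV :: 'a set) = 6 \<and> nilpotent_lie_algebra bracket \<and>
     (\<exists>H V. open_respectful_decomposition bracket H V \<and> dim V = 2 \<and> dim H = 4)"

lemma lie_isomorphic_refl: "lie_isomorphic b b"
  unfolding lie_isomorphic_def by (rule exI[of _ id]) (auto simp: linear_id)

lemma lie_isomorphic_sym:
  assumes "lie_isomorphic b c"
  shows "lie_isomorphic c b"
proof -
  obtain f where f: "linear f" "bij f" "\<And>x y. f (b x y) = c (f x) (f y)"
    using assms unfolding lie_isomorphic_def by blast
  have inv: "f (inv f x) = x" "inv f (f y) = y" for x y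
    using surj_f_inv_f[OF bij_is_surj[OF f(2)]] inv_f_f[OF bij_is_inj[OF f(2)]] by blast+
  have "linear (inv f)"
  proof (rule linearI)
    show "inv f (x + y) = inv f x + inv f y" for x y
      using linear_add[OF f(1), of "inv f x" "inv f y"] inv(2)[of "inv f x + inv f y"]
      by (simp add: inv(1))
    show "inv f (r *\<^sub>R x) = r *\<^sub>R inv f x" for r x
      using linear_scale[OF f(1), of r "inv f x"] inv(2)[of "r *\<^sub>R inv f x"]
      by (simp add: inv(1))
  qed
  moreover have "inv f (c x y) = b (inv f x) (inv f y)" for x y
    using f(3)[of "inv f x" "inv f y"] inv(2)[of "b (inv f x) (inv f y)"] by (simp add: inv(1))
  ultimately show ?thesis
    unfolding lie_isomorphic_def using f(2) bij_imp_bij_inv by blast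
qed

lemma lie_isomorphic_trans:
  assumes "lie_isomorphic b c" "lie_isomorphic c d"
  shows "lie_isomorphic b d"
proof -
  obtain f where f: "linear f" "bij f" "\<And>x y. f (b x y) = c (f x) (f y)"
    using assms(1) unfolding lie_isomorphic_def by blast
  obtain g where g: "linear g" "bij g" "\<And>x y. g (c x y) = d (g x) (g y)"
    using assms(2) unfolding lie_isomorphic_def by blast
  have "linear (g \<circ> f)" "bij (g \<circ> f)" "\<forall>x y. (g \<circ> f) (b x y) = d ((g \<circ> f) x) ((g \<circ> f) y)"
    using f g by (auto simp: linear_compose bij_comp)
  then show ?thesis unfolding lie_isomorphic_def by blast
qed

lemma equiv_lie_isomorphic: "equiv UNIV {(b, c). lie_isomorphic b c}"
proof (rule equivI)
  show "refl {(b, c). lie_isomorphic b c}"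
    by (rule refl_onI) (simp add: lie_isomorphic_refl)
  show "sym {(b, c). lie_isomorphic b c}"
    by (rule symI) (simp add: lie_isomorphic_sym)
  show "trans {(b, c). lie_isomorphic b c}"
    by (rule transI) (use lie_isomorphic_trans in blast)
qed simp

end

theory Submission
  imports Defs
begin

text \<open>
  Nilpotency forces \<open>[V, V]\<close> to be a line \<open>\<langle>z\<rangle>\<close> in \<open>H\<close>. Let \<open>\<omega>(h, h')\<close> be the \<open>V\<close>-part of
  \<open>[h, h']\<close>; it is a nonzero alternating form on \<open>H / \<langle>z\<rangle>\<close>, which has dimension 3, and it is
  preserved by the action of \<open>V\<close>.

  If the values of \<open>\<omega>\<close> lie on a line \<open>\<langle>w\<rangle>\<close>, its radical \<open>R = \<langle>r, z\<rangle>\<close> is a plane and \<open>K = V + R\<close> acts on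
  \<open>H / R\<close> by commuting triangular matrices \<open>[k, x] = \<lambda>(k) y\<close>. When \<open>\<lambda>\<close> vanishes on \<open>R\<close>, the plane \<open>R\<close> is
  an ideal; otherwise \<open>z\<close> is central and the algebra is the extension by one operator of a subspace
  that is abelian modulo \<open>z\<close>. If \<open>\<omega>\<close> has values in all directions of \<open>V\<close>, the algebra is again of
  the second kind, and that operator is a single nilpotent Jordan block modulo \<open>z\<close>. Changes of basis bring both
  parametric families to 17 normal forms. These are told apart by the dimensions of the upper central
  series, of two centraliser-like subspaces attached to the derived algebra, and of the
  (not always linear) sets of elements with \<open>(ad u)\<^sup>n = 0\<close>; the latter see the signs that
  distinguish real forms.
\<close>

section \<open>Coordinates in dimension six\<close>

text \<open>Nilpotency says that no \<open>ad u\<close> has a nonzero eigenvalue on a quotient of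
  invariant subspaces. This is why \<open>[V, V]\<close> lies in \<open>H\<close>: a
  \<open>u2\<close>-part of \<open>[u1, u2]\<close> modulo \<open>H\<close> would be an eigenvalue
  of \<open>ad u1\<close> on \<open>u2\<close> modulo \<open>u1\<close> and \<open>H\<close>.
  Consequently \<open>[v, [h, h']]\<close> is in \<open>H\<close> whatever the \<open>V\<close>-part
  of \<open>[h, h']\<close> is, which gives the invariance of \<omega>; and \<open>z\<close> lies in
  the radical because \<open>ad z\<close> is a commutator of two maps preserving \<open>H\<close>. A
  form on a three-dimensional space with values in a plane vanishes on some pair of independent
  vectors, since every bivector in dimension three is decomposable. When the values of \<omega> fill
  \<open>V\<close>, this provides \<open>b\<close>, \<open>c\<close> with \<omega>(b, c) = 0. The
  obstacle is that \<open>H\<close> is no subalgebra and that the centrality of \<open>z\<close> and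
  the triangular shape of the actions are not given. They have to be won from Jacobi identities and
  vanishing determinants before a multiplication table can be written down. The families overlap: of
  the chain algebras that occur, all but one isomorphism class also belong to the other family, so
  that 17 = 16 + 1.\<close>

lemma exhaust6: "(i::6) = 1 \<or> i = 2 \<or> i = 3 \<or> i = 4 \<or> i = 5 \<or> i = 6"
proof (induct i)
  case (of_int z)
  then have "z = 0 \<or> z = 1 \<or> z = 2 \<or> z = 3 \<or> z = 4 \<or> z = 5" by simp arith
  then show ?case by auto
qed

lemma forall6: "(\<forall>i::6. P i) \<longleftrightarrow> P 1 \<and> P 2 \<and> P 3 \<and> P 4 \<and> P 5 \<and> P 6"
  by (metis exhaust6)

definition vec6 :: "real \<Rightarrow> real \<Rightarrow> real \<Rightarrow> real \<Rightarrow> real \<Rightarrow> real \<Rightarrow> real^6" where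
 "vec6 a b c d e f = (\<chi> i. if i = 1 then a else if i = 2 then b else if i = 3 then c
    else if i = 4 then d else if i = 5 then e else f)"

lemma vec6_nth [simp]:
  "vec6 a b c d e f $ 1 = a" "vec6 a b c d e f $ 2 = b" "vec6 a b c d e f $ 3 = c"
  "vec6 a b c d e f $ 4 = d" "vec6 a b c d e f $ 5 = e" "vec6 a b c d e f $ 6 = f"
  by (simp_all add: vec6_def)

lemma vec6_eq_iff:
  "u = t \<longleftrightarrow> u$1 = t$1 \<and> u$2 = t$2 \<and> u$3 = t$3 \<and> u$4 = t$4 \<and> u$5 = t$5 \<and> u$6 = t$6"
  for u t :: "real^6"
  by (simp add: vec_eq_iff forall6)

definition comb6 :: "'a \<Rightarrow> 'a \<Rightarrow> 'a \<Rightarrow> 'a \<Rightarrow> 'a \<Rightarrow> 'a \<Rightarrow> real^6 \<Rightarrow> 'a::real_vector" where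
  "comb6 e1 e2 e3 e4 e5 e6 u =
     u$1 *\<^sub>R e1 + u$2 *\<^sub>R e2 + u$3 *\<^sub>R e3 + u$4 *\<^sub>R e4 + u$5 *\<^sub>R e5 + u$6 *\<^sub>R e6"

lemma linear_comb6: "linear (comb6 e1 e2 e3 e4 e5 e6)"
  by (rule linearI) (simp_all add: comb6_def algebra_simps)

lemma range_comb6: "range (comb6 e1 e2 e3 e4 e5 e6) = span {e1, e2, e3, e4, e5, e6}"
proof
  show "range (comb6 e1 e2 e3 e4 e5 e6) \<subseteq> span {e1, e2, e3, e4, e5, e6}"
    by (auto simp: comb6_def intro!: span_add span_scale intro: span_base)
  have "x \<in> range (comb6 e1 e2 e3 e4 e5 e6)" if "x \<in> {e1, e2, e3, e4, e5, e6}" for x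
  proof -
    have "comb6 e1 e2 e3 e4 e5 e6 (vec6 1 0 0 0 0 0) = e1" "comb6 e1 e2 e3 e4 e5 e6 (vec6 0 1 0 0 0 0) = e2"
      "comb6 e1 e2 e3 e4 e5 e6 (vec6 0 0 1 0 0 0) = e3" "comb6 e1 e2 e3 e4 e5 e6 (vec6 0 0 0 1 0 0) = e4"
      "comb6 e1 e2 e3 e4 e5 e6 (vec6 0 0 0 0 1 0) = e5" "comb6 e1 e2 e3 e4 e5 e6 (vec6 0 0 0 0 0 1) = e6"
      by (simp_all add: comb6_def)
    then show ?thesis using that by (metis insertE empty_iff rangeI)
  qed
  then show "span {e1, e2, e3, e4, e5, e6} \<subseteq> range (comb6 e1 e2 e3 e4 e5 e6)"
    by (intro span_minimal subsetI linear_subspace_image[OF linear_comb6]) auto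
qed

text \<open>The dimension count takes place in \<open>real^6\<close>: a linear right inverse
  \<open>g\<close> of the surjection carries a basis of the target to six independent vectors, so
  \<open>g\<close> is onto and therefore a two-sided inverse.\<close>

lemma bij_comb6:
  fixes e1 :: "'a::real_vector"
  assumes "dim (UNIV :: 'a set) = 6" "span {e1, e2, e3, e4, e5, e6} = UNIV"
  shows "bij (comb6 e1 e2 e3 e4 e5 e6)"
proof -
  let ?f = "comb6 e1 e2 e3 e4 e5 e6"
  have surj: "surj ?f" using assms(2) range_comb6 by metis
  obtain g where g: "linear g" "?f \<circ> g = id"
    using linear_surjective_right_inverse[OF linear_comb6 surj] by blast
  have inj: "inj g" using g(2) by (metis inj_on_id inj_on_imageI2)
  obtain B :: "'a set" where B: "independent B" "UNIV \<subseteq> span B" "card B = 6"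
    using real_vector.basis_exists[of "UNIV :: 'a set"] assms(1) by metis
  have "independent (g ` B)"
    by (rule linear_independent_injective_image[OF g(1) B(1)]) (use inj in \<open>simp add: inj_on_def\<close>)
  moreover have "card (g ` B) = 6"
    using card_image[of g B] inj B(3) by (metis inj_on_subset subset_UNIV)
  ultimately have "UNIV \<subseteq> span (g ` B)"
    by (intro card_ge_dim_independent) auto
  then have "surj g"
    using span_subspace[of "g ` B" "range g"] linear_subspace_image[OF g(1) subspace_UNIV]
      span_minimal[of "g ` B" "range g"] by blast
  then have "g \<circ> ?f = id"
    using g(2) by (metis comp_assoc comp_id id_comp surj_iff)
  then have "inj ?f" by (metis inj_on_id inj_on_imageI2)
  then show ?thesis using surj by (simp add: bij_def)
qed


section \<open>Lie brackets with central last basis vector\<close>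

context lie_algebra begin

lemma bracket_simps [simp]:
  "bracket (x + y) z = bracket x z + bracket y z" "bracket x (y + z) = bracket x y + bracket x z"
  "bracket (x - y) z = bracket x z - bracket y z" "bracket x (y - z) = bracket x y - bracket x z"
  "bracket (- x) z = - bracket x z" "bracket x (- z) = - bracket x z"
  "bracket (c *\<^sub>R x) z = c *\<^sub>R bracket x z" "bracket x (c *\<^sub>R z) = c *\<^sub>R bracket x z"
  "bracket 0 z = 0" "bracket x 0 = 0" "bracket x x = 0"
  using bilinear_bracket bracket_self
  by (auto simp: bilinear_ladd bilinear_radd bilinear_lsub bilinear_rsub bilinear_lneg bilinear_rneg
      bilinear_lmul bilinear_rmul bilinear_lzero bilinear_rzero)

lemma antisym: "bracket x y = - bracket y x"
proof -
  have "bracket (x + y) (x + y) = bracket x y + bracket y x"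
    unfolding bracket_simps(1,2) by simp
  then show ?thesis by (metis bracket_self eq_neg_iff_add_eq_0)
qed

lemma leibniz: "bracket x (bracket y z) = bracket (bracket x y) z + bracket y (bracket x z)"
proof -
  have "bracket x (bracket y z) - bracket y (bracket x z) - bracket (bracket x y) z = 0"
    using jacobi[of x y z] antisym[of z x] antisym[of z "bracket x y"] by simp
  then show ?thesis by (simp add: algebra_simps)
qed

end

text \<open>All normal forms have a central sixth basis vector, so the ten brackets of the first
  five basis vectors determine the algebra. The result is alternating and bilinear for any choice of
  them; the Jacobi identity is a separate matter.\<close>

definition mk6 :: "real^6 \<Rightarrow> real^6 \<Rightarrow> real^6 \<Rightarrow> real^6 \<Rightarrow> real^6 \<Rightarrow> real^6 \<Rightarrow> real^6 \<Rightarrow> real^6 \<Rightarrow>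
    real^6 \<Rightarrow> real^6 \<Rightarrow> real^6 \<Rightarrow> real^6 \<Rightarrow> real^6" where
  "mk6 b12 b13 b14 b15 b23 b24 b25 b34 b35 b45 u t =
     (u$1 * t$2 - u$2 * t$1) *\<^sub>R b12 + (u$1 * t$3 - u$3 * t$1) *\<^sub>R b13
   + (u$1 * t$4 - u$4 * t$1) *\<^sub>R b14 + (u$1 * t$5 - u$5 * t$1) *\<^sub>R b15
   + (u$2 * t$3 - u$3 * t$2) *\<^sub>R b23 + (u$2 * t$4 - u$4 * t$2) *\<^sub>R b24
   + (u$2 * t$5 - u$5 * t$2) *\<^sub>R b25 + (u$3 * t$4 - u$4 * t$3) *\<^sub>R b34
   + (u$3 * t$5 - u$5 * t$3) *\<^sub>R b35 + (u$4 * t$5 - u$5 * t$4) *\<^sub>R b45"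

lemma mk6_nth:
  "mk6 b12 b13 b14 b15 b23 b24 b25 b34 b35 b45 u t $ k =
     (u$1 * t$2 - u$2 * t$1) * b12$k + (u$1 * t$3 - u$3 * t$1) * b13$k
   + (u$1 * t$4 - u$4 * t$1) * b14$k + (u$1 * t$5 - u$5 * t$1) * b15$k
   + (u$2 * t$3 - u$3 * t$2) * b23$k + (u$2 * t$4 - u$4 * t$2) * b24$k
   + (u$2 * t$5 - u$5 * t$2) * b25$k + (u$3 * t$4 - u$4 * t$3) * b34$k
   + (u$3 * t$5 - u$5 * t$3) * b35$k + (u$4 * t$5 - u$5 * t$4) * b45$k"
  by (simp add: mk6_def)

lemma bilinear_mk6: "bilinear (mk6 b12 b13 b14 b15 b23 b24 b25 b34 b35 b45)"
  unfolding bilinear_def by (intro conjI allI linearI) (simp_all add: mk6_def algebra_simps)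

lemma mk6_self: "mk6 b12 b13 b14 b15 b23 b24 b25 b34 b35 b45 u u = 0"
  by (simp add: mk6_def)

lemma (in lie_algebra) isomorphic_mk6:
  assumes dim: "dim (UNIV :: 'a set) = 6" and span: "span {e1, e2, e3, e4, e5, e6} = UNIV"
    and c: "bracket e1 e2 = comb6 e1 e2 e3 e4 e5 e6 c12" "bracket e1 e3 = comb6 e1 e2 e3 e4 e5 e6 c13"
      "bracket e1 e4 = comb6 e1 e2 e3 e4 e5 e6 c14" "bracket e1 e5 = comb6 e1 e2 e3 e4 e5 e6 c15"
      "bracket e2 e3 = comb6 e1 e2 e3 e4 e5 e6 c23" "bracket e2 e4 = comb6 e1 e2 e3 e4 e5 e6 c24"
      "bracket e2 e5 = comb6 e1 e2 e3 e4 e5 e6 c25" "bracket e3 e4 = comb6 e1 e2 e3 e4 e5 e6 c34"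
      "bracket e3 e5 = comb6 e1 e2 e3 e4 e5 e6 c35" "bracket e4 e5 = comb6 e1 e2 e3 e4 e5 e6 c45"
    and z: "bracket e1 e6 = 0" "bracket e2 e6 = 0" "bracket e3 e6 = 0" "bracket e4 e6 = 0" "bracket e5 e6 = 0"
  shows "lie_isomorphic bracket (mk6 c12 c13 c14 c15 c23 c24 c25 c34 c35 c45)"
proof -
  let ?f = "comb6 e1 e2 e3 e4 e5 e6"
  have "?f (mk6 c12 c13 c14 c15 c23 c24 c25 c34 c35 c45 u t) = bracket (?f u) (?f t)" for u t
  proof -
    have "?f (mk6 c12 c13 c14 c15 c23 c24 c25 c34 c35 c45 u t) =
       (u$1 * t$2 - u$2 * t$1) *\<^sub>R ?f c12 + (u$1 * t$3 - u$3 * t$1) *\<^sub>R ?f c13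
     + (u$1 * t$4 - u$4 * t$1) *\<^sub>R ?f c14 + (u$1 * t$5 - u$5 * t$1) *\<^sub>R ?f c15
     + (u$2 * t$3 - u$3 * t$2) *\<^sub>R ?f c23 + (u$2 * t$4 - u$4 * t$2) *\<^sub>R ?f c24
     + (u$2 * t$5 - u$5 * t$2) *\<^sub>R ?f c25 + (u$3 * t$4 - u$4 * t$3) *\<^sub>R ?f c34
     + (u$3 * t$5 - u$5 * t$3) *\<^sub>R ?f c35 + (u$4 * t$5 - u$5 * t$4) *\<^sub>R ?f c45"
      by (simp add: mk6_def linear_add[OF linear_comb6] linear_scale[OF linear_comb6])
    also have "\<dots> = bracket (?f u) (?f t)"
      unfolding c[symmetric]
      by (subst (2) comb6_def, subst comb6_def)
        (simp add: z antisym[of e1 e2] antisym[of e1 e3] antisym[of e1 e4] antisym[of e1 e5]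
         antisym[of e2 e3] antisym[of e2 e4] antisym[of e2 e5] antisym[of e3 e4] antisym[of e3 e5]
         antisym[of e4 e5] antisym[of e6 e1] antisym[of e6 e2] antisym[of e6 e3] antisym[of e6 e4]
         antisym[of e6 e5] algebra_simps)
    finally show ?thesis .
  qed
  then have "lie_isomorphic (mk6 c12 c13 c14 c15 c23 c24 c25 c34 c35 c45) bracket"
    unfolding lie_isomorphic_def using linear_comb6 bij_comb6[OF dim span] by blast
  then show ?thesis by (rule lie_isomorphic_sym)
qed

section \<open>Two parametric families\<close>

text \<open>Every reduction step uses the Jacobi constraints on its parameters afresh. Carrying the
  axioms along the isomorphism supplies them without checking the Jacobi identity of the target
  table.\<close>

lemma lie_algebra_transport:
  assumes "lie_algebra b" "lie_isomorphic b c"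
  shows "lie_algebra c"
proof -
  obtain f where f: "linear f" "bij f" "\<And>x y. f (b x y) = c (f x) (f y)"
    using assms(2) unfolding lie_isomorphic_def by blast
  interpret lie_algebra b by fact
  have surj: "\<exists>x. y = f x" for y using bij_is_surj[OF f(2)] by blast
  have lin: "f (x + y) = f x + f y" "f (r *\<^sub>R x) = r *\<^sub>R f x" for x y r
    using linear_add[OF f(1)] linear_scale[OF f(1)] by auto
  show ?thesis
  proof
    show "bilinear c" unfolding bilinear_def
    proof (intro conjI allI linearI)
      fix x y z r
      obtain x' y' z' where [simp]: "x = f x'" "y = f y'" "z = f z'" using surj by metis
      show "c x (y + z) = c x y + c x z" "c (y + z) x = c y x + c z x"
        "c x (r *\<^sub>R y) = r *\<^sub>R c x y" "c (r *\<^sub>R y) x = r *\<^sub>R c y x"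
        by (simp_all add: f(3)[symmetric] lin[symmetric])
    qed
    show "c x x = 0" for x
      using surj[of x] bracket_self linear_0[OF f(1)] f(3) by metis
    show "c x (c y z) + c y (c z x) + c z (c x y) = 0" for x y z
    proof -
      obtain x' y' z' where [simp]: "x = f x'" "y = f y'" "z = f z'" using surj by metis
      show ?thesis by (simp add: f(3)[symmetric] lin(1)[symmetric] jacobi linear_0[OF f(1)] del: bracket_simps)
    qed
  qed
qed

text \<open>The working form of each change of basis below: the new basis is given in old
  coordinates, and in \<open>real^6\<close> its independence is enough.\<close>

lemma isomorphic_mk6_coords:
  fixes b :: "real^6 \<Rightarrow> real^6 \<Rightarrow> real^6"
  assumes lie: "lie_algebra b" and d: "d = mk6 c12 c13 c14 c15 c23 c24 c25 c34 c35 c45"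
    and inj: "\<And>t. comb6 e1 e2 e3 e4 e5 e6 t = 0 \<Longrightarrow> t = 0"
    and c: "b e1 e2 = comb6 e1 e2 e3 e4 e5 e6 c12" "b e1 e3 = comb6 e1 e2 e3 e4 e5 e6 c13"
      "b e1 e4 = comb6 e1 e2 e3 e4 e5 e6 c14" "b e1 e5 = comb6 e1 e2 e3 e4 e5 e6 c15"
      "b e2 e3 = comb6 e1 e2 e3 e4 e5 e6 c23" "b e2 e4 = comb6 e1 e2 e3 e4 e5 e6 c24"
      "b e2 e5 = comb6 e1 e2 e3 e4 e5 e6 c25" "b e3 e4 = comb6 e1 e2 e3 e4 e5 e6 c34"
      "b e3 e5 = comb6 e1 e2 e3 e4 e5 e6 c35" "b e4 e5 = comb6 e1 e2 e3 e4 e5 e6 c45"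
    and z: "b e1 e6 = 0" "b e2 e6 = 0" "b e3 e6 = 0" "b e4 e6 = 0" "b e5 e6 = 0"
  shows "lie_isomorphic b d"
  unfolding d
proof (rule lie_algebra.isomorphic_mk6[OF lie _ _ c z])
  show "dim (UNIV :: (real^6) set) = 6" by simp
  have "inj (comb6 e1 e2 e3 e4 e5 e6)"
    using linear_injective_0[OF linear_comb6] inj by blast
  then show "span {e1, e2, e3, e4, e5, e6} = UNIV"
    using linear_injective_imp_surjective[OF linear_comb6] range_comb6 by metis
qed

text \<open>
  In the basis \<open>x, v, y, w, r\<^sub>1, r\<^sub>2\<close>: the span of \<open>r\<^sub>1, r\<^sub>2\<close> is the ideal \<open>R\<close>, on which \<open>x, v, y, w\<close> act by
  multiples of \<open>r\<^sub>1 \<mapsto> r\<^sub>2\<close>, and \<open>w = [x, y]\<close>.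
\<close>

definition ideal_fam where
  "ideal_fam l p1 p2 a1 a2 mx q1 q2 c1 c2 mv b1 b2 my mw =
     mk6 (vec6 0 0 l 0 p1 p2) (vec6 0 0 0 1 0 0) (vec6 0 0 0 0 a1 a2) (vec6 0 0 0 0 0 mx)
         (vec6 0 0 0 0 q1 q2) (vec6 0 0 0 0 c1 c2) (vec6 0 0 0 0 0 mv) (vec6 0 0 0 0 b1 b2)
         (vec6 0 0 0 0 0 my) (vec6 0 0 0 0 0 mw)"

text \<open>
  In the basis \<open>x, v, r, y, w, z\<close>: the operator \<open>ad x\<close> is the chain \<open>v \<mapsto> g r\<close>, \<open>r \<mapsto> y \<mapsto> w \<mapsto> 0\<close> modulo the
  central \<open>z\<close>, and the remaining brackets are multiples of \<open>z\<close>.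
\<close>

definition chain_fam where
  "chain_fam g t1 tau k e s eta k' th =
     mk6 (vec6 0 0 g 0 0 t1) (vec6 0 0 0 1 0 0) (vec6 0 0 0 0 1 0) (vec6 0 0 0 0 0 tau)
         (vec6 0 0 0 0 0 k) (vec6 0 0 0 0 0 e) (vec6 0 0 0 0 0 s) (vec6 0 0 0 0 0 eta)
         (vec6 0 0 0 0 0 k') (vec6 0 0 0 0 0 th)"

text \<open>The table left of \<open>ideal_fam\<close> once \<open>y\<close> and \<open>w\<close>
  act trivially on \<open>R\<close>. The coefficient \<open>mx * q1\<close> of \<open>[v, w]\<close>
  is what the Jacobi identity on \<open>x\<close>, \<open>v\<close>, \<open>y\<close>
  forces.\<close>

definition nform where
  "nform l mx mv p q1 q2 a1 a2 b =
     mk6 (vec6 0 0 l 0 p 0) (vec6 0 0 0 1 0 0) (vec6 0 0 0 0 a1 a2) (vec6 0 0 0 0 0 mx)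
         (vec6 0 0 0 0 q1 q2) (vec6 0 0 0 0 0 (mx * q1)) (vec6 0 0 0 0 0 mv) (vec6 0 0 0 0 0 b) 0 0"

text \<open>On \<open>R\<close> the generators act by multiples of one map and hence commute, so
  \<open>w = [x, y]\<close> and the \<open>y\<close>-part of \<open>[x, v]\<close> act trivially:
  this is \<open>mw = 0\<close> and \<open>l * my = 0\<close>. The other relations come from triples
  among \<open>x\<close>, \<open>v\<close>, \<open>y\<close>, \<open>w\<close>.\<close>

lemma ideal_fam_jacobi:
  assumes "lie_algebra (ideal_fam l p1 p2 a1 a2 mx q1 q2 c1 c2 mv b1 b2 my mw)"
  shows "mw = 0" "l * my = 0" "c1 = 0" "c2 = q1 * mx + p1 * my" "a1 * mv + l * b2 = 0" "l * b1 = 0"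
    "b1 * mx = a1 * my" "b1 * mv = 0"
proof -
  interpret lie_algebra "ideal_fam l p1 p2 a1 a2 mx q1 q2 c1 c2 mv b1 b2 my mw" by fact
  let ?x = "vec6 1 0 0 0 0 0" and ?v = "vec6 0 1 0 0 0 0" and ?y = "vec6 0 0 1 0 0 0"
    and ?w = "vec6 0 0 0 1 0 0" and ?r = "vec6 0 0 0 0 1 0"
  note defs = ideal_fam_def mk6_nth vec6_eq_iff
  show mw: "mw = 0" using jacobi[of ?x ?y ?r] by (simp add: defs)
  show "l * my = 0" using jacobi[of ?x ?v ?r] by (simp add: defs)
  show 1: "c1 = 0" using jacobi[of ?x ?v ?y] by (simp add: defs)
  show "c2 = q1 * mx + p1 * my" using jacobi[of ?x ?v ?y] by (simp add: defs algebra_simps)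
  show "a1 * mv + l * b2 = 0" using jacobi[of ?x ?v ?w] 1 mw by (simp add: defs algebra_simps)
  show "l * b1 = 0" using jacobi[of ?x ?v ?w] by (simp add: defs algebra_simps)
  show "b1 * mx = a1 * my" using jacobi[of ?x ?y ?w] mw by (simp add: defs algebra_simps)
  show "b1 * mv = 0" using jacobi[of ?v ?y ?w] 1 mw by (simp add: defs algebra_simps)
qed

lemmas table_simps = nform_def ideal_fam_def chain_fam_def mk6_nth vec6_eq_iff comb6_def field_simps power2_eq_square

text \<open>Since \<open>z\<close> is central, the brackets among \<open>v\<close>,
  \<open>r\<close>, \<open>y\<close>, \<open>w\<close> are an alternating form with values in its
  line, and the Jacobi identity with \<open>x\<close> says that \<open>ad x\<close> is skew for this
  form.\<close>

lemma chain_fam_jacobi: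
  assumes "lie_algebra (chain_fam g t1 tau k e s eta k' th)"
  shows "e = 0" "s = - (g * eta)" "k' = 0" "th = 0"
proof -
  interpret lie_algebra "chain_fam g t1 tau k e s eta k' th" by fact
  let ?x = "vec6 1 0 0 0 0 0" and ?v = "vec6 0 1 0 0 0 0" and ?r = "vec6 0 0 1 0 0 0"
    and ?y = "vec6 0 0 0 1 0 0" and ?w = "vec6 0 0 0 0 1 0"
  note defs = chain_fam_def mk6_nth vec6_eq_iff
  show "e = 0" using jacobi[of ?x ?v ?r] by (simp add: defs)
  show "s = - (g * eta)" using jacobi[of ?x ?v ?y] by (simp add: defs algebra_simps)
  show "k' = 0" using jacobi[of ?x ?r ?y] by (simp add: defs algebra_simps)
  show "th = 0" using jacobi[of ?x ?r ?w] by (simp add: defs algebra_simps)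
qed

section \<open>Normal forms of \<open>ideal_fam\<close> with nonzero \<open>l\<close>\<close>

lemma ideal_fam_rescale_l:
  assumes lie: "lie_algebra (ideal_fam l p1 p2 a1 a2 mx q1 q2 c1 c2 mv b1 b2 my mw)"
    and l: "l \<noteq> 0"
  shows "lie_isomorphic (ideal_fam l p1 p2 a1 a2 mx q1 q2 c1 c2 mv b1 b2 my mw)
    (nform 1 mx (mv/l) 0 (q1/l) (q2/l + p1*mv/l^2) a1 a2 (- (a1 * (mv/l))))"
proof -
  have j: "mw = 0" "my = 0" "c1 = 0" "c2 = q1 * mx" "b2 = - (a1 * mv / l)" "b1 = 0"
    using ideal_fam_jacobi[OF lie] l by (auto simp: field_simps)
  \<comment> \<open>The new \<open>y\<close> is the bracket of \<open>x\<close> with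
    \<open>v/l\<close>, which absorbs \<open>p1\<close> and \<open>p2\<close>; the new
    \<open>w\<close> is the bracket of \<open>x\<close> with it.\<close>
  show ?thesis
    by (rule isomorphic_mk6_coords[OF lie nform_def, of
      "vec6 1 0 0 0 0 0" "vec6 0 (1/l) 0 0 0 0" "vec6 0 0 1 0 (p1/l) (p2/l)"
      "vec6 0 0 0 1 0 (p1*mx/l)" "vec6 0 0 0 0 1 0" "vec6 0 0 0 0 0 1"])
     (use assms(2-) j in \<open>auto simp: table_simps\<close>)
qed

lemma nform_mv0_a1:
  assumes lie: "lie_algebra (nform 1 m 0 0 q1 q2 a1 a2 0)"
    and mq: "m \<noteq> 0" "q1 \<noteq> 0" and a1: "a1 \<noteq> 0"
  shows "lie_isomorphic (nform 1 m 0 0 q1 q2 a1 a2 0)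
    (nform 1 1 0 0 1 0 1 0 0)"
proof -
  \<comment> \<open>Scaling \<open>v\<close> by \<open>u\<close> matches the \<open>r1\<close>-parts
    of \<open>[x, w]\<close> and \<open>[v, y]\<close>. Replacing \<open>x\<close> by
    \<open>x + c*v\<close> changes the \<open>r2\<close>-part of \<open>[x, w]\<close> by
    \<open>2*m*q1*c\<close>, once through the \<open>r1\<close>-part of the new \<open>w\<close> and
    once through \<open>[v, w]\<close>; this \<open>c\<close> matches the
    \<open>r2\<close>-parts.\<close>
  define c where "c = (a1 * q2 / q1 - a2) / (2*m*q1)"
  define u where "u = a1 / q1"
  have s: "a2 = u * q2 - 2*m*q1*c" "a1 = u * q1" "u \<noteq> 0"
    using mq a1 by (simp_all add: c_def u_def field_simps)
  show ?thesis
    by (rule isomorphic_mk6_coords[OF lie nform_def, of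
      "vec6 1 c 0 0 0 0" "vec6 0 u 0 0 0 0" "vec6 0 0 u 0 0 0"
      "vec6 0 0 0 u (u*c*q1) (u*c*q2)" "vec6 0 0 0 0 (u^2*q1) (u^2*q2)" "vec6 0 0 0 0 0 (u^2*q1*m)"])
     (use assms(2-) in \<open>auto simp: table_simps s\<close>)
qed

lemma nform_mv0:
  assumes lie: "lie_algebra (nform 1 m 0 0 q1 q2 0 a2 0)"
    and mq: "m \<noteq> 0" "q1 \<noteq> 0"
  shows "lie_isomorphic (nform 1 m 0 0 q1 q2 0 a2 0)
    (nform 1 1 0 0 1 0 0 0 0)"
proof -
  define c where "c = - a2 / (2*m*q1)"
  have s: "a2 = - (2*m*q1*c)" using mq by (simp add: c_def field_simps)
  show ?thesis
    by (rule isomorphic_mk6_coords[OF lie nform_def, of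
      "vec6 1 c 0 0 0 0" "vec6 0 1 0 0 0 0" "vec6 0 0 1 0 0 0"
      "vec6 0 0 0 1 (c*q1) (c*q2)" "vec6 0 0 0 0 q1 q2" "vec6 0 0 0 0 0 (q1*m)"])
     (use assms(2-) s in \<open>auto simp: table_simps\<close>)
qed

text \<open>
  With \<open>r\<^sub>2 = [x, r\<^sub>1] = [v, w]\<close> the pairing of the generators is a hyperbolic plane, which \<open>x + v\<close> and \<open>v - x\<close> diagonalise.
\<close>

lemma nform_hyperbolic:
  assumes lie: "lie_algebra (nform 1 1 0 0 1 0 0 0 0)"
  shows "lie_isomorphic (nform 1 1 0 0 1 0 0 0 0)
    (nform 1 0 1 0 1 0 0 (-1) 0)"
  by (rule isomorphic_mk6_coords[OF lie nform_def, of
      "vec6 1 1 0 0 0 0" "vec6 (-1) 1 0 0 0 0" "vec6 0 0 2 0 0 0"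
      "vec6 0 0 0 2 2 0" "vec6 0 0 0 (-2) 2 0" "vec6 0 0 0 0 0 (-4)"])
     (auto simp: table_simps)

text \<open>\<open>x\<close> and \<open>v\<close> act on \<open>R\<close> by \<open>m\<close> and
  \<open>n\<close> times the same map, so \<open>x - (m/n)*v\<close> acts trivially. The last
  parameter \<open>- (a1*n)\<close> is dictated by the Jacobi identity on \<open>x\<close>,
  \<open>v\<close>, \<open>w\<close>.\<close>

lemma nform_eliminate_mx:
  assumes lie: "lie_algebra (nform 1 m n 0 q1 q2 a1 a2 (- (a1*n)))"
    and n: "n \<noteq> 0"
  shows "lie_isomorphic (nform 1 m n 0 q1 q2 a1 a2 (- (a1*n)))
    (nform 1 0 1 0 q1 (q2/n) a1 ((a2 - m*m*q1/n)/n) (- a1))"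
  by (rule isomorphic_mk6_coords[OF lie nform_def, of
      "vec6 1 (-(m/n)) 0 0 0 0" "vec6 0 1 0 0 0 0" "vec6 0 0 1 0 0 0"
      "vec6 0 0 0 1 (-(m/n*q1)) (-(m/n*q2))" "vec6 0 0 0 0 1 0" "vec6 0 0 0 0 0 n"])
     (use assms(2-) in \<open>auto simp: table_simps\<close>)

text \<open>Scaling \<open>v\<close> by \<open>u\<close> scales \<open>[v, y]\<close> by
  \<open>u^2\<close> and \<open>[v, [v, y]]\<close> by \<open>u^3\<close>, but \<open>[x, w]\<close>
  only by \<open>u\<close>. Hence \<open>a2/q1\<close> matters up to a positive factor, and its sign
  cannot be scaled away.\<close>

lemma nform_scale_q1:
  assumes lie: "lie_algebra (nform 1 0 1 0 q1 q2 0 a2 0)"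
    and q1: "q1 \<noteq> 0" and u: "u \<noteq> 0" and eps: "a2 = eps * u^2 * q1"
  shows "lie_isomorphic (nform 1 0 1 0 q1 q2 0 a2 0)
    (nform 1 0 1 0 1 0 0 eps 0)"
  by (rule isomorphic_mk6_coords[OF lie nform_def, of
      "vec6 1 0 0 0 0 0" "vec6 0 u 0 0 0 0" "vec6 0 0 u 0 0 0"
      "vec6 0 0 0 u 0 0" "vec6 0 0 0 0 (u^2*q1) (u^2*q2)" "vec6 0 0 0 0 0 (u^3*q1)"])
     (use assms(2-) in \<open>auto simp: table_simps power3_eq_cube\<close>)

lemma nform_scale_q1_a1:
  assumes lie: "lie_algebra (nform 1 0 1 0 q1 q2 a1 a2 (- a1))"
    and q1: "q1 \<noteq> 0" and a1: "a1 \<noteq> 0"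
  shows "lie_isomorphic (nform 1 0 1 0 q1 q2 a1 a2 (- a1))
    (nform 1 0 1 0 1 0 1 0 (-1))"
proof -
  define u where "u = a1 / q1"
  \<comment> \<open>Adding \<open>c*w\<close> to \<open>v\<close> changes the \<open>r2\<close>-part
    of \<open>[v, y]\<close> by \<open>2*a1*c\<close>: once through \<open>[w, y]\<close> and once
    through the \<open>r1\<close>-part that \<open>y = [x, v]\<close> acquires.\<close>
  define c where "c = (a2 / u - q2) / (2*a1)"
  have s: "a1 = u * q1" "u \<noteq> 0" using q1 a1 by (simp_all add: u_def)
  have s': "a2 = u * (q2 + 2*c*(u*q1))"
    unfolding c_def using s q1 a1 by (simp add: field_simps)
  show ?thesis
    by (rule isomorphic_mk6_coords[OF lie nform_def, of
      "vec6 1 0 0 0 0 0" "vec6 0 u 0 (u*c) 0 0" "vec6 0 0 u 0 (u*c*a1) (u*c*a2)"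
      "vec6 0 0 0 u 0 0" "vec6 0 0 0 0 (u*a1) (u*a2)" "vec6 0 0 0 0 0 (u^2*a1)"])
     (use assms(2-) s s' in \<open>auto simp: table_simps\<close>)
qed

lemma nform_scale_q2_a2:
  assumes lie: "lie_algebra (nform 1 0 1 0 0 q2 0 a2 0)"
    and u: "u \<noteq> 0" and t: "t \<noteq> 0"
  shows "lie_isomorphic (nform 1 0 1 0 0 q2 0 a2 0)
    (nform 1 0 1 0 0 (u*q2/t) 0 (a2/t) 0)"
  by (rule isomorphic_mk6_coords[OF lie nform_def, of
      "vec6 1 0 0 0 0 0" "vec6 0 u 0 0 0 0" "vec6 0 0 u 0 0 0"
      "vec6 0 0 0 u 0 0" "vec6 0 0 0 0 t 0" "vec6 0 0 0 0 0 (u*t)"])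
     (use assms(2-) in \<open>auto simp: table_simps\<close>)

text \<open>Only \<open>[x, v] = y\<close>, \<open>[x, y] = w\<close> and
  \<open>[v, r1] = r2\<close> remain, so exchanging \<open>x\<close> and \<open>v\<close> exchanges,
  up to sign, the planes of \<open>y\<close>, \<open>w\<close> and of \<open>r1\<close>,
  \<open>r2\<close>.\<close>

lemma nform_l1_to_l0:
  assumes lie: "lie_algebra (nform 1 0 1 0 0 0 0 0 0)"
  shows "lie_isomorphic (nform 1 0 1 0 0 0 0 0 0)
    (nform 0 0 1 1 0 0 0 0 0)"
  by (rule isomorphic_mk6_coords[OF lie nform_def, of
      "vec6 0 1 0 0 0 0" "vec6 1 0 0 0 0 0" "vec6 0 0 0 0 1 0"
      "vec6 0 0 0 0 0 1" "vec6 0 0 (-1) 0 0 0" "vec6 0 0 0 (-1) 0 0"])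
     (auto simp: table_simps)

lemma nform_eliminate_q2:
  assumes lie: "lie_algebra (nform 1 0 1 0 0 q2 a1 a2 (- a1))"
    and a1: "a1 \<noteq> 0"
  shows "lie_isomorphic (nform 1 0 1 0 0 q2 a1 a2 (- a1))
    (nform 1 0 1 0 0 0 1 0 (-1))"
proof -
  define c where "c = - q2 / (2*a1)"
  have s: "q2 = - (2*a1*c)" using a1 by (simp add: c_def field_simps)
  show ?thesis
    by (rule isomorphic_mk6_coords[OF lie nform_def, of
      "vec6 1 0 0 0 0 0" "vec6 0 1 0 c 0 0" "vec6 0 0 1 0 (c*a1) (c*a2)"
      "vec6 0 0 0 1 0 0" "vec6 0 0 0 0 a1 a2" "vec6 0 0 0 0 0 a1"])
     (use assms(2-) s in \<open>auto simp: table_simps\<close>)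
qed

section \<open>Normal forms of \<open>ideal_fam\<close> with \<open>l = 0\<close>\<close>

lemma ideal_fam_eliminate_mx_my:
  assumes lie: "lie_algebra (ideal_fam 0 p1 p2 a1 a2 mx q1 q2 c1 c2 mv b1 b2 my mw)"
    and mv: "mv \<noteq> 0"
  shows "lie_isomorphic (ideal_fam 0 p1 p2 a1 a2 mx q1 q2 c1 c2 mv b1 b2 my mw)
    (nform 0 0 1 p1 q1 0 0 ((a2 - mx/mv*c2)/mv) ((b2 - my/mv*c2)/mv))"
proof -
  have j: "mw = 0" "c1 = 0" "c2 = q1 * mx + p1 * my" "a1 = 0" "b1 = 0"
    using ideal_fam_jacobi[OF lie] mv by auto
  show ?thesis
    by (rule isomorphic_mk6_coords[OF lie nform_def, of
      "vec6 1 (-(mx/mv)) 0 0 (p2/mv) 0" "vec6 0 1 0 0 0 0" "vec6 0 (-(my/mv)) 1 0 (-(q2/mv)) 0"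
      "vec6 0 0 0 1 (-(my/mv*p1+mx/mv*q1)) (-(my/mv*p2+mx/mv*q2))" "vec6 0 0 0 0 1 0" "vec6 0 0 0 0 0 mv"])
     (use assms(2-) j in \<open>auto simp: table_simps\<close>)
qed

text \<open>The plane of \<open>x\<close> and \<open>y\<close> pairs with \<open>w\<close> through
  the functional \<open>(a, b)\<close>. A unimodular change of this plane keeps
  \<open>[x, y] = w\<close> and turns the functional into \<open>(1, 0)\<close>.\<close>

lemma nform_p0:
  assumes lie: "lie_algebra (nform 0 0 1 0 0 0 0 a b)"
    and ab: "al * a + be * b = 1"
  shows "lie_isomorphic (nform 0 0 1 0 0 0 0 a b)
    (nform 0 0 1 0 0 0 0 1 0)"
  by (rule isomorphic_mk6_coords[OF lie nform_def, of
      "vec6 al 0 be 0 0 0" "vec6 0 1 0 0 0 0" "vec6 (- b) 0 a 0 0 0"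
      "vec6 0 0 0 1 0 0" "vec6 0 0 0 0 1 0" "vec6 0 0 0 0 0 1"]; (use assms(2-) in \<open>auto simp: table_simps; algebra\<close>))

text \<open>Again a unimodular change of the plane of \<open>x\<close> and \<open>y\<close>; the new
  \<open>y\<close> spans the kernel of \<open>ad v\<close> on it.\<close>

lemma nform_eliminate_q1:
  assumes lie: "lie_algebra (nform 0 0 1 p q 0 0 a b)"
    and pq: "al * p - be * q = 1"
  shows "lie_isomorphic (nform 0 0 1 p q 0 0 a b)
    (nform 0 0 1 1 0 0 0 (al*a + be*b) (q*a + p*b))"
  by (rule isomorphic_mk6_coords[OF lie nform_def, of
      "vec6 al 0 be 0 0 0" "vec6 0 1 0 0 0 0" "vec6 q 0 p 0 0 0"
      "vec6 0 0 0 1 0 0" "vec6 0 0 0 0 1 0" "vec6 0 0 0 0 0 1"]; (use assms(2-) in \<open>auto simp: table_simps; algebra\<close>))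

lemma nform_scale_a2:
  assumes lie: "lie_algebra (nform 0 0 1 1 0 0 0 a 0)"
    and a: "a \<noteq> 0"
  shows "lie_isomorphic (nform 0 0 1 1 0 0 0 a 0)
    (nform 0 0 1 1 0 0 0 1 0)"
  by (rule isomorphic_mk6_coords[OF lie nform_def, of
      "vec6 1 0 0 0 0 0" "vec6 0 1 0 0 0 0" "vec6 0 0 (1/a) 0 0 0"
      "vec6 0 0 0 (1/a) 0 0" "vec6 0 0 0 0 1 0" "vec6 0 0 0 0 0 1"])
     (use assms(2-) in \<open>auto simp: table_simps\<close>)

text \<open>\<open>b\<close> is the coefficient of \<open>[y, [x, y]]\<close>, which is quadratic in
  \<open>y\<close>. It therefore changes by squares, and its sign persists under scaling of
  \<open>y\<close>.\<close>

lemma nform_scale_b: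
  assumes lie: "lie_algebra (nform 0 0 1 1 0 0 0 a b)"
    and t: "t \<noteq> 0" and b: "b \<noteq> 0" and eps: "t^2 * b = eps"
  shows "lie_isomorphic (nform 0 0 1 1 0 0 0 a b)
    (nform 0 0 1 1 0 0 0 0 eps)"
  by (rule isomorphic_mk6_coords[OF lie nform_def, of
      "vec6 1 0 (-(a/b)) 0 0 0" "vec6 0 1 0 0 0 0" "vec6 0 0 t 0 0 0"
      "vec6 0 0 0 t 0 0" "vec6 0 0 0 0 1 0" "vec6 0 0 0 0 0 1"])
     (use assms(2-) in \<open>auto simp: table_simps\<close>)

text \<open>The plane of \<open>x\<close> and \<open>y\<close> acts on \<open>R\<close> through the
  functional \<open>(mx, my)\<close>; a unimodular change makes the new \<open>y\<close> act
  trivially and the new \<open>x\<close> by 1.\<close>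

lemma ideal_fam_eliminate_my:
  assumes lie: "lie_algebra (ideal_fam 0 p1 p2 a1 a2 mx q1 q2 c1 c2 0 b1 b2 my 0)"
    and m: "al * mx + be * my = 1"
  shows "lie_isomorphic (ideal_fam 0 p1 p2 a1 a2 mx q1 q2 c1 c2 0 b1 b2 my 0)
    (ideal_fam 0 (al*p1-be*q1) (al*p2-be*q2) (al*a1+be*b1) (al*a2+be*b2) 1 (my*p1+mx*q1) (my*p2+mx*q2) c1 c2 0 (mx*b1-my*a1) (mx*b2-my*a2) 0 0)"
  by (rule isomorphic_mk6_coords[OF lie ideal_fam_def, of
      "vec6 al 0 be 0 0 0" "vec6 0 1 0 0 0 0" "vec6 (- my) 0 mx 0 0 0"
      "vec6 0 0 0 1 0 0" "vec6 0 0 0 0 1 0" "vec6 0 0 0 0 0 1"]; (use assms(2-) in \<open>auto simp: table_simps; algebra\<close>))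

lemma ideal_fam_mx1_a1:
  assumes lie: "lie_algebra (ideal_fam 0 p1 p2 a1 a2 1 q1 q2 0 q1 0 0 b2 0 0)"
    and q1: "q1 \<noteq> 0" and a1: "a1 \<noteq> 0"
  shows "lie_isomorphic (ideal_fam 0 p1 p2 a1 a2 1 q1 q2 0 q1 0 0 b2 0 0)
    (nform 0 1 0 0 1 0 1 0 0)"
proof -
  \<comment> \<open>\<open>k\<close> and \<open>e\<close> remove the two coordinates of
    \<open>[x, v]\<close>, \<open>h\<close> removes \<open>[y, w]\<close>, and \<open>u\<close> and
    \<open>l\<close> make \<open>[x, w]\<close> and \<open>[v, y]\<close> equal in both
    coordinates.\<close>
  define k where "k = p1 / q1"
  define e where "e = k * q2 - p2"
  define h where "h = - b2 / q1"
  define l where "l = (a1 * q2 / q1 - a2 - h * p1) / (2 * q1)"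
  define u where "u = a1 / q1"
  have s: "p1 = k * q1" "p2 = k * q2 - e" "b2 = - (h * q1)" "a2 = u * q2 - h * p1 - 2 * l * q1" "a1 = u * q1" "u \<noteq> 0"
    using q1 a1 by (simp_all add: k_def e_def h_def l_def field_simps u_def)
  show ?thesis
    by (rule isomorphic_mk6_coords[OF lie nform_def, of
      "vec6 1 (k*h+l) k 0 0 0" "vec6 0 u 0 0 (u*e) 0" "vec6 0 h 1 0 0 0"
      "vec6 0 0 0 1 (h*p1+l*q1) (h*p2+l*q2)" "vec6 0 0 0 0 (u*q1) (u*q2)" "vec6 0 0 0 0 0 (u*q1)"])
     (use assms(2-) in \<open>auto simp: table_simps s\<close>)
qed

lemma ideal_fam_mx1:
  assumes lie: "lie_algebra (ideal_fam 0 p1 p2 0 a2 1 q1 q2 0 q1 0 0 b2 0 0)"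
    and q1: "q1 \<noteq> 0"
  shows "lie_isomorphic (ideal_fam 0 p1 p2 0 a2 1 q1 q2 0 q1 0 0 b2 0 0)
    (nform 0 1 0 0 1 0 0 0 0)"
proof -
  define k where "k = p1 / q1"
  define e where "e = k * q2 - p2"
  define h where "h = - b2 / q1"
  define l where "l = (0 - a2 - h * p1) / (2 * q1)"
  have s: "p1 = k * q1" "p2 = k * q2 - e" "b2 = - (h * q1)" "a2 = 0 - h * p1 - 2 * l * q1"
    using q1 by (simp_all add: k_def e_def h_def l_def field_simps)
  show ?thesis
    by (rule isomorphic_mk6_coords[OF lie nform_def, of
      "vec6 1 (k*h+l) k 0 0 0" "vec6 0 1 0 0 e 0" "vec6 0 h 1 0 0 0"
      "vec6 0 0 0 1 (h*p1+l*q1) (h*p2+l*q2)" "vec6 0 0 0 0 q1 q2" "vec6 0 0 0 0 0 q1"])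
     (use assms(2-) s in \<open>auto simp: table_simps\<close>)
qed

text \<open>The symmetric form \<open>[s, [y, t]]\<close> on the span of \<open>x\<close> and
  \<open>v\<close> is a hyperbolic plane, which \<open>x - v\<close> and \<open>x + v\<close>
  diagonalise with opposite signs. The old \<open>y\<close> becomes the new
  \<open>x\<close>.\<close>

lemma nform_hyperbolic_l0:
  assumes lie: "lie_algebra (nform 0 1 0 0 1 0 0 0 0)"
  shows "lie_isomorphic (nform 0 1 0 0 1 0 0 0 0)
    (nform 0 0 1 1 0 0 0 0 (-1))"
  by (rule isomorphic_mk6_coords[OF lie nform_def, of
      "vec6 0 0 1 0 0 0" "vec6 1 (-1) 0 0 0 0" "vec6 1 1 0 0 0 0"
      "vec6 0 0 0 (-1) (-1) 0" "vec6 0 0 0 (-1) 1 0" "vec6 0 0 0 0 0 2"])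
     (auto simp: table_simps)

section \<open>Normal forms of \<open>chain_fam\<close>\<close>

lemma chain_fam_rescale_g:
  assumes lie: "lie_algebra (chain_fam g t1 tau k e s eta k' th)"
    and g: "g \<noteq> 0"
  shows "lie_isomorphic (chain_fam g t1 tau k e s eta k' th)
    (chain_fam 1 0 (g*tau) (g*k) 0 (g * s) (- (g * s)) 0 0)"
proof -
  note j = chain_fam_jacobi[OF lie]
  show ?thesis
    by (rule isomorphic_mk6_coords[OF lie chain_fam_def, of
      "vec6 1 0 0 0 0 0" "vec6 0 1 0 0 0 0" "vec6 0 0 g 0 0 t1"
      "vec6 0 0 0 g 0 0" "vec6 0 0 0 0 g 0" "vec6 0 0 0 0 0 1"])
     (use assms(2-) j in \<open>auto simp: table_simps\<close>)
qed

lemma chain_to_nform: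
  assumes lie: "lie_algebra (chain_fam 1 0 tau k 0 s (- s) 0 0)"
    and s: "s \<noteq> 0"
  shows "lie_isomorphic (chain_fam 1 0 tau k 0 s (- s) 0 0)
    (nform 1 0 1 0 0 0 1 0 (-1))"
proof -
  \<comment> \<open>\<open>e\<close> cancels \<open>[x, w]\<close> by means of
    \<open>[v, w] = s z\<close>. \<open>f\<close> cancels \<open>[v, r]\<close>, with one
    contribution \<open>s*f\<close> from \<open>[v, w]\<close> and another from
    \<open>[y, r]\<close>.\<close>
  define e where "e = - tau / s"
  define f where "f = - k / (2 * s)"
  have t: "tau = - (e * s)" "k = - (2 * s * f)" using s by (simp_all add: e_def f_def field_simps)
  show ?thesis
    by (rule isomorphic_mk6_coords[OF lie nform_def, of
      "vec6 1 e 0 0 0 0" "vec6 0 1 0 f 0 0" "vec6 0 0 1 0 f 0"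
      "vec6 0 0 0 1 0 (e*k)" "vec6 0 0 0 0 1 0" "vec6 0 0 0 0 0 s"])
     (use assms(2-) t in \<open>auto simp: table_simps\<close>)
qed

lemma chain_scale_tau:
  assumes lie: "lie_algebra (chain_fam 1 0 tau k 0 0 0 0 0)"
    and k: "k \<noteq> 0" and tau: "tau \<noteq> 0"
  shows "lie_isomorphic (chain_fam 1 0 tau k 0 0 0 0 0)
    (chain_fam 1 0 1 1 0 0 0 0 0)"
proof -
  define u where "u = tau / k"
  have t: "tau = u * k" "u \<noteq> 0" using k tau by (simp_all add: u_def field_simps)
  show ?thesis
    by (rule isomorphic_mk6_coords[OF lie chain_fam_def, of
      "vec6 1 0 0 0 0 0" "vec6 0 u 0 0 0 0" "vec6 0 0 u 0 0 0"
      "vec6 0 0 0 u 0 0" "vec6 0 0 0 0 u 0" "vec6 0 0 0 0 0 (u*tau)"])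
     (use assms(2-) t in \<open>auto simp: table_simps\<close>)
qed

text \<open>After exchanging \<open>x\<close> and \<open>v\<close>, it is \<open>v\<close> that runs
  along the chain \<open>r\<close>, \<open>y\<close>, \<open>w\<close>, whose members become
  \<open>y\<close>, \<open>r1\<close>, \<open>r2\<close> up to sign.\<close>

lemma chain_tau0_to_nform:
  assumes lie: "lie_algebra (chain_fam 1 0 0 k 0 0 0 0 0)"
    and k: "k \<noteq> 0"
  shows "lie_isomorphic (chain_fam 1 0 0 k 0 0 0 0 0)
    (nform 1 0 1 0 1 0 0 0 0)"
  by (rule isomorphic_mk6_coords[OF lie nform_def, of
      "vec6 0 1 0 0 0 0" "vec6 1 0 0 0 0 0" "vec6 0 0 (-1) 0 0 0"
      "vec6 0 0 0 0 0 (-k)" "vec6 0 0 0 (-1) 0 0" "vec6 0 0 0 0 (-1) 0"])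
     (use assms(2-) in \<open>auto simp: table_simps\<close>)

text \<open>With \<open>g = 0\<close> the old \<open>v\<close> has left the chain and pairs
  essentially with \<open>r\<close> alone. So \<open>r\<close> can serve as the new
  \<open>v\<close>, and the old \<open>v\<close> and \<open>z\<close> span the new ideal
  \<open>R\<close>; the shift of \<open>x\<close> clears \<open>t1\<close>.\<close>

lemma chain_fam_g0:
  assumes lie: "lie_algebra (chain_fam 0 t1 tau k 0 0 eta 0 0)"
    and k: "k \<noteq> 0"
  shows "lie_isomorphic (chain_fam 0 t1 tau k 0 0 eta 0 0)
    (nform 1 0 1 0 0 (eta/k) 0 (tau/k) 0)"
  by (rule isomorphic_mk6_coords[OF lie nform_def, of
      "vec6 1 0 (t1/k) 0 0 0" "vec6 0 0 1 0 0 0" "vec6 0 0 0 1 0 0"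
      "vec6 0 0 0 0 1 (t1/k*eta)" "vec6 0 (-1) 0 0 0 0" "vec6 0 0 0 0 0 k"])
     (use assms(2-) in \<open>auto simp: table_simps\<close>)

section \<open>The list of models and the reduction of both families to it\<close>

text \<open>The position in the list, counted from 0, is the value of \<open>class_index\<close>.
  Two pairs of entries differ only in the sign of a parameter; over the complex numbers each of
  these pairs would be a single class.\<close>

definition models :: "(real^6 \<Rightarrow> real^6 \<Rightarrow> real^6) list" where
  "models = [nform 0 0 1 0 0 0 0 0 0, nform 0 0 1 0 0 0 0 1 0, nform 0 0 1 1 0 0 0 0 0, nform 0 0 1 1 0 0 0 1 0,
    nform 0 0 1 1 0 0 0 0 1, nform 0 0 1 1 0 0 0 0 (-1), nform 0 1 0 0 1 0 1 0 0, nform 1 0 1 0 1 0 0 0 0,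
    nform 1 0 1 0 1 0 0 1 0, nform 1 0 1 0 1 0 0 (-1) 0, nform 1 1 0 0 1 0 1 0 0, nform 1 0 1 0 1 0 1 0 (-1),
    nform 1 0 1 0 0 0 0 1 0, nform 1 0 1 0 0 1 0 0 0, nform 1 0 1 0 0 1 0 1 0, nform 1 0 1 0 0 0 1 0 (-1),
    chain_fam 1 0 1 1 0 0 0 0 0]"

definition listed :: "('a::real_vector \<Rightarrow> 'a \<Rightarrow> 'a) \<Rightarrow> bool" where
  "listed b \<longleftrightarrow> (\<exists>m\<in>set models. lie_isomorphic b m)"

lemma listed_model: "m \<in> set models \<Longrightarrow> listed m"
  unfolding listed_def using lie_isomorphic_refl by blast

lemma listed_trans: "lie_isomorphic b c \<Longrightarrow> listed c \<Longrightarrow> listed b"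
  unfolding listed_def using lie_isomorphic_trans by blast

lemma listed_via:
  assumes "lie_algebra b" "lie_isomorphic b c" "lie_algebra c \<Longrightarrow> listed c"
  shows "listed b"
  using assms listed_trans lie_algebra_transport by blast

lemma scale_to_sign:
  fixes a :: real
  assumes "a \<noteq> 0"
  obtains u where "u \<noteq> 0" "a = u^2 \<or> a = - (u^2)"
proof
  show "sqrt \<bar>a\<bar> \<noteq> 0" "a = (sqrt \<bar>a\<bar>)^2 \<or> a = - ((sqrt \<bar>a\<bar>)^2)" using assms by auto
qed

lemma listed_nform_q1:
  assumes lie: "lie_algebra (nform 1 0 1 0 q1 q2 a1 a2 (- a1))" and q1: "q1 \<noteq> 0"
  shows "listed (nform 1 0 1 0 q1 q2 a1 a2 (- a1))"
proof (cases "a1 = 0")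
  case True
  have *: "listed (nform 1 0 1 0 q1 q2 0 a2 0)"
    if "a2 = eps * u^2 * q1" "u \<noteq> 0" "nform 1 0 1 0 1 0 0 eps 0 \<in> set models" for eps u
    using lie True listed_trans[OF nform_scale_q1[OF _ q1 that(2,1)] listed_model[OF that(3)]] by simp
  show ?thesis
  proof (cases "a2 = 0")
    case a2: True
    show ?thesis using *[of 0 1] True a2 by (simp add: models_def)
  next
    case False
    then obtain u where u: "u \<noteq> 0" "a2 / q1 = u^2 \<or> a2 / q1 = - (u^2)"
      using scale_to_sign[of "a2 / q1"] q1 by auto
    then show ?thesis using *[of 1 u] *[of "-1" u] True q1 by (auto simp: models_def field_simps)
  qed
next
  case False
  show ?thesis by (rule listed_trans[OF nform_scale_q1_a1[OF lie q1 False] listed_model]) (simp add: models_def)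
qed

lemma listed_nform_q0:
  assumes lie: "lie_algebra (nform 1 0 1 0 0 q2 a1 a2 (- a1))"
  shows "listed (nform 1 0 1 0 0 q2 a1 a2 (- a1))"
proof (cases "a1 = 0")
  case True
  have *: "listed (nform 1 0 1 0 0 q2 0 a2 0)"
    if "u*q2/t = q" "a2/t = a" "u \<noteq> 0" "t \<noteq> 0" "listed (nform 1 0 1 0 0 q 0 a 0)" for u t q a
    using lie True listed_trans[OF nform_scale_q2_a2[OF _ that(3,4)]] that(1,2,5) by simp
  have l: "listed (nform 1 0 1 0 0 1 0 1 0)" "listed (nform 1 0 1 0 0 1 0 0 0)" "listed (nform 1 0 1 0 0 0 0 1 0)"
    by (rule listed_model, simp add: models_def)+
  consider "q2 = 0" "a2 = 0" | "q2 = 0" "a2 \<noteq> 0" | "q2 \<noteq> 0" "a2 = 0" | "q2 \<noteq> 0" "a2 \<noteq> 0" by blast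
  then show ?thesis
  proof cases
    case 1
    then have "lie_algebra (nform 1 0 1 0 0 0 0 0 0)" using lie True by simp
    from listed_trans[OF nform_l1_to_l0[OF this] listed_model] show ?thesis using True 1 by (simp add: models_def)
  next
    case 2 then show ?thesis using *[of 1 a2 0 1] l True by simp
  next
    case 3 then show ?thesis using *[of 1 q2 1 0] l True by simp
  next
    \<comment> \<open>\<open>t = a2\<close> normalises \<open>a2\<close>, and then
      \<open>u = a2/q2\<close> normalises \<open>q2\<close>.\<close>
    case 4 then show ?thesis using *[of "a2/q2" a2 1 1] l True by simp
  qed
next
  case False
  show ?thesis by (rule listed_trans[OF nform_eliminate_q2[OF lie False] listed_model]) (simp add: models_def)
qed

lemma listed_nform_l1:
  assumes lie: "lie_algebra (nform 1 m n 0 q1 q2 a1 a2 (- (a1*n)))" and c: "n \<noteq> 0 \<or> m * q1 \<noteq> 0"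
  shows "listed (nform 1 m n 0 q1 q2 a1 a2 (- (a1*n)))"
proof (cases "n = 0")
  case True
  then have mq: "m \<noteq> 0" "q1 \<noteq> 0" using c by auto
  have lie0: "lie_algebra (nform 1 m 0 0 q1 q2 a1 a2 0)" using lie True by simp
  have "listed (nform 1 m 0 0 q1 q2 a1 a2 0)"
  proof (cases "a1 = 0")
    case True
    show ?thesis unfolding True
    proof (rule listed_via[OF _ nform_mv0[OF _ mq]])
      show "lie_algebra (nform 1 m 0 0 q1 q2 0 a2 0)" using lie0 True by simp
      then show "lie_algebra (nform 1 m 0 0 q1 q2 0 a2 0)" .
      show "listed (nform 1 1 0 0 1 0 0 0 0)" if "lie_algebra (nform 1 1 0 0 1 0 0 0 0)"
        by (rule listed_trans[OF nform_hyperbolic[OF that] listed_model]) (simp add: models_def)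
    qed
  next
    case False
    show ?thesis by (rule listed_trans[OF nform_mv0_a1[OF lie0 mq False] listed_model]) (simp add: models_def)
  qed
  then show ?thesis using True by simp
next
  case False
  show ?thesis
  proof (rule listed_via[OF lie nform_eliminate_mx[OF lie False]])
    assume "lie_algebra (nform 1 0 1 0 q1 (q2 / n) a1 ((a2 - m * m * q1 / n) / n) (- a1))"
    then show "listed (nform 1 0 1 0 q1 (q2 / n) a1 ((a2 - m * m * q1 / n) / n) (- a1))"
      using listed_nform_q1 listed_nform_q0 by (cases "q1 = 0") auto
  qed
qed

lemma listed_nform_l0_p1:
  assumes lie: "lie_algebra (nform 0 0 1 1 0 0 0 a b)"
  shows "listed (nform 0 0 1 1 0 0 0 a b)"
proof (cases "b = 0")
  case True
  show ?thesis
  proof (cases "a = 0")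
    case a: True
    show ?thesis unfolding a True by (rule listed_model) (simp add: models_def)
  next
    case False
    show ?thesis unfolding True using lie True listed_trans[OF nform_scale_a2[OF _ False] listed_model]
      by (simp add: models_def)
  qed
next
  case False
  then obtain u where u: "u \<noteq> 0" "b = u^2 \<or> b = - (u^2)" using scale_to_sign by blast
  then have "1/u \<noteq> 0" "(1/u)^2 * b = 1 \<or> (1/u)^2 * b = -1" by (auto simp: field_simps)
  moreover have "nform 0 0 1 1 0 0 0 0 1 \<in> set models" "nform 0 0 1 1 0 0 0 0 (-1) \<in> set models"
    by (simp_all add: models_def)
  ultimately show ?thesis
    using listed_trans[OF nform_scale_b[OF lie _ False] listed_model] by metis
qed

lemma listed_nform_l0:
  assumes lie: "lie_algebra (nform 0 0 1 p q 0 0 a b)"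
  shows "listed (nform 0 0 1 p q 0 0 a b)"
proof (cases "p = 0 \<and> q = 0")
  case True
  note pq = this
  show ?thesis
  proof (cases "a = 0 \<and> b = 0")
    case True
    then show ?thesis using pq by (intro listed_model) (simp add: models_def)
  next
    case False
    then obtain al be where "al * a + be * b = 1"
      by (metis add.right_neutral add_0 mult_zero_left nonzero_eq_divide_eq times_divide_eq_left)
    from nform_p0[OF _ this] have "lie_isomorphic (nform 0 0 1 0 0 0 0 a b) (nform 0 0 1 0 0 0 0 1 0)"
      using lie pq by simp
    from listed_trans[OF this listed_model] show ?thesis using pq by (simp add: models_def)
  qed
next
  case False
  then obtain al be where "al * p + be * q = 1"
    by (metis add.right_neutral add_0 mult_zero_left nonzero_eq_divide_eq times_divide_eq_left)
  then have "al * p - (- be) * q = 1" by simp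
  from listed_via[OF lie nform_eliminate_q1[OF lie this] listed_nform_l0_p1] show ?thesis .
qed

lemma listed_ideal_fam_mx1:
  assumes lie: "lie_algebra (ideal_fam 0 p1 p2 a1 a2 1 q1 q2 c1 c2 0 b1 b2 0 0)" and c: "c1 \<noteq> 0 \<or> c2 \<noteq> 0"
  shows "listed (ideal_fam 0 p1 p2 a1 a2 1 q1 q2 c1 c2 0 b1 b2 0 0)"
proof -
  have j: "c1 = 0" "c2 = q1" "b1 = 0" using ideal_fam_jacobi[OF lie] by auto
  then have q1: "q1 \<noteq> 0" using c by simp
  have l: "lie_algebra (ideal_fam 0 p1 p2 a1 a2 1 q1 q2 0 q1 0 0 b2 0 0)" using lie j by simp
  show ?thesis
  proof (cases "a1 = 0")
    case True
    show ?thesis unfolding j True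
    proof (rule listed_via[OF _ ideal_fam_mx1[OF _ q1]])
      show "lie_algebra (ideal_fam 0 p1 p2 0 a2 1 q1 q2 0 q1 0 0 b2 0 0)" using l True by simp
      then show "lie_algebra (ideal_fam 0 p1 p2 0 a2 1 q1 q2 0 q1 0 0 b2 0 0)" .
      show "listed (nform 0 1 0 0 1 0 0 0 0)" if "lie_algebra (nform 0 1 0 0 1 0 0 0 0)"
        by (rule listed_trans[OF nform_hyperbolic_l0[OF that] listed_model]) (simp add: models_def)
    qed
  next
    case False
    show ?thesis unfolding j
      by (rule listed_trans[OF ideal_fam_mx1_a1[OF l q1 False] listed_model]) (simp add: models_def)
  qed
qed

text \<open>The disjunction says that \<open>v\<close> fails to commute with \<open>w\<close> or
  with \<open>r1\<close>. This is all that is kept of the fact that \<open>V\<close> is not a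
  subalgebra.\<close>

theorem listed_ideal_fam:
  assumes lie: "lie_algebra (ideal_fam l p1 p2 a1 a2 mx q1 q2 c1 c2 mv b1 b2 my mw)"
    and c: "c1 \<noteq> 0 \<or> c2 \<noteq> 0 \<or> mv \<noteq> 0"
  shows "listed (ideal_fam l p1 p2 a1 a2 mx q1 q2 c1 c2 mv b1 b2 my mw)"
proof (cases "l = 0")
  case True
  note j = ideal_fam_jacobi[OF lie]
  have lie0: "lie_algebra (ideal_fam 0 p1 p2 a1 a2 mx q1 q2 c1 c2 mv b1 b2 my mw)" using lie True by simp
  show ?thesis
  proof (cases "mv = 0")
    case mv: True
    then have c2: "c2 \<noteq> 0" using c j by auto
    then obtain al be where m: "al * mx + be * my = 1" using j(4)
      by (metis add.right_neutral add_0 mult_zero_left mult_zero_right nonzero_eq_divide_eq times_divide_eq_left)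
    have lie1: "lie_algebra (ideal_fam 0 p1 p2 a1 a2 mx q1 q2 c1 c2 0 b1 b2 my 0)" using lie0 mv j(1) by simp
    from listed_via[OF lie1 ideal_fam_eliminate_my[OF lie1 m] listed_ideal_fam_mx1] show ?thesis using c2 True mv j(1) by simp
  next
    case False
    from listed_via[OF lie0 ideal_fam_eliminate_mx_my[OF lie0 False] listed_nform_l0] show ?thesis using True by simp
  qed
next
  case False
  note j = ideal_fam_jacobi[OF lie]
  show ?thesis
  proof (rule listed_via[OF lie ideal_fam_rescale_l[OF lie False]])
    assume L: "lie_algebra (nform 1 mx (mv / l) 0 (q1 / l) (q2 / l + p1 * mv / l\<^sup>2) a1 a2 (- (a1 * (mv / l))))"
    have "mv / l \<noteq> 0 \<or> mx * (q1 / l) \<noteq> 0" using c j False by auto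
    from listed_nform_l1[OF L this] show "listed (nform 1 mx (mv / l) 0 (q1 / l) (q2 / l + p1 * mv / l\<^sup>2) a1 a2 (- (a1 * (mv / l))))" .
  qed
qed

text \<open>One of \<open>[v, r]\<close>, \<open>[v, w]\<close>, \<open>[r, w]\<close> is required
  to be nonzero: up to scaling, the bracket on the original \<open>V\<close> is a combination of
  these. The Jacobi identity rules out the last.\<close>

theorem listed_chain_fam:
  assumes lie: "lie_algebra (chain_fam g t1 tau k e s eta k' th)"
    and c: "k \<noteq> 0 \<or> s \<noteq> 0 \<or> k' \<noteq> 0"
  shows "listed (chain_fam g t1 tau k e s eta k' th)"
proof (cases "g = 0")
  case True
  note j = chain_fam_jacobi[OF lie]
  have k: "k \<noteq> 0" using c j True by auto
  have L: "lie_algebra (chain_fam 0 t1 tau k 0 0 eta 0 0)" using lie j True by simp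
  from listed_via[OF L chain_fam_g0[OF L k]] listed_nform_q0[of "eta/k" 0 "tau/k"]
  show ?thesis using j True by simp
next
  case False
  note j = chain_fam_jacobi[OF lie]
  show ?thesis
  proof (rule listed_via[OF lie chain_fam_rescale_g[OF lie False]])
    assume L: "lie_algebra (chain_fam 1 0 (g*tau) (g*k) 0 (g * s) (- (g * s)) 0 0)"
    show "listed (chain_fam 1 0 (g*tau) (g*k) 0 (g * s) (- (g * s)) 0 0)"
    proof (cases "s = 0")
      case s: True
      then have k: "g * k \<noteq> 0" using c j False by auto
      show ?thesis
      proof (cases "tau = 0")
        case t: True
        show ?thesis using L s t listed_trans[OF chain_tau0_to_nform[OF _ k] listed_model] by (simp add: models_def)
      next
        case t: False
        then have t: "g * tau \<noteq> 0" using False by simp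
        show ?thesis using L s listed_trans[OF chain_scale_tau[OF _ k t] listed_model] by (simp add: models_def)
      qed
    next
      case s: False
      then have s: "g * s \<noteq> 0" using False by simp
      show ?thesis by (rule listed_trans[OF chain_to_nform[OF L s] listed_model]) (simp add: models_def)
    qed
  qed
qed

section \<open>Nilpotent Lie algebras\<close>

lemma in_span_insert:
  "subspace T \<Longrightarrow> u \<in> span (insert p T) \<longleftrightarrow> (\<exists>a. u - a *\<^sub>R p \<in> T)"
  by (simp add: span_breakdown_eq span_eq_iff[THEN iffD2])

lemma in_span_insert2:
  "subspace T \<Longrightarrow> u \<in> span (insert p (insert q T)) \<longleftrightarrow> (\<exists>a b. u - a *\<^sub>R p - b *\<^sub>R q \<in> T)"
  by (simp add: span_breakdown_eq span_eq_iff[THEN iffD2])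

lemma in_span_pair: "u \<in> span {p, q} \<longleftrightarrow> (\<exists>a b. u = a *\<^sub>R p + b *\<^sub>R q)"
  by (simp add: span_breakdown_eq algebra_simps)

lemma span_exchange:
  assumes "c \<noteq> 0" "p' - c *\<^sub>R p \<in> span S"
  shows "span (insert p' S) = span (insert p S)"
proof -
  have "p - (1/c) *\<^sub>R p' = - ((1/c) *\<^sub>R (p' - c *\<^sub>R p))" using assms(1) by (simp add: algebra_simps)
  then have "p - (1/c) *\<^sub>R p' \<in> span S" using span_neg[OF span_scale[OF assms(2)]] by simp
  then have "p \<in> span (insert p' S)" "p' \<in> span (insert p S)"
    using assms(2) by (auto simp: span_breakdown_eq)
  moreover have "S \<subseteq> span (insert p S)" "S \<subseteq> span (insert p' S)"
    by (meson span_superset subset_insertI subset_trans)+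
  ultimately show ?thesis by (simp add: span_eq)
qed

lemma not_in_span_of_dim:
  fixes a :: "'a::real_vector"
  assumes "dim (UNIV :: 'a set) = n" "span (insert a S) = UNIV" "finite S" "card S < n"
  shows "a \<notin> span S"
proof
  assume "a \<in> span S"
  then have "span S = UNIV" using assms(2) by (metis span_redundant)
  then show False using real_vector.dim_le_card[of UNIV S] assms by auto
qed

locale nilpotent_lie = lie_algebra bracket for bracket :: "'a::real_vector \<Rightarrow> 'a \<Rightarrow> 'a" +
  assumes nilpotent: "\<exists>n. lower_central_series bracket n = {0}"
begin

lemma bracket_in_span:
  assumes "\<And>s. s \<in> S \<Longrightarrow> bracket k s \<in> T" "subspace T" "u \<in> span S"
  shows "bracket k u \<in> T"
  using assms(3)
proof (induction rule: span_induct_alt)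
  case base then show ?case using assms(2) by (simp add: subspace_0)
next
  case (step c x y) then show ?case using assms by (simp add: subspace_add subspace_scale)
qed

text \<open>
  Every use of nilpotency goes through this lemma: iterating the inclusion \<open>S \<subseteq> [K, S] + T\<close> pushes \<open>S\<close> down
  the lower central series.
\<close>

lemma nilpotent_absorb:
  assumes T: "subspace T" "\<And>k t. k \<in> K \<Longrightarrow> t \<in> T \<Longrightarrow> bracket k t \<in> T"
    and S: "S \<subseteq> span ({bracket k s | k s. k \<in> K \<and> s \<in> S} \<union> T)"
  shows "S \<subseteq> T"
proof -
  have "S \<subseteq> span (lower_central_series bracket n \<union> T)" for n
  proof (induction n)
    case 0 then show ?case using span_superset by force
  next
    case (Suc n)
    have "bracket k s \<in> span (lower_central_series bracket (Suc n) \<union> T)" if "k \<in> K" "s \<in> S" for k s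
    proof -
      have "s \<in> span (lower_central_series bracket n \<union> T)" using Suc that by blast
      then show ?thesis
      proof (rule bracket_in_span[rotated 2])
        fix u assume "u \<in> lower_central_series bracket n \<union> T"
        then show "bracket k u \<in> span (lower_central_series bracket (Suc n) \<union> T)"
          using T(2)[OF that(1)] by (auto simp: bracket_span_def intro!: span_base)
      qed simp
    qed
    then have "{bracket k s | k s. k \<in> K \<and> s \<in> S} \<union> T \<subseteq> span (lower_central_series bracket (Suc n) \<union> T)"
      using span_superset by blast
    then show ?case using S span_minimal subspace_span by (metis (no_types, lifting) subset_trans)
  qed
  moreover obtain n where "lower_central_series bracket n = {0}" using nilpotent by blast
  ultimately have "S \<subseteq> span ({0} \<union> T)" by metis
  then show ?thesis using T(1) by (simp add: span_eq_iff[THEN iffD2])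
qed

text \<open>For a nonzero eigenvalue, \<open>s\<close> is a multiple of \<open>[x, s]\<close> modulo
  \<open>T\<close>, so \<open>nilpotent_absorb\<close> would swallow the set \<open>{s}\<close> into
  \<open>T\<close>.\<close>

lemma eigenvalue_zero:
  assumes T: "subspace T" "\<And>t. t \<in> T \<Longrightarrow> bracket x t \<in> T"
    and s: "bracket x s - c *\<^sub>R s \<in> T" "s \<notin> T"
  shows "c = 0"
proof (rule ccontr)
  assume "c \<noteq> 0"
  then have "s = (1/c) *\<^sub>R bracket x s - (1/c) *\<^sub>R (bracket x s - c *\<^sub>R s)"
    by (simp add: algebra_simps)
  also have "\<dots> \<in> span ({bracket k s' | k s'. k \<in> {x} \<and> s' \<in> {s}} \<union> T)"
    by (intro span_diff span_scale span_base) (use s in auto)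
  finally have "{s} \<subseteq> span ({bracket k s' | k s'. k \<in> {x} \<and> s' \<in> {s}} \<union> T)" by blast
  from nilpotent_absorb[OF T(1) _ this] T(2) s(2) show False by auto
qed

text \<open>If the determinant were nonzero, Cramer's rule would express \<open>p\<close> and
  \<open>q\<close> modulo \<open>T\<close> through their brackets with \<open>x\<close>, and both
  would be absorbed by \<open>T\<close>.\<close>

lemma det_zero:
  assumes T: "subspace T" "\<And>t. t \<in> T \<Longrightarrow> bracket x t \<in> T"
    and p: "bracket x p - a *\<^sub>R p - b *\<^sub>R q \<in> T" and q: "bracket x q - c *\<^sub>R p - d *\<^sub>R q \<in> T"
    and ni: "p \<notin> T \<or> q \<notin> T"
  shows "a * d - b * c = 0"
proof (rule ccontr)
  assume D: "a * d - b * c \<noteq> 0"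
  let ?P = "bracket x p - a *\<^sub>R p - b *\<^sub>R q" and ?Q = "bracket x q - c *\<^sub>R p - d *\<^sub>R q"
  let ?S = "span ({bracket k s' | k s'. k \<in> {x} \<and> s' \<in> {p, q}} \<union> T)"
  have "(a * d - b * c) *\<^sub>R p = d *\<^sub>R (bracket x p - ?P) - b *\<^sub>R (bracket x q - ?Q)"
    "(a * d - b * c) *\<^sub>R q = a *\<^sub>R (bracket x q - ?Q) - c *\<^sub>R (bracket x p - ?P)"
    by (simp_all add: algebra_simps)
  moreover have "bracket x p \<in> ?S" "bracket x q \<in> ?S" "?P \<in> ?S" "?Q \<in> ?S"
    using p q by (auto intro: span_base)
  then have "d *\<^sub>R (bracket x p - ?P) - b *\<^sub>R (bracket x q - ?Q) \<in> ?S"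
     "a *\<^sub>R (bracket x q - ?Q) - c *\<^sub>R (bracket x p - ?P) \<in> ?S"
    by (meson span_diff span_scale)+
  ultimately have "(a * d - b * c) *\<^sub>R p \<in> ?S" "(a * d - b * c) *\<^sub>R q \<in> ?S" by simp_all
  from span_scale[OF this(1), of "1/(a * d - b * c)"] span_scale[OF this(2), of "1/(a * d - b * c)"]
  have "{p, q} \<subseteq> ?S" using D by simp
  from nilpotent_absorb[OF T(1) _ this] T(2) ni show False by auto
qed

text \<open>Engel's theorem for a set \<open>K\<close> acting on a quotient of dimension at most
  two. If the action is nonzero, any nonzero value \<open>y\<close> of it can be taken as
  \<open>q'\<close>.\<close>

lemma triangularise:
  assumes T: "subspace T" "\<And>k t. k \<in> K \<Longrightarrow> t \<in> T \<Longrightarrow> bracket k t \<in> T"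
    and pq: "\<And>k. k \<in> K \<Longrightarrow> bracket k p \<in> span (insert p (insert q T))"
      "\<And>k. k \<in> K \<Longrightarrow> bracket k q \<in> span (insert p (insert q T))"
  obtains p' q' where "span (insert p' (insert q' T)) = span (insert p (insert q T))"
    "\<And>k. k \<in> K \<Longrightarrow> bracket k q' \<in> T" "\<And>k. k \<in> K \<Longrightarrow> bracket k p' \<in> span (insert q' T)"
proof (cases "\<forall>k\<in>K. bracket k p \<in> T \<and> bracket k q \<in> T")
  case True
  show ?thesis
  proof (rule that)
    show "span (insert p (insert q T)) = span (insert p (insert q T))" ..
    show "bracket k q \<in> T" if "k \<in> K" for k using True that by blast
    show "bracket k p \<in> span (insert q T)" if "k \<in> K" for k
      using True that span_superset[of "insert q T"] by blast
  qed
next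
  case False
  then obtain k0 s where ks: "k0 \<in> K" "s \<in> {p, q}" "bracket k0 s \<notin> T" by blast
  define y where "y = bracket k0 s"
  have "y \<in> span (insert p (insert q T))" using ks pq unfolding y_def by blast
  then obtain a b where ab: "y - a *\<^sub>R p - b *\<^sub>R q \<in> T" using in_span_insert2[OF T(1)] by blast
  have "a \<noteq> 0 \<or> b \<noteq> 0" using ab ks(3) y_def by auto
  then obtain x where x: "span (insert x (insert y T)) = span (insert p (insert q T))"
  proof
    assume "a \<noteq> 0"
    moreover have "y - a *\<^sub>R p \<in> span (insert q T)"
      unfolding in_span_insert[OF T(1)] using ab by blast
    ultimately have "span (insert y (insert q T)) = span (insert p (insert q T))" by (rule span_exchange)
    then have "span (insert q (insert y T)) = span (insert p (insert q T))" by (simp only: insert_commute)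
    then show ?thesis by (rule that)
  next
    assume "b \<noteq> 0"
    moreover have "y - b *\<^sub>R q - a *\<^sub>R p \<in> T" using ab by (simp add: algebra_simps)
    then have "y - b *\<^sub>R q \<in> span (insert p T)" unfolding in_span_insert[OF T(1)] by blast
    ultimately have "span (insert y (insert p T)) = span (insert q (insert p T))" by (rule span_exchange)
    then have "span (insert p (insert y T)) = span (insert p (insert q T))" by (simp only: insert_commute)
    then show ?thesis by (rule that)
  qed
  have xy: "bracket k u \<in> span (insert x (insert y T))" if "k \<in> K" "u \<in> span (insert x (insert y T))" for k u
    using that(2) unfolding x
  proof (rule bracket_in_span[rotated 2])
    fix u assume "u \<in> insert p (insert q T)"
    then consider "u = p" | "u = q" | "u \<in> T" by blast
    then show "bracket k u \<in> span (insert p (insert q T))"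
      by cases (use pq[OF that(1)] T(2)[OF that(1)] in \<open>auto intro: span_base\<close>)
  qed simp
  have xS: "x \<in> span (insert x (insert y T))" "y \<in> span (insert x (insert y T))"
    by (auto intro: span_base)
  \<comment> \<open>\<open>S\<close> is spanned by \<open>T\<close> and all values of the action. It
    contains \<open>y\<close>, and it misses \<open>x\<close> because otherwise
    \<open>nilpotent_absorb\<close> would put \<open>y\<close> into \<open>T\<close>; so modulo
    \<open>T\<close> it is the line of \<open>y\<close>.\<close>
  define S where "S = span ({bracket k s | k s. k \<in> K \<and> s \<in> {x, y}} \<union> T)"
  have TS: "t \<in> S" if "t \<in> T" for t using that unfolding S_def by (auto intro: span_base)
  have sub: "subspace S" unfolding S_def by simp
  have KS: "bracket k x \<in> S" "bracket k y \<in> S" if "k \<in> K" for k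
    using that unfolding S_def by (auto intro: span_base)
  have "s \<in> span (insert x (insert y T))" unfolding x using ks(2) by (auto intro: span_base)
  then have "bracket k0 s \<in> S"
  proof (rule bracket_in_span[rotated 2])
    fix u assume "u \<in> insert x (insert y T)"
    then show "bracket k0 u \<in> S" using KS[OF ks(1)] TS T(2)[OF ks(1)] by blast
  qed (rule sub)
  then have yS: "y \<in> S" by (simp only: y_def)
  have xnS: "x \<notin> S"
  proof
    assume "x \<in> S"
    then have "{x, y} \<subseteq> span ({bracket k s | k s. k \<in> K \<and> s \<in> {x, y}} \<union> T)" using yS S_def by auto
    from nilpotent_absorb[OF T(1) T(2) this] show False using ks(3) y_def by auto
  qed
  have coeff: "a = 0" if "u \<in> S" "u - a *\<^sub>R x - b *\<^sub>R y \<in> T" for u a b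
  proof (rule ccontr)
    assume "a \<noteq> 0"
    have "u - (u - a *\<^sub>R x - b *\<^sub>R y) - b *\<^sub>R y \<in> S"
      by (rule subspace_diff[OF sub subspace_diff[OF sub that(1) TS[OF that(2)]] subspace_scale[OF sub yS]])
    from subspace_scale[OF sub this, of "1/a"] have "x \<in> S" using \<open>a \<noteq> 0\<close> by simp
    then show False using xnS by simp
  qed
  show ?thesis
  proof (rule that[OF x])
    fix k assume k: "k \<in> K"
    obtain a b where ab: "bracket k x - a *\<^sub>R x - b *\<^sub>R y \<in> T"
      using xy[OF k xS(1)] in_span_insert2[OF T(1)] by blast
    with coeff KS(1)[OF k] have "a = 0" by blast
    with ab show "bracket k x \<in> span (insert y T)" using in_span_insert[OF T(1)] by auto
    obtain c d where cd: "bracket k y - c *\<^sub>R x - d *\<^sub>R y \<in> T"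
      using xy[OF k xS(2)] in_span_insert2[OF T(1)] by blast
    with coeff KS(2)[OF k] have "c = 0" by blast
    with cd have "bracket k y - d *\<^sub>R y \<in> T" by simp
    moreover from this have "d = 0"
      using eigenvalue_zero[OF T(1) T(2)[OF k]] ks(3) y_def by blast
    ultimately show "bracket k y \<in> T" by simp
  qed
qed

end

section \<open>The values of \<omega> on a line: from actions on quotients to multiplication
  tables\<close>

lemma span_UNIV_if: "span A = UNIV \<Longrightarrow> A \<subseteq> span B \<Longrightarrow> span B = UNIV"
  by (metis span_minimal subspace_span top.extremum_uniqueI)

lemma listed_ideal_fam_iso:
  assumes "lie_algebra b" "lie_isomorphic b (ideal_fam l p1 p2 a1 a2 mx q1 q2 c1 c2 mv b1 b2 my mw)"
    "c1 \<noteq> 0 \<or> c2 \<noteq> 0 \<or> mv \<noteq> 0"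
  shows "listed b"
  by (rule listed_via[OF assms(1,2)]) (rule listed_ideal_fam[OF _ assms(3)])

context nilpotent_lie begin

lemma listed_of_ideal:
  assumes dim: "dim (UNIV :: 'a set) = 6" and span: "span {x, y, v, w, r, z} = UNIV"
    and yR: "\<And>k. k \<in> {v, w, r, z} \<Longrightarrow> bracket k y \<in> span {r, z}"
    and vx: "bracket v x - lv *\<^sub>R y \<in> span {r, z}" and wx: "bracket w x - lw *\<^sub>R y \<in> span {r, z}"
    and rx: "bracket r x \<in> span {r, z}" and zx: "bracket z x \<in> span {r, z}"
    and xy: "bracket x y - w - c *\<^sub>R y \<in> span {r, z}"
    and KR: "\<And>k t. k \<in> {v, w, r, z} \<Longrightarrow> t \<in> span {r, z} \<Longrightarrow> bracket k t \<in> span {r, z}"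
    and vw: "bracket v w = z"
  shows "listed bracket"
proof -
  define R where "R = span {r, z}"
  note asm = yR vx wx rx zx xy KR
  note asm = asm[folded R_def]
  have sR: "subspace R" by (simp add: R_def)
  note sub = subspace_add[OF sR] subspace_diff[OF sR] subspace_scale[OF sR] subspace_neg[OF sR] subspace_0[OF sR]
  have rz: "r \<in> R" "z \<in> R" by (auto simp: R_def intro: span_base)
  have xR: "bracket x t \<in> R" if "t \<in> R" for t
  proof (rule bracket_in_span[OF _ sR that[unfolded R_def]])
    fix s assume "s \<in> {r, z}"
    then show "bracket x s \<in> R" using asm(4,5) antisym[of x s] sub(4) by auto
  qed
  have ideal: "bracket u t \<in> R" if "t \<in> R" for u t
  proof -
    have "bracket t u \<in> R"
    proof (rule bracket_in_span[OF _ sR])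
      show "u \<in> span {x, y, v, w, r, z}" using span by simp
      fix s assume "s \<in> {x, y, v, w, r, z}"
      then consider "s = x" | "s = y" | "s \<in> {v, w, r, z}" by blast
      then show "bracket t s \<in> R"
      proof cases
        case 1 then show ?thesis using xR[OF that] antisym[of t x] sub(4) by simp
      next
        case 2
        have "bracket y t \<in> R"
        proof (rule bracket_in_span[OF _ sR that[unfolded R_def]])
          fix s assume "s \<in> {r, z}"
          then show "bracket y s \<in> R" using asm(1)[of s] antisym[of y s] sub(4) by auto
        qed
        then show ?thesis using antisym[of t y] sub(4) 2 by simp
      next
        case 3 then show ?thesis using asm(7)[OF 3 that] antisym[of t s] sub(4) by simp
      qed
    qed
    then show ?thesis using antisym[of u t] sub(4) by simp
  qed
  have yT: "y \<notin> span {w, r, z}" "y \<notin> R" and z0: "z \<noteq> 0"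
  proof -
    have "y \<notin> span {x, v, w, r, z}"
      by (rule not_in_span_of_dim[OF dim]) (use span in \<open>simp_all add: insert_commute card_insert_if\<close>)
    moreover have "span {w, r, z} \<subseteq> span {x, v, w, r, z}" "R \<subseteq> span {x, v, w, r, z}"
      unfolding R_def by (intro span_mono; blast)+
    ultimately show "y \<notin> span {w, r, z}" "y \<notin> R" by blast+
    have "z \<notin> span {x, y, v, w, r}"
      by (rule not_in_span_of_dim[OF dim]) (use span in \<open>simp_all add: insert_commute card_insert_if\<close>)
    then show "z \<noteq> 0" using span_zero by metis
  qed
  have lw: "lw = 0"
  proof -
    have "bracket x y - c *\<^sub>R y - 1 *\<^sub>R w \<in> R" using asm(6) by (simp add: algebra_simps)
    moreover have "bracket x w - (- lw) *\<^sub>R y - 0 *\<^sub>R w \<in> R"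
      using sub(4)[OF asm(3)] antisym[of x w] by (simp add: algebra_simps)
    \<comment> \<open>On the plane of \<open>y\<close> and \<open>w\<close> modulo \<open>R\<close>,
      \<open>ad x\<close> sends \<open>y\<close> to \<open>c y + w\<close> and \<open>w\<close> to
      \<open>- lw y\<close>; its determinant is \<open>lw\<close>.\<close>
    ultimately have "c * 0 - 1 * (- lw) = 0"
      using det_zero[OF sR xR] yT(2) by blast
    then show ?thesis by simp
  qed
  have xw: "bracket x w \<in> R" using sub(4)[OF asm(3)] antisym[of x w] lw by simp
  have c: "c = 0"
  proof (rule eigenvalue_zero[OF _ _ _ yT(1)])
    have RT: "R \<subseteq> span {w, r, z}" unfolding R_def by (intro span_mono) blast
    show "subspace (span {w, r, z})" by simp
    show "bracket x y - c *\<^sub>R y \<in> span {w, r, z}"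
    proof -
      have "bracket x y - c *\<^sub>R y = (bracket x y - w - c *\<^sub>R y) + w" by simp
      then show ?thesis using RT asm(6) by (metis insertI1 span_add span_base subsetD)
    qed
    fix t assume "t \<in> span {w, r, z}"
    then show "bracket x t \<in> span {w, r, z}"
    proof (rule bracket_in_span[rotated 2])
      fix s assume "s \<in> {w, r, z}"
      then show "bracket x s \<in> span {w, r, z}" using xw xR rz RT by auto
    qed simp
  qed
  define w1 where "w1 = bracket x y"
  have w1: "w1 - w \<in> R" using asm(6) c by (simp add: w1_def)
  \<comment> \<open>\<open>z\<close> need not be central here. \<open>R\<close> gets a basis adapted
    to the action of the whole algebra, with \<open>r2\<close> central.\<close>
  obtain r1 r2 where r12: "span (insert r1 (insert r2 {0})) = span (insert r (insert z {0}))"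
    "\<And>u. bracket u r2 = 0" "\<And>u. bracket u r1 \<in> span (insert r2 {0})"
  proof (rule triangularise[of "{0}" UNIV r z])
    have "span (insert r (insert z {0})) = R" unfolding R_def by (metis insert_commute span_insert_0)
    then show "bracket k r \<in> span (insert r (insert z {0}))" "bracket k z \<in> span (insert r (insert z {0}))" for k
      using ideal rz by auto
  qed (use that in \<open>auto simp: subspace_def\<close>)
  have R: "R = span {r1, r2}" using r12(1) unfolding R_def by (metis insert_commute span_insert_0)
  have r1: "r1 \<in> R" "r2 \<in> R" by (auto simp: R intro: span_base)
  have "span {x, v, y, w1, r1, r2} = UNIV"
  proof (rule span_UNIV_if[OF span])
    have RT: "R \<subseteq> span {x, v, y, w1, r1, r2}" unfolding R by (intro span_mono) blast
    have "w1 - (w1 - w) \<in> span {x, v, y, w1, r1, r2}"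
      by (rule span_diff) (use RT w1 in \<open>auto intro: span_base\<close>)
    then have "w \<in> span {x, v, y, w1, r1, r2}" by simp
    then show "{x, y, v, w, r, z} \<subseteq> span {x, v, y, w1, r1, r2}"
      using RT rz by (auto intro: span_base)
  qed
  note iso = isomorphic_mk6[OF dim this]
  have pr: "\<exists>a b. u = a *\<^sub>R r1 + b *\<^sub>R r2" if "u \<in> R" for u
    using that unfolding R in_span_pair .
  have ww: "bracket u w1 \<in> R" if "bracket u w \<in> R" for u
    using sub(1)[OF that ideal[OF w1, of u]] by simp
  obtain p1 p2 where p: "bracket x v + lv *\<^sub>R y = p1 *\<^sub>R r1 + p2 *\<^sub>R r2"
    using pr[of "bracket x v + lv *\<^sub>R y"] sub(4)[OF asm(2)] antisym[of x v] by auto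
  obtain a1 a2 where a: "bracket x w1 = a1 *\<^sub>R r1 + a2 *\<^sub>R r2" using pr[OF ww[OF xw]] by blast
  obtain q1 q2 where q: "bracket v y = q1 *\<^sub>R r1 + q2 *\<^sub>R r2" using pr[OF asm(1)[of v]] by blast
  obtain c1 c2 where c: "bracket v w1 = c1 *\<^sub>R r1 + c2 *\<^sub>R r2" using pr[OF ww[of v]] vw rz by auto
  have "bracket y w \<in> R" using asm(1)[of w] antisym[of y w] sub(4) by simp
  then obtain b1 b2 where b: "bracket y w1 = b1 *\<^sub>R r1 + b2 *\<^sub>R r2" using pr[OF ww[of y]] by blast
  have m: "\<exists>m. bracket u r1 = m *\<^sub>R r2" for u
    using r12(3)[of u] by (auto simp: span_breakdown_eq)
  obtain mx mv my mw where m: "bracket x r1 = mx *\<^sub>R r2" "bracket v r1 = mv *\<^sub>R r2"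
    "bracket y r1 = my *\<^sub>R r2" "bracket w1 r1 = mw *\<^sub>R r2" using m by metis
  have "lie_isomorphic bracket (ideal_fam (- lv) p1 p2 a1 a2 mx q1 q2 c1 c2 mv b1 b2 my mw)"
    unfolding ideal_fam_def
    by (rule iso) (use p in \<open>simp_all add: comb6_def w1_def[symmetric] a q c b m r12(2) algebra_simps\<close>)
  \<comment> \<open>Otherwise \<open>v\<close> would commute with \<open>w\<close>, which differs
    from \<open>w1\<close> by an element of \<open>R\<close>.\<close>
  moreover have "c1 \<noteq> 0 \<or> c2 \<noteq> 0 \<or> mv \<noteq> 0"
  proof (rule ccontr)
    assume "\<not> ?thesis"
    then have "bracket v w1 = 0" "bracket v r1 = 0" using c m by auto
    moreover obtain a b where "w1 - w = a *\<^sub>R r1 + b *\<^sub>R r2" using pr[OF w1] by blast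
    then have "w = w1 - (a *\<^sub>R r1 + b *\<^sub>R r2)" by (simp add: algebra_simps)
    ultimately have "bracket v w = 0" using r12(2) by simp
    then show False using vw z0 by simp
  qed
  ultimately show ?thesis by (rule listed_ideal_fam_iso[OF lie_algebra_axioms])
qed

text \<open>\<open>r\<close> moves \<open>x\<close> in the direction of \<open>y\<close>. So
  multiples of \<open>r\<close> can be subtracted from \<open>v\<close> and \<open>w\<close> until
  they commute with \<open>x\<close> modulo \<open>R\<close>, and \<open>[x, r]\<close> can take the
  place of \<open>y\<close>. It remains to show that \<open>z\<close> is central and to straighten
  the chain of \<open>ad x\<close>.\<close>

lemma listed_of_nonideal:
  assumes dim: "dim (UNIV :: 'a set) = 6" and span: "span {x, y, v, w, r, z} = UNIV"
    and yR: "\<And>k. k \<in> {v, w, r, z} \<Longrightarrow> bracket k y \<in> span {r, z}"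
    and vx: "bracket v x - lv *\<^sub>R y \<in> span {r, z}" and wx: "bracket w x - lw *\<^sub>R y \<in> span {r, z}"
    and rx: "bracket r x - lr *\<^sub>R y \<in> span {r, z}" and zx: "bracket z x \<in> span {r, z}"
    and xy: "bracket x y - w - c *\<^sub>R y \<in> span {r, z}"
    and KR: "\<And>k t. k \<in> {v, w, r, z} \<Longrightarrow> t \<in> span {r, z} \<Longrightarrow> bracket k t \<in> span {r, z}"
    and vw: "bracket v w = z" and lr: "lr \<noteq> 0"
  shows "listed bracket"
proof -
  define R where "R = span {r, z}"
  note asm = yR vx wx rx zx xy KR
  note asm = asm[folded R_def]
  have sR: "subspace R" by (simp add: R_def)
  note sub = subspace_add[OF sR] subspace_diff[OF sR] subspace_scale[OF sR] subspace_neg[OF sR] subspace_0[OF sR]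
  have rz: "r \<in> R" "z \<in> R" by (auto simp: R_def intro: span_base)
  have Rpr: "\<exists>a b. u = a *\<^sub>R r + b *\<^sub>R z" if "u \<in> R" for u
    using that unfolding R_def in_span_pair .
  have ni: "y \<notin> R" "r \<notin> span {z}" "z \<notin> span {r}"
  proof -
    have "y \<notin> span {x, v, w, r, z}" "r \<notin> span {x, y, v, w, z}" "z \<notin> span {x, y, v, w, r}"
      by (rule not_in_span_of_dim[OF dim]; use span in \<open>simp add: insert_commute card_insert_if\<close>)+
    moreover have "R \<subseteq> span {x, v, w, r, z}" "span {z} \<subseteq> span {x, y, v, w, z}" "span {r} \<subseteq> span {x, y, v, w, r}"
      unfolding R_def by (intro span_mono; blast)+
    ultimately show "y \<notin> R" "r \<notin> span {z}" "z \<notin> span {r}" by blast+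
  qed
  have r0: "r \<noteq> 0" "z \<noteq> 0" using ni by (metis span_zero)+
  have Rz: "b *\<^sub>R z \<in> span {z}" for b by (simp add: span_base span_scale)
  \<comment> \<open>\<open>ad x\<close> takes \<open>r\<close> out of \<open>R\<close> but keeps
    \<open>z\<close> in it, so an element of \<open>R\<close> that stays in \<open>R\<close> has no
    \<open>r\<close>-part.\<close>
  have crit: "\<exists>b. u = b *\<^sub>R z" if u: "u \<in> R" "bracket x u \<in> R" for u
  proof -
    obtain a b where ab: "u = a *\<^sub>R r + b *\<^sub>R z" using Rpr[OF u(1)] by blast
    have "(a * lr) *\<^sub>R y = - bracket x u - a *\<^sub>R (bracket r x - lr *\<^sub>R y) - b *\<^sub>R bracket z x"
      unfolding ab using antisym[of x r] antisym[of x z] by (simp add: algebra_simps)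
    also have "\<dots> \<in> R" using u asm(4,5) sub by simp
    finally have "a * lr = 0"
      using ni(1) sub(3)[of "(a * lr) *\<^sub>R y" "1/(a*lr)"] by (cases "a * lr = 0") simp_all
    then show ?thesis using ab lr by auto
  qed
  \<comment> \<open>A nilpotent Lie algebra of dimension two is abelian; each of the two
    coefficients is an eigenvalue.\<close>
  have rz0: "bracket r z = 0"
  proof -
    obtain a b where ab: "bracket r z = a *\<^sub>R r + b *\<^sub>R z" using Rpr[OF asm(7)[of r z]] rz by auto
    have "b = 0"
    proof (rule eigenvalue_zero[OF _ _ _ ni(3)])
      show "bracket r z - b *\<^sub>R z \<in> span {r}" by (simp add: ab span_base span_scale)
      show "bracket r t \<in> span {r}" if "t \<in> span {r}" for t
        using that by (rule bracket_in_span[rotated 2]) (auto simp: span_zero)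
    qed simp
    moreover from this have "- a = 0"
      by (intro eigenvalue_zero[of "{0}" z r]) (use r0 ab antisym[of z r] in auto)
    ultimately show ?thesis using ab by simp
  qed
  have RR: "bracket t u = 0" if "t \<in> R" "u \<in> R" for t u
    using Rpr[OF that(1)] Rpr[OF that(2)] rz0 antisym[of z r] by auto
  define mu where "mu = lv / lr"
  define nu where "nu = lw / lr"
  define v' where "v' = v - mu *\<^sub>R r"
  define w' where "w' = w - nu *\<^sub>R r"
  define y' where "y' = bracket x r"
  have vx': "bracket v' x \<in> R"
  proof -
    have "bracket v' x = (bracket v x - lv *\<^sub>R y) - mu *\<^sub>R (bracket r x - lr *\<^sub>R y)"
      using lr by (simp add: v'_def mu_def algebra_simps)
    then show ?thesis using asm(2,4) sub by simp
  qed
  have wx': "bracket w' x \<in> R"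
  proof -
    have "bracket w' x = (bracket w x - lw *\<^sub>R y) - nu *\<^sub>R (bracket r x - lr *\<^sub>R y)"
      using lr by (simp add: w'_def nu_def algebra_simps)
    then show ?thesis using asm(3,4) sub by simp
  qed
  have xv': "bracket x v' \<in> R" "bracket x w' \<in> R" "bracket x z \<in> R"
    using vx' wx' asm(5) sub(4) antisym[of x v'] antisym[of x w'] antisym[of x z] by simp_all
  have y': "y' + lr *\<^sub>R y \<in> R"
    using sub(4)[OF asm(4)] antisym[of x r] by (simp add: y'_def)
  have KR': "bracket v' t \<in> R" "bracket w' t \<in> R" "bracket r t \<in> R" "bracket z t \<in> R" if "t \<in> R" for t
    using asm(7)[OF _ that] sub by (simp_all add: v'_def w'_def)
  have Ky: "bracket v' y \<in> R" "bracket w' y \<in> R" "bracket r y \<in> R"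
    using asm(1) sub by (simp_all add: v'_def w'_def)
  have Ky': "bracket v' y' \<in> R" "bracket w' y' \<in> R" "bracket r y' \<in> R"
  proof -
    have "bracket k y' \<in> R" if "bracket k y \<in> R" "\<And>t. t \<in> R \<Longrightarrow> bracket k t \<in> R" for k
    proof -
      have "bracket k y' = bracket k (y' + lr *\<^sub>R y) - lr *\<^sub>R bracket k y" by simp
      then show ?thesis using that y' sub by metis
    qed
    then show "bracket v' y' \<in> R" "bracket w' y' \<in> R" "bracket r y' \<in> R" using Ky KR' by blast+
  qed
  \<comment> \<open>\<open>R\<close> is abelian, so the term \<open>[[k, x], r]\<close> drops out of
    the Leibniz rule. Combined with \<open>crit\<close>, this confines \<open>[k, r]\<close> to the
    line of \<open>z\<close>.\<close>
  have key: "bracket k y' = bracket x (bracket k r)" if "bracket k x \<in> R" for k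
    using leibniz[of k x r] RR[OF that rz(1)] by (simp add: y'_def)
  obtain ka where ka: "bracket v' r = ka *\<^sub>R z"
    using crit[OF KR'(1)[OF rz(1)]] key[OF vx'] Ky'(1) by auto
  obtain la where la: "bracket w' r = la *\<^sub>R z"
    using crit[OF KR'(2)[OF rz(1)]] key[OF wx'] Ky'(2) by auto
  have Kz: "bracket k z = 0" if "bracket k x \<in> R" "\<And>t. t \<in> R \<Longrightarrow> bracket k t \<in> R" for k
  proof -
    have "bracket x (bracket k z) = bracket (bracket x k) z + bracket k (bracket x z)" by (rule leibniz)
    also have "\<dots> \<in> R" using that xv'(3) RR[of "bracket x k" z] rz sub(4) antisym[of x k] by simp
    finally have "\<exists>b. bracket k z = b *\<^sub>R z" using crit that(2) rz by blast
    then obtain b where b: "bracket k z = b *\<^sub>R z" by blast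
    have "b = 0" by (rule eigenvalue_zero[of "{0}" k z]) (use b r0 in auto)
    then show ?thesis using b by simp
  qed
  have vz: "bracket v' z = 0" "bracket w' z = 0" using Kz vx' wx' KR' by blast+
  have zy: "bracket z y' = 0" using key[of z] asm(5) rz0 antisym[of z r] by simp
  have zvw: "z = bracket v' w' + nu *\<^sub>R bracket v' r - mu *\<^sub>R bracket w' r"
    using vw antisym[of r w'] by (simp add: v'_def w'_def algebra_simps)
  have xz: "bracket x z = 0"
  proof -
    obtain e f where ef: "bracket x z = e *\<^sub>R r + f *\<^sub>R z" using Rpr[OF xv'(3)] by blast
    \<comment> \<open>If \<open>[x, z]\<close> had an \<open>r\<close>-part, then \<open>v'\<close>
      and \<open>w'\<close>, which annihilate \<open>z\<close>, would annihilate \<open>R\<close>.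
      Then \<open>z = [v', w']\<close>, and the Leibniz rule for \<open>ad x\<close> gives
      \<open>[x, z] = 0\<close>.\<close>
    have e: "e = 0"
    proof (rule ccontr)
      assume "e \<noteq> 0"
      have "bracket k r = 0" if "bracket k x \<in> R" "bracket k z = 0" for k
      proof -
        have "bracket k (bracket x z) = 0"
          using leibniz[of k x z] that RR[OF that(1) rz(2)] by simp
        then show ?thesis using that ef \<open>e \<noteq> 0\<close> by simp
      qed
      then have kr: "bracket v' r = 0" "bracket w' r = 0" using vx' wx' vz by blast+
      have R0: "bracket v' t = 0" "bracket w' t = 0" if "t \<in> R" for t
        using Rpr[OF that] kr vz by auto
      have "bracket x z = 0"
        using leibniz[of x v' w'] zvw kr R0 xv' antisym[of "bracket x v'" w'] by simp
      then have er: "e *\<^sub>R r = - (f *\<^sub>R z)" using ef by (simp add: eq_neg_iff_add_eq_0)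
      have "r = (1/e) *\<^sub>R (e *\<^sub>R r)" using \<open>e \<noteq> 0\<close> by simp
      also have "\<dots> = (- f / e) *\<^sub>R z" unfolding er by simp
      finally have "r = (- f / e) *\<^sub>R z" .
      then show False using ni(2) Rz by metis
    qed
    have "f = 0" by (rule eigenvalue_zero[of "{0}" x z]) (use ef e r0 in auto)
    then show ?thesis using ef e by simp
  qed
  obtain eta where eta: "bracket r y' = eta *\<^sub>R z"
  proof -
    obtain a b where ab: "bracket r y' = a *\<^sub>R r + b *\<^sub>R z" using Rpr[OF Ky'(3)] by blast
    have "- a = 0"
    proof (rule eigenvalue_zero[OF _ _ _ ni(2)])
      show "bracket y' r - (- a) *\<^sub>R r \<in> span {z}"
        using Rz[of "- b"] antisym[of y' r] by (simp add: ab)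
      show "bracket y' t \<in> span {z}" if "t \<in> span {z}" for t
        using that by (rule bracket_in_span[rotated 2]) (use zy antisym[of y' z] in \<open>auto simp: span_zero\<close>)
    qed simp
    then have "bracket r y' = b *\<^sub>R z" using ab by simp
    then show ?thesis by (rule that)
  qed
  obtain c1 c2 c3 where xy': "bracket x y' = - lr *\<^sub>R w' + c1 *\<^sub>R y' + c2 *\<^sub>R r + c3 *\<^sub>R z"
  proof -
    obtain a b where ab: "y' + lr *\<^sub>R y = a *\<^sub>R r + b *\<^sub>R z" using Rpr[OF y'] by blast
    obtain a' b' where ab': "bracket x y - w - c *\<^sub>R y = a' *\<^sub>R r + b' *\<^sub>R z" using Rpr[OF asm(6)] by blast
    have "bracket x y' = bracket x (y' + lr *\<^sub>R y) - lr *\<^sub>R bracket x y" by simp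
    also have "bracket x (y' + lr *\<^sub>R y) = a *\<^sub>R y'" unfolding ab using xz by (simp add: y'_def)
    also have "bracket x y = w' + nu *\<^sub>R r + c *\<^sub>R y + a' *\<^sub>R r + b' *\<^sub>R z"
      using ab' by (simp add: w'_def algebra_simps)
    also have "lr *\<^sub>R (w' + nu *\<^sub>R r + c *\<^sub>R y + a' *\<^sub>R r + b' *\<^sub>R z) =
       lr *\<^sub>R w' + c *\<^sub>R (lr *\<^sub>R y) + (lr * nu + lr * a') *\<^sub>R r + (lr * b') *\<^sub>R z"
      by (simp add: algebra_simps)
    also have "lr *\<^sub>R y = a *\<^sub>R r + b *\<^sub>R z - y'" using ab by (simp add: algebra_simps)
    finally have "bracket x y' = - lr *\<^sub>R w' + (a + c) *\<^sub>R y' + (- c * a - lr * nu - lr * a') *\<^sub>R r + (- c * b - lr * b') *\<^sub>R z"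
      by (simp add: algebra_simps)
    then show ?thesis by (rule that)
  qed
  obtain d d' where xw': "bracket x w' = d *\<^sub>R r + d' *\<^sub>R z" using Rpr[OF xv'(2)] by blast
  have span': "span {x, v', r, y', w', z} = UNIV"
  proof (rule span_UNIV_if[OF span])
    let ?B = "span {x, v', r, y', w', z}"
    have RT: "R \<subseteq> ?B" unfolding R_def by (intro span_mono) blast
    have B: "x \<in> ?B" "v' \<in> ?B" "r \<in> ?B" "y' \<in> ?B" "w' \<in> ?B" "z \<in> ?B" by (auto intro: span_base)
    have "v' + mu *\<^sub>R r \<in> ?B" "w' + nu *\<^sub>R r \<in> ?B" "(1/lr) *\<^sub>R ((y' + lr *\<^sub>R y) - y') \<in> ?B"
      by (intro span_add span_scale span_diff B subsetD[OF RT y'])+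
    then show "{x, y, v, w, r, z} \<subseteq> ?B" using B lr by (simp add: v'_def w'_def)
  qed
  have ni': "r \<notin> span {w', z}" "y' \<notin> span {w', z}"
  proof -
    have "r \<notin> span {x, v', y', w', z}" "y' \<notin> span {x, v', r, w', z}"
      by (rule not_in_span_of_dim[OF dim]; use span' in \<open>simp add: insert_commute card_insert_if\<close>)+
    moreover have "span {w', z} \<subseteq> span {x, v', y', w', z}" "span {w', z} \<subseteq> span {x, v', r, w', z}"
      by (intro span_mono; blast)+
    ultimately show "r \<notin> span {w', z}" "y' \<notin> span {w', z}" by blast+
  qed
  \<comment> \<open>Otherwise \<open>ad x\<close> would lead from \<open>r\<close> to
    \<open>y'\<close>, on to \<open>w'\<close> and back to \<open>r\<close> modulo \<open>z\<close>,
    with nonzero factors throughout, which nilpotency forbids.\<close>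
  have d: "d = 0"
  proof (rule ccontr)
    assume d: "d \<noteq> 0"
    let ?S = "span ({bracket k s | k s. k \<in> {x} \<and> s \<in> {r, y', w'}} \<union> span {z})"
    have b: "bracket x r \<in> ?S" "bracket x y' \<in> ?S" "bracket x w' \<in> ?S" "z \<in> ?S"
      by (rule span_base, blast)+ (simp add: span_base)
    have y: "y' \<in> ?S" using b(1) by (simp add: y'_def)
    have "(1/d) *\<^sub>R (bracket x w' - d' *\<^sub>R z) \<in> ?S" by (intro span_scale span_diff b)
    then have r: "r \<in> ?S" using d by (simp add: xw')
    have "(1/lr) *\<^sub>R (c1 *\<^sub>R y' + c2 *\<^sub>R r + c3 *\<^sub>R z - bracket x y') \<in> ?S"
      by (intro span_scale span_diff span_add b y r)
    then have "w' \<in> ?S" using lr by (simp add: xy')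
    then have "{r, y', w'} \<subseteq> ?S" using y r by simp
    from nilpotent_absorb[OF _ _ this] have "{r, y', w'} \<subseteq> span {z}"
    proof -
      have "bracket x t \<in> span {z}" if "t \<in> span {z}" for t
        using that by (rule bracket_in_span[rotated 2]) (use xz in \<open>auto simp: span_zero\<close>)
      then show ?thesis using nilpotent_absorb[OF _ _ \<open>{r, y', w'} \<subseteq> ?S\<close>] by simp
    qed
    then show False using ni(2) by simp
  qed
  have wz: "a *\<^sub>R w' + b *\<^sub>R z \<in> span {w', z}" for a b unfolding in_span_pair by blast
  have inv: "bracket x t \<in> span {w', z}" if "t \<in> span {w', z}" for t
    using that by (rule bracket_in_span[rotated 2]) (use xz xw' d wz[of 0 d'] in \<open>auto simp: span_zero\<close>)
  have c2: "c2 = 0"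
  proof -
    have "bracket x r - 0 *\<^sub>R r - 1 *\<^sub>R y' \<in> span {w', z}" by (simp add: y'_def span_zero)
    moreover have "bracket x y' - c2 *\<^sub>R r - c1 *\<^sub>R y' \<in> span {w', z}"
      using wz[of "- lr" c3] by (simp add: xy')
    ultimately have "0 * c1 - 1 * c2 = 0"
      using det_zero[OF subspace_span inv] ni'(1) by blast
    then show ?thesis by simp
  qed
  have c1: "c1 = 0"
    by (rule eigenvalue_zero[OF subspace_span inv _ ni'(2)]) (use wz[of "- lr" c3] in \<open>simp_all add: xy' c2\<close>)
  define w2 where "w2 = bracket x y'"
  have w2: "w2 = - lr *\<^sub>R w' + c3 *\<^sub>R z" using xy' c1 c2 by (simp add: w2_def)
  have span2: "span {x, v', r, y', w2, z} = UNIV"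
  proof (rule span_UNIV_if[OF span'])
    let ?B = "span {x, v', r, y', w2, z}"
    have B: "x \<in> ?B" "v' \<in> ?B" "r \<in> ?B" "y' \<in> ?B" "w2 \<in> ?B" "z \<in> ?B" by (auto intro: span_base)
    have "(1/lr) *\<^sub>R (c3 *\<^sub>R z - w2) \<in> ?B" by (intro span_scale span_diff B)
    then show "{x, v', r, y', w', z} \<subseteq> ?B" using B lr by (simp add: w2)
  qed
  obtain g t1 where g: "bracket x v' = g *\<^sub>R r + t1 *\<^sub>R z" using Rpr[OF xv'(1)] by blast
  have vy: "bracket v' y' = 0" "bracket w' y' = 0"
    using key[OF vx'] key[OF wx'] ka la xz by simp_all
  define s where "s = 1 - nu * ka + mu * la"
  have s: "bracket v' w' = s *\<^sub>R z" using zvw ka la by (simp add: s_def algebra_simps)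
  have zc: "bracket z k = 0" if "bracket k z = 0" for k using that antisym[of z k] by simp
  have yz: "bracket y' z = 0" using zy antisym[of y' z] by simp
  have "lie_isomorphic bracket (chain_fam g t1 (- lr * d') ka 0 (- lr * s) eta (lr * la) 0)"
    unfolding chain_fam_def
    by (rule isomorphic_mk6[OF dim span2])
      (use antisym[of r w'] antisym[of y' w'] in \<open>simp_all add: comb6_def g w2_def[symmetric] y'_def[symmetric]
        ka eta vy vz xz rz0 yz zc, simp_all add: w2 xw' d xz s vz la rz0 yz vy algebra_simps\<close>)
  \<comment> \<open>\<open>z\<close> is a combination of \<open>[v', w']\<close>,
    \<open>[v', r]\<close> and \<open>[w', r]\<close>, so these cannot all vanish.\<close>
  moreover have "ka \<noteq> 0 \<or> - lr * s \<noteq> 0 \<or> lr * la \<noteq> 0"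
    using zvw s ka la r0(2) lr by auto
  ultimately show ?thesis
    by (intro listed_via[OF lie_algebra_axioms _ listed_chain_fam]) auto
qed

end

lemma not_in_span_of_basis:
  fixes a :: "'a::real_vector"
  assumes "dim (UNIV :: 'a set) = 6" "span {e1, e2, e3, e4, e5, e6} = UNIV"
    "insert a S = {e1, e2, e3, e4, e5, e6}" "card S < 6" "finite S" "T \<subseteq> S"
  shows "a \<notin> span T"
  using not_in_span_of_dim[of 6 a S] span_mono[OF assms(6)] assms by (metis subsetD)

lemma subspace_scale_cancel:
  assumes "subspace S" "c *\<^sub>R u \<in> S" "u \<notin> S"
  shows "c = 0"
proof (rule ccontr)
  assume "c \<noteq> 0"
  then show False using subspace_scale[OF assms(1,2), of "1/c"] assms(3) by simp
qed

context nilpotent_lie begin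

text \<open>Modulo its radical \<open>R\<close>, \<omega> is a nondegenerate form on a plane. This
  pins down \<open>R\<close> as the elements of \<open>H\<close> that bracket \<open>H\<close> into
  \<open>H\<close>, and hence makes it stable under everything that preserves
  \<open>H\<close>.\<close>

lemma listed_of_line:
  assumes dim: "dim (UNIV :: 'a set) = 6" and span: "span {x0, y0, r, z, v, w} = UNIV"
    and H: "H = span {x0, y0, r, z}"
    and VH: "\<And>h. h \<in> H \<Longrightarrow> bracket v h \<in> H" "\<And>h. h \<in> H \<Longrightarrow> bracket w h \<in> H"
    and rH: "\<And>h. h \<in> H \<Longrightarrow> bracket r h \<in> H"
    and HH: "\<And>h h'. h \<in> H \<Longrightarrow> h' \<in> H \<Longrightarrow> bracket h h' \<in> span (insert w H)"
    and vw: "bracket v w = z" and xy0: "bracket x0 y0 \<notin> H"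
  shows "listed bracket"
proof -
  define R where "R = span {r, z}"
  have sR: "subspace R" and sH: "subspace H" by (simp_all add: R_def H)
  note sub = subspace_add[OF sR] subspace_diff[OF sR] subspace_scale[OF sR] subspace_neg[OF sR] subspace_0[OF sR]
  note subH = subspace_add[OF sH] subspace_diff[OF sH] subspace_scale[OF sH] subspace_neg[OF sH] subspace_0[OF sH]
  have rz: "r \<in> R" "z \<in> R" by (auto simp: R_def intro: span_base)
  have RH: "R \<subseteq> H" unfolding R_def H by (intro span_mono) blast
  have HI: "H = span (insert x0 (insert y0 R))"
  proof -
    have "u \<in> H \<longleftrightarrow> u \<in> span (insert x0 (insert y0 R))" for u
      unfolding in_span_insert2[OF sR] unfolding H R_def span_breakdown_eq[of _ x0] span_breakdown_eq[of _ y0] by blast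
    then show ?thesis by blast
  qed
  have zH: "bracket z h \<in> H" if "h \<in> H" for h
  proof -
    have "bracket z h = bracket v (bracket w h) - bracket w (bracket v h)"
      using leibniz[of v w h] vw by simp
    then show ?thesis using VH that subH(2) by simp
  qed
  have KH: "bracket k h \<in> H" if "k \<in> {v, w, r, z}" "h \<in> H" for k h
    using that VH rH zH by blast
  have RHH: "bracket t h \<in> H" if "t \<in> R" "h \<in> H" for t h
  proof -
    have "bracket h t \<in> H"
    proof (rule bracket_in_span[OF _ sH that(1)[unfolded R_def]])
      fix s assume "s \<in> {r, z}"
      then show "bracket h s \<in> H" using KH[OF _ that(2), of s] antisym[of h s] subH(4) by auto
    qed
    then show ?thesis using antisym[of t h] subH(4) by simp
  qed
  have x0: "x0 \<in> H" "y0 \<in> H" by (auto simp: H intro: span_base)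
  \<comment> \<open>Nondegeneracy: testing against \<open>x0\<close> and \<open>y0\<close> kills the
    two coordinates of \<open>u\<close> outside \<open>R\<close>.\<close>
  have crit: "u \<in> R" if u: "u \<in> H" "\<And>h. h \<in> H \<Longrightarrow> bracket u h \<in> H" for u
  proof -
    obtain a b where ab: "u - a *\<^sub>R x0 - b *\<^sub>R y0 \<in> R"
      using u(1) unfolding HI in_span_insert2[OF sR] by blast
    let ?t = "u - a *\<^sub>R x0 - b *\<^sub>R y0"
    have e: "a *\<^sub>R bracket x0 y0 = bracket u y0 - bracket ?t y0"
      "b *\<^sub>R bracket x0 y0 = bracket ?t x0 - bracket u x0"
      using antisym[of y0 x0] by (simp_all add: algebra_simps)
    have "a *\<^sub>R bracket x0 y0 \<in> H" "b *\<^sub>R bracket x0 y0 \<in> H"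
      unfolding e by (rule subH(2)[OF u(2)[OF x0(2)] RHH[OF ab x0(2)]], rule subH(2)[OF RHH[OF ab x0(1)] u(2)[OF x0(1)]])
    then have "a = 0" "b = 0" using subspace_scale_cancel[OF sH _ xy0] by blast+
    then show ?thesis using ab by simp
  qed
  have KR: "bracket k t \<in> R" if k: "k \<in> {v, w, r, z}" and t: "t \<in> R" for k t
  proof (rule crit)
    show "bracket k t \<in> H" using KH[OF k] t RH by blast
    fix h assume h: "h \<in> H"
    have "bracket (bracket k t) h = bracket k (bracket t h) - bracket t (bracket k h)"
      using leibniz[of k t h] by simp
    then show "bracket (bracket k t) h \<in> H"
      using KH[OF k] RHH[OF t] h subH(2) by simp
  qed
  obtain x1 y where x1: "span (insert x1 (insert y R)) = H"
    and Ky: "\<And>k. k \<in> {v, w, r, z} \<Longrightarrow> bracket k y \<in> R"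
    and Kx1: "\<And>k. k \<in> {v, w, r, z} \<Longrightarrow> bracket k x1 \<in> span (insert y R)"
  proof (rule triangularise[OF sR, of "{v, w, r, z}" x0 y0])
    show "bracket k t \<in> R" if "k \<in> {v, w, r, z}" "t \<in> R" for k t by (rule KR[OF that])
    show "bracket k x0 \<in> span (insert x0 (insert y0 R))" "bracket k y0 \<in> span (insert x0 (insert y0 R))"
      if "k \<in> {v, w, r, z}" for k
      unfolding HI[symmetric] by (rule KH[OF that x0(1)], rule KH[OF that x0(2)])
  qed (use that HI in blast)
  have x1H: "x1 \<in> H" "y \<in> H" unfolding x1[symmetric] by (auto intro: span_base)
  have x1y: "bracket x1 y \<notin> H"
  proof
    assume *: "bracket x1 y \<in> H"
    then have **: "bracket y x1 \<in> H" using antisym[of y x1] subH(4) by simp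
    have inH: "s \<in> H" if "s \<in> insert x1 (insert y R)" for s using that x1H RH by blast
    have ss: "bracket s s' \<in> H" if s: "s \<in> insert x1 (insert y R)" "s' \<in> insert x1 (insert y R)" for s s'
    proof -
      consider "s \<in> R" | "s' \<in> R" | "s \<in> {x1, y}" "s' \<in> {x1, y}" using s by blast
      then show ?thesis
      proof cases
        case 1 then show ?thesis using RHH inH[OF s(2)] by blast
      next
        case 2 then show ?thesis using RHH inH[OF s(1)] antisym[of s s'] subH(4) by simp
      next
        case 3 then show ?thesis using * ** subH(5) by auto
      qed
    qed
    have "bracket s h \<in> H" if "s \<in> insert x1 (insert y R)" "h \<in> H" for s h
      by (rule bracket_in_span[OF ss[OF that(1)] sH that(2)[folded x1]])
    then have "bracket h s \<in> H" if "s \<in> insert x1 (insert y R)" "h \<in> H" for s h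
      using that antisym[of h s] subH(4) by simp
    then have "bracket h h' \<in> H" if "h \<in> H" "h' \<in> H" for h h'
      using bracket_in_span[OF _ sH that(2)[folded x1]] that(1) by blast
    then show False using xy0 x0 by blast
  qed
  obtain de where de: "bracket x1 y - de *\<^sub>R w \<in> H"
    using HH[OF x1H] unfolding in_span_insert[OF sH] by blast
  have de0: "de \<noteq> 0" using de x1y by auto
  \<comment> \<open>The rescaling makes the \<open>V\<close>-part of \<open>[x, y]\<close> exactly
    \<open>w\<close>.\<close>
  define x where "x = (1/de) *\<^sub>R x1"
  have xH: "x \<in> H" using x1H subH by (simp add: x_def)
  have Kx: "bracket k x \<in> span (insert y R)" if "k \<in> {v, w, r, z}" for k
    using Kx1[OF that] by (simp add: x_def span_scale)
  have xy: "bracket x y - w \<in> H"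
    using subH(3)[OF de, of "1/de"] de0 by (simp add: x_def algebra_simps)
  have span': "span {x, y, v, w, r, z} = UNIV"
  proof (rule span_UNIV_if[OF span])
    let ?B = "span {x, y, v, w, r, z}"
    have B: "x \<in> ?B" "y \<in> ?B" "v \<in> ?B" "w \<in> ?B" "r \<in> ?B" "z \<in> ?B" by (auto intro: span_base)
    have "R \<subseteq> ?B" unfolding R_def by (intro span_mono) blast
    moreover have "x1 \<in> ?B" using span_scale[OF B(1), of de] de0 by (simp add: x_def)
    ultimately have "H \<subseteq> ?B" unfolding x1[symmetric] using B by (intro span_minimal) auto
    then show "{x0, y0, r, z, v, w} \<subseteq> ?B" using B x0 by blast
  qed
  obtain lv lw lr where l: "bracket v x - lv *\<^sub>R y \<in> R" "bracket w x - lw *\<^sub>R y \<in> R" "bracket r x - lr *\<^sub>R y \<in> R"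
    using Kx unfolding in_span_insert[OF sR] by (metis insertI1 insertI2)
  \<comment> \<open>On \<open>H\<close> modulo \<open>R\<close> the elements \<open>v\<close> and
    \<open>w\<close> act by strictly triangular matrices of size two. These commute, so
    \<open>z = [v, w]\<close> acts by zero.\<close>
  have zx: "bracket z x \<in> R"
  proof -
    have *: "bracket k u \<in> R" if "k \<in> {v, w, r, z}" "u \<in> span (insert y R)" for k u
      by (rule bracket_in_span[OF _ sR that(2)]) (use that(1) Ky KR in blast)
    have "bracket z x = bracket v (bracket w x) - bracket w (bracket v x)"
      using leibniz[of v w x] vw by simp
    then show ?thesis using * Kx sub(2) by simp
  qed
  obtain al c where alc: "bracket x y - w - al *\<^sub>R x - c *\<^sub>R y \<in> R"
  proof -
    obtain a b where "bracket x y - w - a *\<^sub>R x1 - b *\<^sub>R y \<in> R"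
      using xy unfolding x1[symmetric] in_span_insert2[OF sR] by blast
    then have "bracket x y - w - (a*de) *\<^sub>R x - b *\<^sub>R y \<in> R" using de0 by (simp add: x_def)
    then show ?thesis by (rule that)
  qed
  \<comment> \<open>\<open>ad y\<close> preserves the hyperplane spanned by the basis vectors other
    than \<open>x\<close>, and \<open>- al\<close> is its eigenvalue on \<open>x\<close> modulo that
    hyperplane.\<close>
  have "- al = 0"
  proof (rule eigenvalue_zero)
    let ?T = "span {y, v, w, r, z}"
    have RT: "R \<subseteq> ?T" unfolding R_def by (intro span_mono) blast
    show "x \<notin> ?T"
      by (rule not_in_span_of_basis[OF dim span']) (auto simp: card_insert_if)
    have "bracket y x - (- al) *\<^sub>R x = - (bracket x y - w - al *\<^sub>R x - c *\<^sub>R y) - w - c *\<^sub>R y"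
      using antisym[of y x] by simp
    also have "\<dots> \<in> ?T"
      by (intro span_diff span_neg span_scale subsetD[OF RT alc]) (auto intro: span_base)
    finally show "bracket y x - (- al) *\<^sub>R x \<in> ?T" .
    show "bracket y t \<in> ?T" if "t \<in> ?T" for t
    proof (rule bracket_in_span[OF _ _ that])
      fix s assume "s \<in> {y, v, w, r, z}"
      then consider "s = y" | "s \<in> {v, w, r, z}" by blast
      then show "bracket y s \<in> ?T"
        by cases (use Ky[of s] RT antisym[of y s] sub(4) in \<open>auto simp: span_zero\<close>)
    qed simp
  qed simp
  then have c: "bracket x y - w - c *\<^sub>R y \<in> R" using alc by simp
  show ?thesis
  proof (cases "lr = 0")
    case True
    then have "bracket r x \<in> R" using l(3) by simp
    from listed_of_ideal[OF dim span' Ky[unfolded R_def] l(1,2)[unfolded R_def] this[unfolded R_def]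
        zx[unfolded R_def] c[unfolded R_def] KR[unfolded R_def] vw]
    show ?thesis .
  next
    case False
    from listed_of_nonideal[OF dim span' Ky[unfolded R_def] l[unfolded R_def]
        zx[unfolded R_def] c[unfolded R_def] KR[unfolded R_def] vw False]
    show ?thesis .
  qed
qed

section \<open>The values of \<omega> in all directions of \<open>V\<close>\<close>

text \<open>
  Here \<open>c\<close> is a cyclic vector for \<open>ad a\<close> modulo \<open>z\<close>.
\<close>

lemma listed_of_chain:
  assumes dim: "dim (UNIV :: 'a set) = 6" and span: "span {a, b, c, v1, v2, z} = UNIV"
    and z: "\<And>u. bracket u z = 0" and vv: "bracket v1 v2 = z"
    and ab: "bracket a b = v1 + p2 *\<^sub>R b + p3 *\<^sub>R c + p4 *\<^sub>R z"
    and ac: "bracket a c = v2 + q2 *\<^sub>R b + q3 *\<^sub>R c + q4 *\<^sub>R z"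
    and av: "bracket a v1 = g1 *\<^sub>R b + g2 *\<^sub>R c + g3 *\<^sub>R z" "bracket a v2 = g0 *\<^sub>R z"
    and bc: "bracket b c = E *\<^sub>R z" and bv: "bracket b v1 = F *\<^sub>R z" "bracket b v2 = 0"
    and cv: "bracket c v1 = G *\<^sub>R z" "bracket c v2 = C *\<^sub>R z"
  shows "listed bracket"
proof -
  have z0: "z \<noteq> 0"
  proof -
    have "z \<notin> span {}" by (rule not_in_span_of_basis[OF dim span, of _ "{a, b, c, v1, v2}"]) (auto simp: card_insert_if)
    then show ?thesis by simp
  qed
  have nb: "b \<notin> span {c, v2, z}" "b \<notin> span {v2, z}"
    by (rule not_in_span_of_basis[OF dim span, of _ "{a, c, v1, v2, z}"]; auto simp: card_insert_if)+
  have zz: "bracket z u = 0" for u using z[of u] antisym[of z u] by simp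
  have o: "bracket c b = - (E *\<^sub>R z)" "bracket v1 b = - (F *\<^sub>R z)" "bracket v2 b = 0"
     "bracket v1 c = - (G *\<^sub>R z)" "bracket v2 c = - (C *\<^sub>R z)" "bracket v2 v1 = - z"
    using antisym[of c b] antisym[of v1 b] antisym[of v2 b] antisym[of v1 c] antisym[of v2 c] antisym[of v2 v1]
      bc bv cv vv by simp_all
  have lz: "x = 0" if "x *\<^sub>R z = 0" for x :: real using that z0 by simp
  \<comment> \<open>\<open>ad a\<close> is a derivation and \<open>z\<close> is central; the
    identities that follow are the \<open>z\<close>-coefficients of the Leibniz rule applied to
    pairs among \<open>b\<close>, \<open>c\<close>, \<open>v1\<close>, \<open>v2\<close>.\<close>
  have pC: "1 + p3 * C = 0"
    using leibniz[of a b v2] by (intro lz) (simp add: ab av bv vv cv z zz algebra_simps)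
  then have C: "C \<noteq> 0" by auto
  have "q3 * C = 0"
    using leibniz[of a c v2] by (intro lz) (simp add: ac av bv vv cv z zz algebra_simps)
  then have q3: "q3 = 0" using C by simp
  have "g2 * C = 0"
    using leibniz[of a v1 v2] by (intro lz) (simp add: ac av bv vv cv z zz algebra_simps)
  then have g2: "g2 = 0" using C by simp
  have J: "- 1 + q2 * F - g1 * E = 0"
    using leibniz[of a c v1] by (intro lz) (simp add: ac av bv vv cv z zz o q3 g2 algebra_simps)
  \<comment> \<open>With \<open>q2 = 0\<close> the span of \<open>c\<close>, \<open>v2\<close>,
    \<open>z\<close> would be invariant under \<open>ad a\<close>, whose determinant on
    \<open>b\<close>, \<open>v1\<close> modulo it is \<open>- g1\<close>. Then
    \<open>g1 = 0\<close>, and \<open>J\<close> reads \<open>-1 = 0\<close>.\<close>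
  have q2: "q2 \<noteq> 0"
  proof
    assume q2: "q2 = 0"
    have "p2 * 0 - 1 * g1 = 0"
    proof (rule det_zero[of "span {c, v2, z}" a b p2 1 v1 g1 0])
      show "bracket a t \<in> span {c, v2, z}" if "t \<in> span {c, v2, z}" for t
      proof (rule bracket_in_span[OF _ _ that])
        fix s assume s: "s \<in> {c, v2, z}"
        have "v2 + q4 *\<^sub>R z \<in> span {c, v2, z}" "g0 *\<^sub>R z \<in> span {c, v2, z}"
          by (intro span_add span_scale; simp add: span_base)+
        then show "bracket a s \<in> span {c, v2, z}" using s ac q2 q3 av z by (auto simp: span_zero)
      qed simp
      have "p3 *\<^sub>R c + p4 *\<^sub>R z \<in> span {c, v2, z}" "g3 *\<^sub>R z \<in> span {c, v2, z}"
        by (intro span_add span_scale; simp add: span_base)+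
      then show "bracket a b - p2 *\<^sub>R b - 1 *\<^sub>R v1 \<in> span {c, v2, z}"
        "bracket a v1 - g1 *\<^sub>R b - 0 *\<^sub>R v1 \<in> span {c, v2, z}" by (simp_all add: ab av g2)
    qed (use nb in auto)
    then show False using J q2 by simp
  qed
  \<comment> \<open>\<open>n\<close> is the successor of \<open>b\<close> under \<open>ad a\<close>,
    up to multiples of \<open>b\<close> and \<open>z\<close>. The determinant on \<open>b\<close>
    and \<open>n\<close> modulo \<open>v2\<close> and \<open>z\<close> is the negative of
    \<open>g1 + p3 * q2\<close>.\<close>
  define n where "n = v1 + p3 *\<^sub>R c"
  have zT: "t *\<^sub>R z \<in> span {v2, z}" "s *\<^sub>R v2 + t *\<^sub>R z \<in> span {v2, z}" for s t
    by (intro span_add span_scale; simp add: span_base)+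
  have an: "bracket a n = (g1 + p3 * q2) *\<^sub>R b + (p3 *\<^sub>R v2 + (g3 + p3 * q4) *\<^sub>R z)"
    by (simp add: n_def av ac g2 q3 algebra_simps)
  have inv: "bracket a t \<in> span {v2, z}" if "t \<in> span {v2, z}" for t
    by (rule bracket_in_span[OF _ _ that]) (use av z zT in \<open>auto simp: span_zero\<close>)
  have "p2 * 0 - 1 * (g1 + p3 * q2) = 0"
  proof (rule det_zero[of "span {v2, z}" a b p2 1 n "g1 + p3 * q2" 0])
    show "bracket a b - p2 *\<^sub>R b - 1 *\<^sub>R n \<in> span {v2, z}"
      using zT(1)[of p4] by (simp add: ab n_def)
    show "bracket a n - (g1 + p3 * q2) *\<^sub>R b - 0 *\<^sub>R n \<in> span {v2, z}"
      using zT(2) by (simp add: an)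
  qed (use nb inv in auto)
  then have ka: "g1 + p3 * q2 = 0" by simp
  have p2: "p2 = 0"
  proof (rule eigenvalue_zero)
    let ?T = "span {n, v2, z}"
    have T: "n \<in> ?T" "v2 \<in> ?T" "z \<in> ?T" by (auto intro: span_base)
    show "bracket a t \<in> ?T" if "t \<in> ?T" for t
    proof (rule bracket_in_span[OF _ _ that])
      have "bracket a n \<in> ?T" "bracket a v2 \<in> ?T" "bracket a z \<in> ?T"
        unfolding an ka av z using T by (simp_all add: span_add span_scale span_zero)
      then show "bracket a s \<in> ?T" if "s \<in> {n, v2, z}" for s using that by blast
    qed simp
    have "n + p4 *\<^sub>R z \<in> ?T" by (intro span_add span_scale T)
    then show "bracket a b - p2 *\<^sub>R b \<in> ?T" by (simp add: ab n_def)
    show "b \<notin> ?T"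
    proof
      assume "b \<in> ?T"
      then have "b \<in> span {v1, c, v2, z}"
      proof (rule subsetD[OF span_minimal, rotated 2])
        show "{n, v2, z} \<subseteq> span {v1, c, v2, z}"
          unfolding n_def by (auto intro!: span_add span_scale intro: span_base)
      qed simp
      moreover have "b \<notin> span {v1, c, v2, z}"
        by (rule not_in_span_of_basis[OF dim span, of _ "{a, c, v1, v2, z}"]) (auto simp: card_insert_if)
      ultimately show False by simp
    qed
  qed simp
  define m2 where "m2 = bracket a c"
  define m3 where "m3 = bracket a m2"
  define m4 where "m4 = bracket a m3"
  have m2: "m2 = v2 + q2 *\<^sub>R b + q4 *\<^sub>R z" by (simp add: m2_def ac q3)
  have m3: "m3 = q2 *\<^sub>R v1 + (q2 * p3) *\<^sub>R c + (g0 + q2 * p4) *\<^sub>R z"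
    by (simp add: m3_def m2 ab av z p2 algebra_simps)
  have "m4 = (q2 * (g1 + p3 * q2)) *\<^sub>R b + (q2 * p3) *\<^sub>R v2 + (q2 * g3 + q2 * p3 * q4) *\<^sub>R z"
    by (simp add: m4_def m3 ac av z q3 g2 algebra_simps)
  then have m4: "m4 = (q2 * p3) *\<^sub>R v2 + (q2 * g3 + q2 * p3 * q4) *\<^sub>R z" by (simp add: ka)
  have p3: "p3 \<noteq> 0" using pC by auto
  have span': "span {a, c, m2, m3, m4, z} = UNIV"
  proof (rule span_UNIV_if[OF span])
    let ?B = "span {a, c, m2, m3, m4, z}"
    have B: "a \<in> ?B" "c \<in> ?B" "m2 \<in> ?B" "m3 \<in> ?B" "m4 \<in> ?B" "z \<in> ?B" by (auto intro: span_base)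
    have "(1/(q2 * p3)) *\<^sub>R (m4 - (q2 * g3 + q2 * p3 * q4) *\<^sub>R z) \<in> ?B" by (intro span_diff span_scale B)
    then have v2: "v2 \<in> ?B" using q2 p3 by (simp add: m4)
    have "(1/q2) *\<^sub>R (m2 - v2 - q4 *\<^sub>R z) \<in> ?B" by (intro span_diff span_scale B v2)
    then have b: "b \<in> ?B" using q2 by (simp add: m2)
    have "(1/q2) *\<^sub>R (m3 - (q2 * p3) *\<^sub>R c - (g0 + q2 * p4) *\<^sub>R z) \<in> ?B" by (intro span_diff span_scale B)
    then have "v1 \<in> ?B" using q2 by (simp add: m3)
    then show "{a, b, c, v1, v2, z} \<subseteq> ?B" using B v2 b by simp
  qed
  have "\<exists>t. bracket u u' = t *\<^sub>R z" if "u \<in> {c, m2, m3, m4}" "u' \<in> {c, m2, m3, m4}" for u u'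
  proof -
    have "bracket u u' \<in> span {z}" if u: "u \<in> span {b, c, v1, v2, z}" and u': "u' \<in> span {b, c, v1, v2, z}" for u u'
    proof (rule bracket_in_span[OF _ _ u'])
      fix s' assume s': "s' \<in> {b, c, v1, v2, z}"
      have "bracket s' u \<in> span {z}"
      proof (rule bracket_in_span[OF _ _ u])
        have x: "t *\<^sub>R z \<in> span {z}" "- (t *\<^sub>R z) \<in> span {z}" "z \<in> span {z}" "- z \<in> span {z}" for t
          by (simp_all add: span_base span_scale span_neg)
        fix s assume "s \<in> {b, c, v1, v2, z}"
        then show "bracket s' s \<in> span {z}"
          using s' x by (auto simp: bc bv cv vv o z zz span_zero)
      qed simp
      then show "bracket u s' \<in> span {z}" using antisym[of u s'] span_neg by metis
    qed simp
    moreover have "{c, m2, m3, m4} \<subseteq> span {b, c, v1, v2, z}"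
      unfolding m2 m3 m4 by (auto intro!: span_add span_scale intro: span_base)
    ultimately have "bracket u u' \<in> span {z}" using that by blast
    then show ?thesis by (auto simp: span_breakdown_eq)
  qed
  then obtain k e eta k' th where m: "bracket c m2 = k *\<^sub>R z" "bracket c m3 = e *\<^sub>R z"
     "bracket m2 m3 = eta *\<^sub>R z" "bracket m2 m4 = k' *\<^sub>R z" "bracket m3 m4 = th *\<^sub>R z"
    by (metis insertCI)
  have cm4: "bracket c m4 = (q2 * p3 * C) *\<^sub>R z" by (simp add: m4 cv z)
  have am4: "bracket a m4 = (q2 * p3 * g0) *\<^sub>R z" by (simp add: m4 av z)
  have "lie_isomorphic bracket (chain_fam 1 0 (q2 * p3 * g0) k e (q2 * p3 * C) eta k' th)"
    unfolding chain_fam_def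
    by (rule isomorphic_mk6[OF dim span'])
      (simp_all add: comb6_def m2_def[symmetric] m3_def[symmetric] m4_def[symmetric] m cm4 am4 z)
  then show ?thesis
    using q2 p3 C by (intro listed_via[OF lie_algebra_axioms _ listed_chain_fam]) auto
qed

text \<open>Here \<open>v2\<close> acts on \<open>H\<close> trivially modulo \<open>z\<close>. The
  coefficient \<open>B\<close> of \<open>[b, v2]\<close> is removed by subtracting a multiple of
  \<open>c\<close> from \<open>b\<close>; this works once \<open>[c, v2]\<close> is known to be
  nonzero.\<close>

lemma listed_of_kernel:
  assumes dim: "dim (UNIV :: 'a set) = 6" and span: "span {a, b, c, v1, v2, z} = UNIV"
    and z: "\<And>u. bracket u z = 0" and vv: "bracket v1 v2 = z"
    and ab: "bracket a b = v1 + p2 *\<^sub>R b + p3 *\<^sub>R c + p4 *\<^sub>R z"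
    and ac: "bracket a c = v2 + q2 *\<^sub>R b + q3 *\<^sub>R c + q4 *\<^sub>R z"
    and av: "bracket a v1 = g1 *\<^sub>R b + g2 *\<^sub>R c + g3 *\<^sub>R z" "bracket a v2 = g0 *\<^sub>R z"
    and bc: "bracket b c = E *\<^sub>R z" and bv: "bracket b v1 = F *\<^sub>R z" "bracket b v2 = B *\<^sub>R z"
    and cv: "bracket c v1 = G *\<^sub>R z" "bracket c v2 = C *\<^sub>R z"
  shows "listed bracket"
proof -
  have z0: "z \<noteq> 0"
  proof -
    have "z \<notin> span {}" by (rule not_in_span_of_basis[OF dim span, of _ "{a, b, c, v1, v2}"]) (auto simp: card_insert_if)
    then show ?thesis by simp
  qed
  have zz: "bracket z u = 0" for u using z[of u] antisym[of z u] by simp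
  have lz: "x = 0" if "x *\<^sub>R z = 0" for x :: real using that z0 by simp
  have o: "bracket c b = - (E *\<^sub>R z)" using antisym[of c b] bc by simp
  have e1: "1 + p2 * B + p3 * C = 0"
    using leibniz[of a b v2] by (intro lz) (simp add: ab av bv vv cv z zz algebra_simps)
  have e2: "q2 * B + q3 * C = 0"
    using leibniz[of a c v2] by (intro lz) (simp add: ac av bv vv cv z zz algebra_simps)
  have e3: "g1 * B + g2 * C = 0"
    using leibniz[of a v1 v2] by (intro lz) (simp add: ac av bv vv cv z zz algebra_simps)
  \<comment> \<open>For \<open>C = 0\<close> the first identity gives \<open>1 + p2 * B = 0\<close>,
    yet \<open>p2\<close> is an eigenvalue of \<open>ad a\<close> on \<open>b\<close> modulo
    \<open>c\<close>, \<open>v1\<close>, \<open>v2\<close>, \<open>z\<close>.\<close>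
  have C: "C \<noteq> 0"
  proof
    assume C: "C = 0"
    then have B: "B \<noteq> 0" "p2 \<noteq> 0" "q2 = 0" "g1 = 0" using e1 e2 e3 by auto
    let ?T = "span {v2, z}" and ?S = "span {c, v1, v2, z}"
    have zT: "x *\<^sub>R z \<in> ?T" "v2 + x *\<^sub>R z \<in> ?T" for x by (intro span_add span_scale; simp add: span_base)+
    have "q3 = 0"
    proof (rule eigenvalue_zero)
      show "bracket a t \<in> ?T" if "t \<in> ?T" for t
        by (rule bracket_in_span[OF _ _ that]) (use av z zT in \<open>auto simp: span_zero\<close>)
      show "bracket a c - q3 *\<^sub>R c \<in> ?T" using zT by (simp add: ac B)
      show "c \<notin> ?T" by (rule not_in_span_of_basis[OF dim span, of _ "{a, b, v1, v2, z}"]) (auto simp: card_insert_if)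
    qed simp
    have S: "c \<in> ?S" "v1 \<in> ?S" "v2 \<in> ?S" "z \<in> ?S" by (auto intro: span_base)
    have "p2 = 0"
    proof (rule eigenvalue_zero)
      have "v2 + q4 *\<^sub>R z \<in> ?S" "g2 *\<^sub>R c + g3 *\<^sub>R z \<in> ?S" "g0 *\<^sub>R z \<in> ?S" "v1 + p3 *\<^sub>R c + p4 *\<^sub>R z \<in> ?S"
        by (intro span_add span_scale S)+
      note m = this
      show "bracket a t \<in> ?S" if "t \<in> ?S" for t
        by (rule bracket_in_span[OF _ _ that]) (use m ac av z B \<open>q3 = 0\<close> in \<open>auto simp: span_zero\<close>)
      show "bracket a b - p2 *\<^sub>R b \<in> ?S" using m by (simp add: ab algebra_simps)
      show "b \<notin> ?S" by (rule not_in_span_of_basis[OF dim span, of _ "{a, c, v1, v2, z}"]) (auto simp: card_insert_if)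
    qed simp
    then show False using B by simp
  qed
  define m where "m = B / C"
  define b' where "b' = b - m *\<^sub>R c"
  define v1' where "v1' = v1 - m *\<^sub>R v2"
  have m: "B = m * C" using C by (simp add: m_def)
  have b: "b = b' + m *\<^sub>R c" "v1 = v1' + m *\<^sub>R v2" by (simp_all add: b'_def v1'_def)
  show ?thesis
  proof (rule listed_of_chain[OF dim])
    show "span {a, b', c, v1', v2, z} = UNIV"
    proof (rule span_UNIV_if[OF span])
      let ?B = "span {a, b', c, v1', v2, z}"
      have B: "a \<in> ?B" "b' \<in> ?B" "c \<in> ?B" "v1' \<in> ?B" "v2 \<in> ?B" "z \<in> ?B" by (auto intro: span_base)
      then show "{a, b, c, v1, v2, z} \<subseteq> ?B" unfolding b by (auto intro!: span_add span_scale)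
    qed
    show "bracket u z = 0" for u by (rule z)
    show "bracket v1' v2 = z" using vv by (simp add: v1'_def)
    show "bracket a b' = v1' + (p2 - m * q2) *\<^sub>R b' + (p3 + p2 * m - m * q3 - m * q2 * m) *\<^sub>R c + (p4 - m * q4) *\<^sub>R z"
      by (simp add: b'_def v1'_def ab ac algebra_simps)
    show "bracket a c = v2 + q2 *\<^sub>R b' + (q3 + q2 * m) *\<^sub>R c + q4 *\<^sub>R z"
      by (simp add: b'_def ac algebra_simps)
    show "bracket a v1' = g1 *\<^sub>R b' + (g2 + g1 * m) *\<^sub>R c + (g3 - m * g0) *\<^sub>R z"
      by (simp add: b'_def v1'_def av algebra_simps)
    show "bracket a v2 = g0 *\<^sub>R z" by (rule av)
    show "bracket b' c = E *\<^sub>R z" by (simp add: b'_def bc)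
    show "bracket b' v1' = (F - m * B - m * G + m * m * C) *\<^sub>R z"
      by (simp add: b'_def v1'_def bv cv algebra_simps)
    show "bracket b' v2 = 0" by (simp add: b'_def bv cv m)
    show "bracket c v1' = (G - m * C) *\<^sub>R z" by (simp add: v1'_def cv algebra_simps)
    show "bracket c v2 = C *\<^sub>R z" by (rule cv)
  qed
qed

lemma listed_of_plane:
  assumes dim: "dim (UNIV :: 'a set) = 6" and span: "span {a, b, c, v1, v2, z} = UNIV"
    and H: "H = span {a, b, c, z}"
    and VH: "\<And>v h. v \<in> {v1, v2} \<Longrightarrow> h \<in> H \<Longrightarrow> bracket v h \<in> H"
    and vv: "bracket v1 v2 = z"
    and abH: "bracket a b - v1 \<in> H" and acH: "bracket a c - v2 \<in> H" and bcH: "bracket b c \<in> H"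
  shows "listed bracket"
proof -
  define cmb where "cmb p q s t = p *\<^sub>R a + q *\<^sub>R b + s *\<^sub>R c + t *\<^sub>R z" for p q s t
  have sH: "subspace H" by (simp add: H)
  note subH = subspace_add[OF sH] subspace_diff[OF sH] subspace_scale[OF sH] subspace_neg[OF sH] subspace_0[OF sH]
  have inH: "a \<in> H" "b \<in> H" "c \<in> H" "z \<in> H" by (auto simp: H intro: span_base)
  have cmbH: "cmb p q s t \<in> H" for p q s t unfolding cmb_def by (intro subH inH)
  have Hcmb: "\<exists>p q s t. u = cmb p q s t" if "u \<in> H" for u
  proof -
    obtain p q s t where "u - p *\<^sub>R a - q *\<^sub>R b - s *\<^sub>R c - t *\<^sub>R z = 0"
      using \<open>u \<in> H\<close> unfolding H span_breakdown_eq by auto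
    then have "u = cmb p q s t" by (simp add: cmb_def algebra_simps)
    then show ?thesis by blast
  qed
  have ni1: "v1 \<notin> span {a, b, c, v2, z}"
    by (rule not_in_span_of_basis[OF dim span, of _ "{a, b, c, v2, z}"]) (auto simp: card_insert_if)
  have ni2: "v2 \<notin> span {a, b, c, v1, z}"
    by (rule not_in_span_of_basis[OF dim span, of _ "{a, b, c, v1, z}"]) (auto simp: card_insert_if)
  have ni3: "z \<notin> span {}"
    by (rule not_in_span_of_basis[OF dim span, of _ "{a, b, c, v1, v2}"]) (auto simp: card_insert_if)
  have ni4: "b \<notin> span {z}"
    by (rule not_in_span_of_basis[OF dim span, of _ "{a, c, v1, v2, z}"]) (auto simp: card_insert_if)
  have ni5: "a \<notin> span {b, c, v1, v2, z}"
    by (rule not_in_span_of_basis[OF dim span, of _ "{b, c, v1, v2, z}"]) (auto simp: card_insert_if)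
  have ni6: "c \<notin> span {b, z}"
    by (rule not_in_span_of_basis[OF dim span, of _ "{a, b, v1, v2, z}"]) (auto simp: card_insert_if)
  have z0: "z \<noteq> 0" using ni3 by auto
  have indep: "p = 0" "q = 0" if pq: "p *\<^sub>R v1 + q *\<^sub>R v2 \<in> H" for p q
  proof -
    have "H \<subseteq> span {a, b, c, v2, z}" "H \<subseteq> span {a, b, c, v1, z}" unfolding H by (intro span_mono; blast)+
    then have 1: "p *\<^sub>R v1 + q *\<^sub>R v2 \<in> span {a, b, c, v2, z}" "p *\<^sub>R v1 + q *\<^sub>R v2 \<in> span {a, b, c, v1, z}"
      using pq by blast+
    have 2: "q *\<^sub>R v2 \<in> span {a, b, c, v2, z}" "p *\<^sub>R v1 \<in> span {a, b, c, v1, z}"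
      by (rule span_scale, rule span_base, simp)+
    have "p *\<^sub>R v1 \<in> span {a, b, c, v2, z}" "q *\<^sub>R v2 \<in> span {a, b, c, v1, z}"
      using span_diff[OF 1(1) 2(1)] span_diff[OF 1(2) 2(2)] by simp_all
    then show "p = 0" "q = 0" using subspace_scale_cancel[OF subspace_span] ni1 ni2 by blast+
  qed
  have zH: "bracket z h \<in> H" if "h \<in> H" for h
  proof -
    have "bracket z h = bracket v1 (bracket v2 h) - bracket v2 (bracket v1 h)"
      using leibniz[of v1 v2 h] vv by simp
    then show ?thesis using VH that subH(2) by simp
  qed
  have vg: "bracket v u \<in> H" if v: "v \<in> {v1, v2}" for v u
  proof (rule bracket_in_span[OF _ sH])
    show "u \<in> span {a, b, c, v1, v2, z}" using span by simp
    fix s assume "s \<in> {a, b, c, v1, v2, z}"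
    then consider "s \<in> {a, b, c, z}" | "s \<in> {v1, v2}" by blast
    then show "bracket v s \<in> H"
    proof cases
      case 1 then show ?thesis using VH[OF v] inH by blast
    next
      case 2
      have "bracket v2 v1 = - z" "- z \<in> H" using antisym[of v2 v1] vv subH(4) inH(4) by simp_all
      then show ?thesis using 2 v vv inH(4) subH(5) by auto
    qed
  qed
  have om: "bracket (cmb p q s t) (cmb p' q' s' t') - (p * q' - q * p') *\<^sub>R v1 - (p * s' - s * p') *\<^sub>R v2 \<in> H"
    for p q s t p' q' s' t'
  proof -
    have "bracket (cmb p q s t) (cmb p' q' s' t') - (p * q' - q * p') *\<^sub>R v1 - (p * s' - s * p') *\<^sub>R v2 =
      (p * q' - q * p') *\<^sub>R (bracket a b - v1) + (p * s' - s * p') *\<^sub>R (bracket a c - v2)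
      + (q * s' - s * q') *\<^sub>R bracket b c + t *\<^sub>R bracket z (cmb p' q' s' t') - t' *\<^sub>R bracket z (cmb p q s t)"
      using antisym[of b a] antisym[of c a] antisym[of c b] antisym[of a z] antisym[of b z] antisym[of c z]
      unfolding cmb_def by (simp add: algebra_simps)
    also have "\<dots> \<in> H" by (intro subH(1,2,3) abH acH bcH zH cmbH)
    finally show ?thesis .
  qed
  \<comment> \<open>\<omega> has the coordinates \<open>p q' - q p'\<close> along \<open>v1\<close>
    and \<open>p s' - s p'\<close> along \<open>v2\<close>. Two brackets are summed because
    invariance has the form \<omega>(v h, h') + \<omega>(h, v h') = 0; a single bracket is handled
    with zeros for the second.\<close>
  have W: "p * q' - q * p' + (P * Q' - Q * P') = 0" "p * s' - s * p' + (P * S' - S * P') = 0"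
    if "bracket (cmb p q s t) (cmb p' q' s' t') + bracket (cmb P Q S T) (cmb P' Q' S' T') \<in> H"
    for p q s t p' q' s' t' P Q S T P' Q' S' T'
  proof -
    have "(p * q' - q * p' + (P * Q' - Q * P')) *\<^sub>R v1 + (p * s' - s * p' + (P * S' - S * P')) *\<^sub>R v2 =
      (bracket (cmb p q s t) (cmb p' q' s' t') + bracket (cmb P Q S T) (cmb P' Q' S' T'))
      - (bracket (cmb p q s t) (cmb p' q' s' t') - (p * q' - q * p') *\<^sub>R v1 - (p * s' - s * p') *\<^sub>R v2)
      - (bracket (cmb P Q S T) (cmb P' Q' S' T') - (P * Q' - Q * P') *\<^sub>R v1 - (P * S' - S * P') *\<^sub>R v2)"
      by (simp add: scaleR_add_left)
    also have "\<dots> \<in> H" by (rule subH(2)[OF subH(2)[OF that om] om])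
    finally show "p * q' - q * p' + (P * Q' - Q * P') = 0" "p * s' - s * p' + (P * S' - S * P') = 0"
      using indep by blast+
  qed
  have base: "a = cmb 1 0 0 0" "b = cmb 0 1 0 0" "c = cmb 0 0 1 0" "z = cmb 0 0 0 1" "0 = cmb 0 0 0 0"
    by (simp_all add: cmb_def)
  have zsp: "t *\<^sub>R z \<in> span {z}" for t by (simp add: span_base span_scale)
  have Zinv: "bracket u t \<in> span {z}" if "bracket u z \<in> span {z}" "t \<in> span {z}" for u t
    by (rule bracket_in_span[OF _ _ that(2)]) (use that(1) in auto)
  \<comment> \<open>Invariance of \<omega> makes \<open>v\<close> act on \<open>b\<close> and
    \<open>c\<close> by one and the same scalar modulo \<open>z\<close>, and nilpotency makes that
    scalar zero.\<close>
  have D: "\<exists>q s t t2 t3. bracket v a = q *\<^sub>R b + s *\<^sub>R c + t *\<^sub>R z \<and> bracket v b = t2 *\<^sub>R z \<and>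
      bracket v c = t3 *\<^sub>R z \<and> bracket v z = 0" if v: "v \<in> {v1, v2}" for v
  proof -
    have inv: "bracket (bracket v h) h' + bracket h (bracket v h') \<in> H" for h h'
      using vg[OF v] leibniz[of v h h'] by metis
    obtain p1 q1 s1 t1 where 1: "bracket v a = cmb p1 q1 s1 t1" using Hcmb vg[OF v] by blast
    obtain p2 q2 s2 t2 where 2: "bracket v b = cmb p2 q2 s2 t2" using Hcmb vg[OF v] by blast
    obtain p3 q3 s3 t3 where 3: "bracket v c = cmb p3 q3 s3 t3" using Hcmb vg[OF v] by blast
    obtain p4 q4 s4 t4 where 4: "bracket v z = cmb p4 q4 s4 t4" using Hcmb vg[OF v] by blast
    have z4: "bracket (bracket v z) h \<in> H" if "h \<in> H" for h
    proof -
      have "bracket (bracket v z) h = (bracket (bracket v z) h + bracket z (bracket v h)) - bracket z (bracket v h)" by simp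
      then show ?thesis using inv[of z h] zH[OF VH[OF v that]] subH(2) by metis
    qed
    have "p4 = 0"
      using W[of p4 q4 s4 t4 0 1 0 0 0 0 0 0 0 0 0 0] z4[OF inH(2)] unfolding 4 base[symmetric] by simp
    moreover have "q4 = 0" "s4 = 0"
      using W[of p4 q4 s4 t4 1 0 0 0 0 0 0 0 0 0 0 0] z4[OF inH(1)] unfolding 4 base[symmetric] by simp_all
    ultimately have vz: "bracket v z = t4 *\<^sub>R z" using 4 by (simp add: cmb_def)
    have "t4 = 0" by (rule eigenvalue_zero[of "{0}" v z]) (use vz z0 in auto)
    then have vz: "bracket v z = 0" using vz by simp
    have a23: "p2 = 0" "p3 = 0"
      using W[of p2 q2 s2 t2 0 0 1 0 0 1 0 0 p3 q3 s3 t3] inv[of b c] unfolding 2 3 base[symmetric] by simp_all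
    have a12: "p1 + q2 = 0" "s2 = 0"
      using W[of p1 q1 s1 t1 0 1 0 0 1 0 0 0 p2 q2 s2 t2] inv[of a b] unfolding 1 2 base[symmetric] by simp_all
    have a13: "q3 = 0" "p1 + s3 = 0"
      using W[of p1 q1 s1 t1 0 0 1 0 1 0 0 0 p3 q3 s3 t3] inv[of a c] unfolding 1 3 base[symmetric] by simp_all
    have "q2 = 0"
    proof (rule eigenvalue_zero[OF _ _ _ ni4])
      show "bracket v b - q2 *\<^sub>R b \<in> span {z}" using zsp by (simp add: 2 cmb_def a23 a12)
      show "bracket v t \<in> span {z}" if "t \<in> span {z}" for t using Zinv[OF _ that] vz by (simp add: span_zero)
    qed simp
    then have "p1 = 0" "q2 = 0" "s3 = 0" using a12 a13 by auto
    then show ?thesis using 1 2 3 vz a23 a12 a13 by (auto simp: cmb_def)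
  qed
  obtain q s t t2 t3 where d1: "bracket v1 a = q *\<^sub>R b + s *\<^sub>R c + t *\<^sub>R z" "bracket v1 b = t2 *\<^sub>R z"
      "bracket v1 c = t3 *\<^sub>R z" "bracket v1 z = 0" using D[of v1] by blast
  obtain q' s' t' t2' t3' where d2: "bracket v2 a = q' *\<^sub>R b + s' *\<^sub>R c + t' *\<^sub>R z" "bracket v2 b = t2' *\<^sub>R z"
      "bracket v2 c = t3' *\<^sub>R z" "bracket v2 z = 0" using D[of v2] by blast
  have zexp: "bracket z h = bracket v1 (bracket v2 h) - bracket v2 (bracket v1 h)" for h
    using leibniz[of v1 v2 h] vv by simp
  \<comment> \<open>By \<open>D\<close>, bracketing \<open>a\<close> with \<open>v1\<close> and
    \<open>v2\<close> in either order ends in the line of \<open>z\<close>, so \<open>z\<close> is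
    an eigenvector of \<open>ad a\<close>.\<close>
  have za: "bracket z a = 0"
  proof -
    define x where "x = q' * t2 + s' * t3 - q * t2' - s * t3'"
    have x: "bracket z a = x *\<^sub>R z" unfolding zexp d1 d2 by (simp add: d1 d2 x_def algebra_simps)
    have "- x = 0" by (rule eigenvalue_zero[of "{0}" a z]) (use x z0 antisym[of a z] in auto)
    then show ?thesis using x by simp
  qed
  have zc: "bracket u z = 0" for u
  proof -
    have "bracket z u \<in> {0}"
    proof (rule bracket_in_span)
      show "u \<in> span {a, b, c, v1, v2, z}" using span by simp
      fix x assume "x \<in> {a, b, c, v1, v2, z}"
      then show "bracket z x \<in> {0}"
        using za zexp[of b] zexp[of c] d1 d2 antisym[of z v1] antisym[of z v2] by auto
    qed simp
    then show ?thesis using antisym[of u z] by simp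
  qed
  have zc': "bracket z u = 0" for u using zc antisym[of z u] by simp
  have Zinv: "bracket u t \<in> span {z}" if "t \<in> span {z}" for u t
    using Zinv[OF _ that] zc by (simp add: span_zero)
  obtain al be ga de where bc: "bracket b c = cmb al be ga de" using Hcmb bcH by blast
  obtain p1 p2 p3 p4 where "bracket a b - v1 = cmb p1 p2 p3 p4" using Hcmb abH by blast
  then have ab: "bracket a b = v1 + cmb p1 p2 p3 p4" by (simp add: algebra_simps)
  obtain q1 q2 q3 q4 where "bracket a c - v2 = cmb q1 q2 q3 q4" using Hcmb acH by blast
  then have ac: "bracket a c = v2 + cmb q1 q2 q3 q4" by (simp add: algebra_simps)
  \<comment> \<open>If \<open>[b, c]\<close> had an \<open>a\<close>-part,
    \<open>a' = [b, c]\<close> could replace \<open>a\<close>. It is annihilated by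
    \<open>v1\<close> and \<open>v2\<close>, and \<open>J\<close> is an ideal. Nilpotency puts
    \<open>[a', b]\<close> into \<open>J\<close>, with \<open>V\<close>-part \<open>al * v1\<close>;
    its bracket with \<open>v2\<close> is then \<open>- al * z\<close>, whereas the Leibniz rule
    gives 0.\<close>
  have al: "al = 0"
  proof (rule ccontr)
    assume al: "al \<noteq> 0"
    define a' where "a' = bracket b c"
    have va': "bracket v a' = 0" if v: "v \<in> {v1, v2}" for v
    proof -
      obtain x y where "bracket v b = x *\<^sub>R z" "bracket v c = y *\<^sub>R z" using D[OF v] by blast
      then show ?thesis unfolding a'_def leibniz[of v b c] by (simp add: zc zc')
    qed
    have va: "bracket v a \<in> span {z}" if v: "v \<in> {v1, v2}" for v
    proof -
      obtain x y where xy: "bracket v b = x *\<^sub>R z" "bracket v c = y *\<^sub>R z" using D[OF v] by blast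
      have "al *\<^sub>R bracket v a = bracket v a' - (be * x + ga * y) *\<^sub>R z"
        unfolding a'_def bc cmb_def by (simp add: xy zc algebra_simps)
      also have "\<dots> = (- (be * x + ga * y)) *\<^sub>R z" using va'[OF v] by (simp add: algebra_simps)
      finally have "al *\<^sub>R bracket v a \<in> span {z}" using zsp by metis
      from span_scale[OF this, of "1/al"] show ?thesis using al by simp
    qed
    let ?J = "span {v1, v2, z}"
    have zJ: "span {z} \<subseteq> ?J" by (intro span_mono) blast
    have Jid: "bracket u j \<in> ?J" if "j \<in> ?J" for u j
    proof (rule bracket_in_span[OF _ _ that])
      fix k assume k: "k \<in> {v1, v2, z}"
      have "bracket k u \<in> span {z}"
      proof (rule bracket_in_span)
        show "u \<in> span {a, b, c, v1, v2, z}" using span by simp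
        fix x assume "x \<in> {a, b, c, v1, v2, z}"
        then show "bracket k x \<in> span {z}"
          using k va zc zc' d1 d2 zsp zsp[of 1] zsp[of "-1"] vv antisym[of v2 v1] by (auto simp: span_zero)
      qed simp
      then show "bracket u k \<in> ?J" using zJ antisym[of u k] span_neg by (metis subsetD)
    qed simp
    have span': "span {a', b, c, v1, v2, z} = UNIV"
    proof -
      have "a' - al *\<^sub>R a \<in> span {b, c, v1, v2, z}"
        unfolding a'_def bc cmb_def by (simp, intro span_add span_scale) (auto intro: span_base)
      from span_exchange[OF al this] span show ?thesis by simp
    qed
    have ni': "b \<notin> span (insert a' {v1, v2, z})"
      by (rule not_in_span_of_basis[OF dim span', of _ "{a', c, v1, v2, z}"]) (auto simp: card_insert_if)
    have ni'': "a' \<notin> span (insert b {v1, v2, z})" "a' \<notin> ?J"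
      by (rule not_in_span_of_basis[OF dim span', of _ "{b, c, v1, v2, z}"]; auto simp: card_insert_if)+
    \<comment> \<open>The quotient by \<open>J\<close> is spanned by \<open>a'\<close>,
      \<open>b\<close>, \<open>c\<close> with \<open>[b, c] = a'\<close>. The three coefficients
      vanish in turn: \<open>tau\<close> as a determinant of \<open>ad b\<close>, \<open>sig\<close>
      as an eigenvalue of \<open>ad a'\<close>, \<open>rho\<close> as an eigenvalue of
      \<open>ad b\<close>.\<close>
    obtain rho sig tau where r: "bracket a' b - rho *\<^sub>R a' - sig *\<^sub>R b - tau *\<^sub>R c \<in> ?J"
    proof -
      have "bracket a' b \<in> span {a', b, c, v1, v2, z}" using span' by simp
      then show ?thesis using that unfolding span_breakdown_eq[of _ a'] span_breakdown_eq[of _ b] span_breakdown_eq[of _ c] by blast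
    qed
    define j where "j = bracket a' b - rho *\<^sub>R a' - sig *\<^sub>R b - tau *\<^sub>R c"
    have j: "j \<in> ?J" using r by (simp add: j_def)
    have ba: "bracket b a' = - (rho *\<^sub>R a' + sig *\<^sub>R b + tau *\<^sub>R c + j)"
      using antisym[of b a'] by (simp add: j_def)
    have up: "?J \<subseteq> span (insert b {v1, v2, z})" "?J \<subseteq> span (insert a' {v1, v2, z})" by (intro span_mono; blast)+
    have "- rho * 0 - (- tau) * 1 = 0"
    proof (rule det_zero[of "span (insert b {v1, v2, z})" b a' "- rho" "- tau" c 1 0])
      show "bracket b k \<in> span (insert b {v1, v2, z})" if "k \<in> span (insert b {v1, v2, z})" for k
      proof (rule bracket_in_span[OF _ _ that])
        fix k assume "k \<in> insert b {v1, v2, z}"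
        then consider "k = b" | "k \<in> ?J" by (auto intro: span_base)
        then show "bracket b k \<in> span (insert b {v1, v2, z})"
          by cases (use Jid up in \<open>auto simp: span_zero\<close>)
      qed simp
      have "- (sig *\<^sub>R b + j) \<in> span (insert b {v1, v2, z})"
        by (intro span_neg span_add span_scale subsetD[OF up(1) j]) (simp add: span_base)
      then show "bracket b a' - (- rho) *\<^sub>R a' - (- tau) *\<^sub>R c \<in> span (insert b {v1, v2, z})"
        by (simp add: ba algebra_simps)
      show "bracket b c - 1 *\<^sub>R a' - 0 *\<^sub>R c \<in> span (insert b {v1, v2, z})" by (simp add: a'_def span_zero)
    qed (use ni'' in auto)
    then have tau: "tau = 0" by simp
    have sig: "sig = 0"
    proof (rule eigenvalue_zero[OF _ _ _ ni'])
      show "bracket a' k \<in> span (insert a' {v1, v2, z})" if "k \<in> span (insert a' {v1, v2, z})" for k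
      proof (rule bracket_in_span[OF _ _ that])
        fix k assume "k \<in> insert a' {v1, v2, z}"
        then consider "k = a'" | "k \<in> ?J" by (auto intro: span_base)
        then show "bracket a' k \<in> span (insert a' {v1, v2, z})"
          by cases (use Jid up in \<open>auto simp: span_zero\<close>)
      qed simp
      have "rho *\<^sub>R a' + j \<in> span (insert a' {v1, v2, z})"
        by (intro span_add span_scale subsetD[OF up(2) j]) (simp add: span_base)
      then show "bracket a' b - sig *\<^sub>R b \<in> span (insert a' {v1, v2, z})"
        using tau by (simp add: j_def algebra_simps)
    qed simp
    have "- rho = 0"
      by (rule eigenvalue_zero[OF _ Jid _ ni''(2), of b]) (use span_neg[OF j] in \<open>simp_all add: ba tau sig\<close>)
    then have "bracket a' b = j" using tau sig by (simp add: j_def)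
    moreover obtain x y x' where "j = x *\<^sub>R v1 + y *\<^sub>R v2 + x' *\<^sub>R z"
    proof -
      obtain x y x' where "j - x *\<^sub>R v1 - y *\<^sub>R v2 - x' *\<^sub>R z = 0"
        using j unfolding span_breakdown_eq by auto
      then have "j = x *\<^sub>R v1 + y *\<^sub>R v2 + x' *\<^sub>R z" by (simp add: algebra_simps)
      then show ?thesis by (rule that)
    qed
    ultimately have a'b: "bracket a' b = x *\<^sub>R v1 + y *\<^sub>R v2 + x' *\<^sub>R z" by simp
    have "bracket a' b - al *\<^sub>R v1 \<in> H"
      using om[of al be ga de 0 1 0 0] unfolding bc[symmetric] base[symmetric] a'_def[symmetric] by simp
    from subH(2)[OF this subH(3)[OF inH(4), of x']]
    have "(bracket a' b - al *\<^sub>R v1) - x' *\<^sub>R z \<in> H" .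
    then have "(x - al) *\<^sub>R v1 + y *\<^sub>R v2 \<in> H" by (simp add: a'b algebra_simps)
    then have "x - al = 0" "y = 0" using indep by blast+
    then have "bracket v2 (bracket a' b) = - (al *\<^sub>R z)"
      using antisym[of v2 v1] by (simp add: a'b zc vv)
    moreover have "bracket v2 (bracket a' b) = 0"
      using leibniz[of v2 a' b] va'[of v2] d2 zc by simp
    ultimately show False using al z0 by simp
  qed
  have ga: "ga = 0"
  proof (rule eigenvalue_zero[OF _ _ _ ni6])
    have bz: "x *\<^sub>R b + y *\<^sub>R z \<in> span {b, z}" for x y by (intro span_add span_scale; simp add: span_base)
    show "bracket b c - ga *\<^sub>R c \<in> span {b, z}" using bz by (simp add: bc cmb_def al)
    show "bracket b t \<in> span {b, z}" if "t \<in> span {b, z}" for t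
      by (rule bracket_in_span[OF _ _ that]) (use zc in \<open>auto simp: span_zero\<close>)
  qed simp
  have "- be = 0"
  proof (rule eigenvalue_zero[OF _ _ _ ni4])
    show "bracket c b - (- be) *\<^sub>R b \<in> span {z}"
      using zsp[of "- de"] antisym[of c b] by (simp add: bc cmb_def al ga)
    show "bracket c t \<in> span {z}" if "t \<in> span {z}" for t by (rule Zinv[OF that])
  qed simp
  then have bc: "bracket b c = de *\<^sub>R z" using bc al ga by (simp add: cmb_def)
  let ?N = "span {b, c, v1, v2, z}"
  have N: "b \<in> ?N" "c \<in> ?N" "v1 \<in> ?N" "v2 \<in> ?N" "z \<in> ?N" by (auto intro: span_base)
  have bv: "bracket b v1 = (- t2) *\<^sub>R z" "bracket b v2 = (- t2') *\<^sub>R z" "bracket c v1 = (- t3) *\<^sub>R z"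
    "bracket c v2 = (- t3') *\<^sub>R z" "bracket c b = (- de) *\<^sub>R z"
    using antisym[of b v1] antisym[of b v2] antisym[of c v1] antisym[of c v2] antisym[of c b] d1 d2 bc by simp_all
  have p1: "- p1 = 0"
  proof (rule eigenvalue_zero[OF _ _ _ ni5])
    have "- (v1 + p2 *\<^sub>R b + p3 *\<^sub>R c + p4 *\<^sub>R z) \<in> ?N" by (intro span_neg span_add span_scale N)
    then show "bracket b a - (- p1) *\<^sub>R a \<in> ?N"
      by (subst antisym) (simp add: ab cmb_def algebra_simps)
    show "bracket b x \<in> ?N" if "x \<in> ?N" for x
      by (rule bracket_in_span[OF _ _ that]) (use bv bc zc span_scale[OF N(5)] span_neg[OF span_scale[OF N(5)]] in \<open>auto simp: span_zero\<close>)
  qed simp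
  have q1: "- q1 = 0"
  proof (rule eigenvalue_zero[OF _ _ _ ni5])
    have "- (v2 + q2 *\<^sub>R b + q3 *\<^sub>R c + q4 *\<^sub>R z) \<in> ?N" by (intro span_neg span_add span_scale N)
    then show "bracket c a - (- q1) *\<^sub>R a \<in> ?N"
      by (subst antisym) (simp add: ac cmb_def algebra_simps)
    show "bracket c x \<in> ?N" if "x \<in> ?N" for x
      by (rule bracket_in_span[OF _ _ that]) (use bv bc zc span_scale[OF N(5)] span_neg[OF span_scale[OF N(5)]] in \<open>auto simp: span_zero\<close>)
  qed simp
  have ab: "bracket a b = v1 + p2 *\<^sub>R b + p3 *\<^sub>R c + p4 *\<^sub>R z"
    and ac: "bracket a c = v2 + q2 *\<^sub>R b + q3 *\<^sub>R c + q4 *\<^sub>R z"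
    using ab ac p1 q1 by (simp_all add: cmb_def)
  have av: "bracket a v1 = (- q) *\<^sub>R b + (- s) *\<^sub>R c + (- t) *\<^sub>R z" "bracket a v2 = (- q') *\<^sub>R b + (- s') *\<^sub>R c + (- t') *\<^sub>R z"
    using antisym[of a v1] antisym[of a v2] d1 d2 by simp_all
  \<comment> \<open>This is the determinant of \<open>ad a\<close> from \<open>v1\<close>,
    \<open>v2\<close> to \<open>b\<close>, \<open>c\<close> modulo \<open>z\<close>. As
    \<open>ad a\<close> also leads from \<open>b\<close>, \<open>c\<close> back to
    \<open>v1\<close>, \<open>v2\<close>, a nonzero value would make it invertible on their span
    modulo \<open>z\<close>.\<close>
  have det: "q * s' - s * q' = 0"
  proof (rule ccontr)
    assume D: "q * s' - s * q' \<noteq> 0"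
    let ?S = "span ({bracket k n | k n. k \<in> {a} \<and> n \<in> {b, c, v1, v2}} \<union> span {z})"
    have S: "bracket a b \<in> ?S" "bracket a c \<in> ?S" "bracket a v1 \<in> ?S" "bracket a v2 \<in> ?S" "z \<in> ?S"
      by (rule span_base, blast)+ (simp add: span_base)
    have "(1/(q * s' - s * q')) *\<^sub>R (s *\<^sub>R (bracket a v2 + t' *\<^sub>R z) - s' *\<^sub>R (bracket a v1 + t *\<^sub>R z)) \<in> ?S"
      "(1/(q * s' - s * q')) *\<^sub>R (q' *\<^sub>R (bracket a v1 + t *\<^sub>R z) - q *\<^sub>R (bracket a v2 + t' *\<^sub>R z)) \<in> ?S"
      by (intro span_scale span_diff span_add S)+
    moreover have "s *\<^sub>R (bracket a v2 + t' *\<^sub>R z) - s' *\<^sub>R (bracket a v1 + t *\<^sub>R z) = (q * s' - s * q') *\<^sub>R b"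
      "q' *\<^sub>R (bracket a v1 + t *\<^sub>R z) - q *\<^sub>R (bracket a v2 + t' *\<^sub>R z) = (q * s' - s * q') *\<^sub>R c"
      by (simp_all add: av algebra_simps)
    ultimately have bc': "b \<in> ?S" "c \<in> ?S" using D by simp_all
    have "bracket a b - p2 *\<^sub>R b - p3 *\<^sub>R c - p4 *\<^sub>R z \<in> ?S" "bracket a c - q2 *\<^sub>R b - q3 *\<^sub>R c - q4 *\<^sub>R z \<in> ?S"
      by (intro span_scale span_diff S bc')+
    then have "{b, c, v1, v2} \<subseteq> ?S" using bc' by (simp add: ab ac)
    from nilpotent_absorb[OF subspace_span _ this] Zinv have "{b, c, v1, v2} \<subseteq> span {z}" by blast
    then show False using ni4 by simp
  qed
  show ?thesis
  proof (cases "q' = 0 \<and> s' = 0")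
    case True
    then have "bracket a v2 = (- t') *\<^sub>R z" using av by simp
    from listed_of_kernel[OF dim span zc vv ab ac av(1) this bc bv(1-4)] show ?thesis .
  next
    case False
    obtain x where x: "q = x * q'" "s = x * s'"
    proof (cases "q' = 0")
      case True then show ?thesis using that[of "s / s'"] False det by auto
    next
      case q': False
      then have "s = (q / q') * s'" using det by (simp add: field_simps)
      then show ?thesis using that[of "q / q'"] q' by simp
    qed
    \<comment> \<open>The singular matrix has a kernel: \<open>w2\<close> commutes with
      \<open>a\<close> modulo \<open>z\<close> and takes the role of \<open>v2\<close>. The signs of
      \<open>- c\<close> and \<open>- v2\<close> preserve the relation that the two vectors of
      \<open>V\<close> bracket to \<open>z\<close>.\<close>
    define c' where "c' = b - x *\<^sub>R c"
    define w2 where "w2 = v1 - x *\<^sub>R v2"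
    show ?thesis
    proof (rule listed_of_kernel[OF dim, of a "- c" c' "- v2" w2 z])
      show "span {a, - c, c', - v2, w2, z} = UNIV"
      proof (rule span_UNIV_if[OF span])
        let ?B = "span {a, - c, c', - v2, w2, z}"
        have B: "a \<in> ?B" "- c \<in> ?B" "c' \<in> ?B" "- v2 \<in> ?B" "w2 \<in> ?B" "z \<in> ?B" by (auto intro: span_base)
        have "c' - x *\<^sub>R (- c) \<in> ?B" "w2 - x *\<^sub>R (- v2) \<in> ?B" "- (- c) \<in> ?B" "- (- v2) \<in> ?B"
          by (intro span_diff span_scale span_neg B)+
        then show "{a, b, c, v1, v2, z} \<subseteq> ?B" using B by (simp add: c'_def w2_def)
      qed
      show "bracket u z = 0" for u by (rule zc)
      show "bracket (- v2) w2 = z" using antisym[of v2 v1] vv by (simp add: w2_def)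
      show "bracket a (- c) = - v2 + (q3 + x * q2) *\<^sub>R (- c) + (- q2) *\<^sub>R c' + (- q4) *\<^sub>R z"
        by (simp add: ac c'_def algebra_simps)
      show "bracket a c' = w2 + (- (p3 + x * p2) + x * (q3 + x * q2)) *\<^sub>R (- c) + (p2 - x * q2) *\<^sub>R c' + (p4 - x * q4) *\<^sub>R z"
        by (simp add: ac ab c'_def w2_def algebra_simps)
      show "bracket a (- v2) = (- (s' + x * q')) *\<^sub>R (- c) + q' *\<^sub>R c' + t' *\<^sub>R z"
        by (simp add: av c'_def algebra_simps)
      show "bracket a w2 = (x * t' - t) *\<^sub>R z"
        by (simp add: av w2_def x algebra_simps)
      show "bracket (- c) c' = de *\<^sub>R z" by (simp add: c'_def bv)
      show "bracket (- c) (- v2) = (- t3') *\<^sub>R z" by (simp add: bv)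
      show "bracket (- c) w2 = (t3 - x * t3') *\<^sub>R z" by (simp add: bv w2_def algebra_simps)
      show "bracket c' (- v2) = (t2' - x * t3') *\<^sub>R z" by (simp add: bv c'_def algebra_simps)
      show "bracket c' w2 = (- t2 + x * t2' + x * t3 - x * x * t3') *\<^sub>R z" by (simp add: bv c'_def w2_def algebra_simps)
    qed
  qed
qed

end

section \<open>From a decomposition to the list\<close>

lemma (in nilpotent_lie) listed_of_decomposition:
  assumes dim: "dim (UNIV :: 'a set) = 6" and sH: "subspace H" and sV: "subspace V"
    and HV: "H \<inter> V = {0}" and sum: "\<And>u. \<exists>h\<in>H. \<exists>v\<in>V. u = h + v"
    and VH: "\<And>v h. v \<in> V \<Longrightarrow> h \<in> H \<Longrightarrow> bracket v h \<in> H"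
    and Hn: "\<exists>h\<in>H. \<exists>h'\<in>H. bracket h h' \<notin> H" and Vn: "\<exists>v\<in>V. \<exists>v'\<in>V. bracket v v' \<notin> V"
    and V: "V = span {u1, u2}" and dH: "dim H = 4"
  shows "listed bracket"
proof -
  note subH = subspace_add[OF sH] subspace_diff[OF sH] subspace_scale[OF sH] subspace_neg[OF sH] subspace_0[OF sH]
  note subV = subspace_add[OF sV] subspace_diff[OF sV] subspace_scale[OF sV] subspace_neg[OF sV] subspace_0[OF sV]
  have uV: "u1 \<in> V" "u2 \<in> V" by (auto simp: V intro: span_base)
  have Vex: "\<exists>p q. u = p *\<^sub>R u1 + q *\<^sub>R u2" if "u \<in> V" for u
    using that unfolding V in_span_pair .
  define z where "z = bracket u1 u2"
  have br: "bracket (p *\<^sub>R u1 + q *\<^sub>R u2) (p' *\<^sub>R u1 + q' *\<^sub>R u2) = (p * q' - q * p') *\<^sub>R z" for p q p' q'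
    using antisym[of u2 u1] by (simp add: z_def algebra_simps)
  have z0: "z \<noteq> 0"
  proof
    assume "z = 0"
    obtain v v' where "v \<in> V" "v' \<in> V" "bracket v v' \<notin> V" using Vn by blast
    moreover obtain p q p' q' where "v = p *\<^sub>R u1 + q *\<^sub>R u2" "v' = p' *\<^sub>R u1 + q' *\<^sub>R u2"
      using Vex calculation by metis
    ultimately show False using br \<open>z = 0\<close> subV(5) by simp
  qed
  have ni: "u2 \<notin> span (insert u1 H)" "u1 \<notin> span (insert u2 H)"
  proof -
    have *: "z = 0" if "u - c *\<^sub>R u' \<in> H" "u \<in> V" "u' \<in> V" "bracket u u' = z \<or> bracket u u' = - z" for u u' c
    proof -
      have "u - c *\<^sub>R u' \<in> H \<inter> V" using that subV by blast
      then have "u = c *\<^sub>R u'" using HV by simp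
      then show ?thesis using that(4) by auto
    qed
    show "u2 \<notin> span (insert u1 H)" "u1 \<notin> span (insert u2 H)"
      unfolding in_span_insert[OF sH] using * uV z0 antisym[of u2 u1] z_def by metis+
  qed
  have zH: "z \<in> H"
  proof -
    obtain h p q where hpq: "h \<in> H" "z = h + (p *\<^sub>R u1 + q *\<^sub>R u2)" using sum[of z] Vex by blast
    have inv: "bracket u t \<in> span (insert u H)" if "u \<in> V" "t \<in> span (insert u H)" for u t
    proof (rule bracket_in_span[OF _ _ that(2)])
      fix s assume "s \<in> insert u H"
      then show "bracket u s \<in> span (insert u H)"
        using VH[OF that(1)] by (auto simp: span_zero intro: span_base)
    qed simp
    have "q = 0"
    proof (rule eigenvalue_zero[OF _ inv[OF uV(1)] _ ni(1)])
      have "h + p *\<^sub>R u1 \<in> span (insert u1 H)"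
        by (intro span_add span_scale) (simp_all add: span_base hpq)
      then show "bracket u1 u2 - q *\<^sub>R u2 \<in> span (insert u1 H)"
        using hpq(2) by (simp add: z_def algebra_simps)
    qed simp_all
    moreover have "- p = 0"
    proof (rule eigenvalue_zero[OF _ inv[OF uV(2)] _ ni(2)])
      have "- (h + q *\<^sub>R u2) \<in> span (insert u2 H)"
        by (intro span_neg span_add span_scale) (simp_all add: span_base hpq)
      moreover have "bracket u2 u1 - (- p) *\<^sub>R u1 = - (h + q *\<^sub>R u2)"
        using hpq(2) antisym[of u2 u1] by (simp add: z_def)
      ultimately show "bracket u2 u1 - (- p) *\<^sub>R u1 \<in> span (insert u2 H)" by simp
    qed simp_all
    ultimately show ?thesis using hpq by simp
  qed
  have pq: "span {p, q} = V \<and> (\<exists>d. d \<noteq> 0 \<and> bracket p q = d *\<^sub>R z) \<or> (\<exists>d. q = d *\<^sub>R p)"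
    if pV: "p \<in> V" "q \<in> V" and p0: "p \<noteq> 0" for p q
  proof -
    obtain a b where p: "p = a *\<^sub>R u1 + b *\<^sub>R u2" using Vex pV by blast
    obtain c d where q: "q = c *\<^sub>R u1 + d *\<^sub>R u2" using Vex pV by blast
    have ab: "a \<noteq> 0 \<or> b \<noteq> 0" using p p0 by auto
    show ?thesis
    proof (cases "a * d - b * c = 0")
      case True
      have "q = (c / a) *\<^sub>R p" if "a \<noteq> 0"
      proof -
        have "c / a * b = d" using that True by (simp add: field_simps)
        then show ?thesis using that by (simp add: p q scaleR_add_right)
      qed
      moreover have "q = (d / b) *\<^sub>R p" if "b \<noteq> 0"
      proof -
        have "d / b * a = c" using that True by (simp add: field_simps)
        then show ?thesis using that by (simp add: p q scaleR_add_right)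
      qed
      ultimately show ?thesis using ab by blast
    next
      case False
      let ?D = "a * d - b * c"
      have "d *\<^sub>R p - b *\<^sub>R q = ?D *\<^sub>R u1" "a *\<^sub>R q - c *\<^sub>R p = ?D *\<^sub>R u2"
        by (simp_all add: p q algebra_simps)
      moreover have "(1/?D) *\<^sub>R (d *\<^sub>R p - b *\<^sub>R q) \<in> span {p, q}" "(1/?D) *\<^sub>R (a *\<^sub>R q - c *\<^sub>R p) \<in> span {p, q}"
        by (intro span_scale span_diff; simp add: span_base)+
      ultimately have "u1 \<in> span {p, q}" "u2 \<in> span {p, q}" using False by simp_all
      then have "V \<subseteq> span {p, q}" unfolding V by (intro span_minimal) auto
      moreover have "span {p, q} \<subseteq> V" using pV by (intro span_minimal) (auto simp: sV)
      ultimately show ?thesis using br[of a b c d] False p q by blast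
    qed
  qed
  obtain B where B: "{z} \<subseteq> B" "B \<subseteq> H" "independent B" "H \<subseteq> span B"
    using maximal_independent_subset_extend[of "{z}" H] zH z0 by auto
  have cB: "card B = 4" using real_vector.dim_unique[OF B(2,4,3) refl] dH by simp
  then have "finite B" using card.infinite by fastforce
  then have "card (B - {z}) = 3" using B(1) cB by simp
  then obtain a b c where abc: "B - {z} = {a, b, c}" by (auto simp: card_3_iff)
  have HB: "H = span {a, b, c, z}"
  proof -
    have "B = {a, b, c, z}" using abc B(1) by blast
    then show ?thesis using B(2,4) sH by (metis span_minimal subset_antisym)
  qed
  have plane: "listed bracket" if H: "H = span {a, b, c, z}" and w: "w1 \<in> V" "w2 \<in> V"
    and ab: "bracket a b - w1 \<in> H" and ac: "bracket a c - w2 \<in> H" and w1: "w1 \<noteq> 0" and nd: "\<nexists>d. w2 = d *\<^sub>R w1"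
    for a b c w1 w2
  proof -
    obtain d where d: "span {w1, w2} = V" "d \<noteq> 0" "bracket w1 w2 = d *\<^sub>R z" using pq[OF w w1] nd by blast
    have in_H: "a \<in> H" "b \<in> H" "c \<in> H" unfolding H by (auto intro: span_base)
    obtain h s t where hst: "h \<in> H" "bracket b c = h + (s *\<^sub>R w1 + t *\<^sub>R w2)"
    proof -
      obtain h v where "h \<in> H" "v \<in> V" "bracket b c = h + v" using sum[of "bracket b c"] by blast
      moreover from this obtain s t where "v = s *\<^sub>R w1 + t *\<^sub>R w2" unfolding d(1)[symmetric] in_span_pair by blast
      ultimately show ?thesis using that by blast
    qed
    \<comment> \<open>\<omega>(b, c) = s w1 + t w2 is cancelled by adding multiples of
      \<open>a\<close>, because \<omega>(a, b) = w1 and \<omega>(a, c) = w2; these two values do not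
      change.\<close>
    define b' where "b' = b - t *\<^sub>R a"
    define c' where "c' = c + s *\<^sub>R a"
    have H': "H = span {a, b', c', bracket w1 w2}"
    proof
      have "bracket w1 w2 \<in> H" unfolding d(3) using zH subH by simp
      then show "span {a, b', c', bracket w1 w2} \<subseteq> H"
        using in_H subH by (intro span_minimal) (auto simp: sH b'_def c'_def)
      let ?B = "span {a, b', c', bracket w1 w2}"
      have B: "a \<in> ?B" "b' \<in> ?B" "c' \<in> ?B" "bracket w1 w2 \<in> ?B" by (auto intro: span_base)
      have "b' + t *\<^sub>R a \<in> ?B" "c' - s *\<^sub>R a \<in> ?B" "(1/d) *\<^sub>R bracket w1 w2 \<in> ?B"
        by (intro span_add span_diff span_scale B)+
      then show "H \<subseteq> ?B" unfolding H using B d by (intro span_minimal) (auto simp: b'_def c'_def)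
    qed
    show ?thesis
    proof (rule listed_of_plane[OF dim _ H'])
      have "u \<in> span {a, b', c', w1, w2, bracket w1 w2}" for u
      proof -
        obtain h v where hv: "h \<in> H" "v \<in> V" "u = h + v" using sum[of u] by blast
        have "H \<subseteq> span {a, b', c', w1, w2, bracket w1 w2}" "V \<subseteq> span {a, b', c', w1, w2, bracket w1 w2}"
          unfolding H' d(1)[symmetric] by (intro span_mono; blast)+
        then show ?thesis using hv span_add by (metis subsetD)
      qed
      then show "span {a, b', c', w1, w2, bracket w1 w2} = UNIV" by blast
      show "bracket v h \<in> H" if "v \<in> {w1, w2}" "h \<in> H" for v h using VH that w by blast
      show "bracket a b' - w1 \<in> H" "bracket a c' - w2 \<in> H" using ab ac by (simp_all add: b'_def c'_def)
      have "bracket b' c' = h - s *\<^sub>R (bracket a b - w1) - t *\<^sub>R (bracket a c - w2)"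
        using hst(2) antisym[of b a] by (simp add: b'_def c'_def algebra_simps)
      then show "bracket b' c' \<in> H" using hst(1) ab ac subH by simp
    qed simp
  qed
  have line: "listed bracket" if H: "H = span {a, b, c, z}" and w: "w \<in> V" "w \<noteq> 0"
    and ab: "bracket a b - w \<in> H" and ac: "bracket a c - p *\<^sub>R w \<in> H" and bc: "bracket b c - q *\<^sub>R w \<in> H"
    for a b c w p q
  proof -
    have "\<exists>v\<in>V. \<nexists>d. v = d *\<^sub>R w"
    proof (rule ccontr)
      assume "\<not> ?thesis"
      then obtain d1 d2 where "u1 = d1 *\<^sub>R w" "u2 = d2 *\<^sub>R w" using uV by blast
      then have "z = 0" by (simp add: z_def)
      then show False using z0 by simp
    qed
    then obtain v where v: "v \<in> V" "\<nexists>d. v = d *\<^sub>R w" by blast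
    obtain d where d: "span {w, v} = V" "d \<noteq> 0" "bracket w v = d *\<^sub>R z" using pq[OF w(1) v(1) w(2)] v(2) by blast
    have d': "bracket v w = (- d) *\<^sub>R z" using antisym[of v w] d by simp
    \<comment> \<open>\<open>r\<close> solves \<omega>(r, a) = \<omega>(r, b) = 0 and so spans the
      radical together with \<open>z\<close>.\<close>
    define r where "r = c - p *\<^sub>R b + q *\<^sub>R a"
    have in_H: "a \<in> H" "b \<in> H" "c \<in> H" unfolding H by (auto intro: span_base)
    have H': "H = span {a, b, r, bracket v w}"
    proof
      have "bracket v w \<in> H" unfolding d' by (rule subH(3)[OF zH])
      then show "span {a, b, r, bracket v w} \<subseteq> H"
        using in_H subH by (intro span_minimal) (auto simp: sH r_def)
      let ?B = "span {a, b, r, bracket v w}"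
      have B: "a \<in> ?B" "b \<in> ?B" "r \<in> ?B" "bracket v w \<in> ?B" by (auto intro: span_base)
      have "r + p *\<^sub>R b - q *\<^sub>R a \<in> ?B" "(1/(- d)) *\<^sub>R bracket v w \<in> ?B"
        by (intro span_add span_diff span_scale B)+
      then show "H \<subseteq> ?B" unfolding H using B d d' by (intro span_minimal) (auto simp: r_def)
    qed
    have rr: "bracket r a \<in> H" "bracket r b \<in> H"
    proof -
      have "bracket r a = p *\<^sub>R (bracket a b - w) - (bracket a c - p *\<^sub>R w)"
        "bracket r b = q *\<^sub>R (bracket a b - w) - (bracket b c - q *\<^sub>R w)"
        using antisym[of c a] antisym[of b a] antisym[of c b] by (simp_all add: r_def algebra_simps)
      then show "bracket r a \<in> H" "bracket r b \<in> H" using ab ac bc subH by simp_all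
    qed
    have zHH: "bracket (bracket v w) h \<in> H" if "h \<in> H" for h
    proof -
      have "bracket (bracket v w) h = bracket v (bracket w h) - bracket w (bracket v h)"
        using leibniz[of v w h] by simp
      then show ?thesis using VH v w that subH by simp
    qed
    have rz: "r \<in> H" using in_H subH by (simp add: r_def)
    have rvw: "bracket r (bracket v w) \<in> H"
      using antisym[of r "bracket v w"] zHH[OF rz] subH(4) by simp
    have rH: "bracket r h \<in> H" if "h \<in> H" for h
    proof (rule bracket_in_span[OF _ sH that[unfolded H']])
      fix s assume "s \<in> {a, b, r, bracket v w}"
      then show "bracket r s \<in> H" using rr rvw subH(5) by auto
    qed
    show ?thesis
    proof (rule listed_of_line[OF dim _ H'])
      have "u \<in> span {a, b, r, bracket v w, v, w}" for u
      proof -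
        obtain h v' where hv: "h \<in> H" "v' \<in> V" "u = h + v'" using sum[of u] by blast
        have "H \<subseteq> span {a, b, r, bracket v w, v, w}" "V \<subseteq> span {a, b, r, bracket v w, v, w}"
          unfolding H' d(1)[symmetric] by (intro span_mono; blast)+
        then show ?thesis using hv span_add by (metis subsetD)
      qed
      then show "span {a, b, r, bracket v w, v, w} = UNIV" by blast
      show "bracket v h \<in> H" "bracket w h \<in> H" "bracket r h \<in> H" if "h \<in> H" for h
        using VH v w rH that by blast+
      show "bracket a b \<notin> H"
      proof
        assume "bracket a b \<in> H"
        then have "w \<in> H" using subH(2)[OF _ ab, of "bracket a b"] by simp
        then show False using w HV by blast
      qed
      have HI: "H \<subseteq> span (insert w H)" by (meson span_superset subset_insertI subset_trans)
      have abw: "bracket a b \<in> span (insert w H)" unfolding in_span_insert[OF sH] using ab by (metis scaleR_one)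
      have baw: "bracket b a \<in> span (insert w H)" using span_neg[OF abw] antisym[of b a] by simp
      show "bracket h h' \<in> span (insert w H)" if h: "h \<in> H" and h': "h' \<in> H" for h h'
      proof (rule bracket_in_span[OF _ _ h'[unfolded H']])
        fix s assume s: "s \<in> {a, b, r, bracket v w}"
        have "bracket s h \<in> span (insert w H)"
        proof (rule bracket_in_span[OF _ _ h[unfolded H']])
          fix s' assume s': "s' \<in> {a, b, r, bracket v w}"
          consider "s \<in> {a, b}" "s' \<in> {a, b}" | "s \<in> {r, bracket v w}" | "s' \<in> {r, bracket v w}" using s s' by blast
          then show "bracket s s' \<in> span (insert w H)"
          proof cases
            case 1 then show ?thesis using abw baw by (auto simp: span_zero)
          next
            case 2
            have "s' \<in> H" unfolding H' by (rule span_base[OF s'])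
            then show ?thesis using 2 rH zHH HI by blast
          next
            case 3
            have "s \<in> H" unfolding H' by (rule span_base[OF s])
            then have "bracket s' s \<in> H" using 3 rH zHH by blast
            then show ?thesis using antisym[of s s'] HI subH(4) by auto
          qed
        qed simp
        then show "bracket h s \<in> span (insert w H)" using antisym[of h s] span_neg by metis
      qed simp
    qed simp
  qed
  have dec: "\<exists>w\<in>V. u - w \<in> H" for u using sum[of u] by (metis add_diff_cancel_right')
  obtain wab where wab: "wab \<in> V" "bracket a b - wab \<in> H" using dec by blast
  obtain wac where wac: "wac \<in> V" "bracket a c - wac \<in> H" using dec by blast
  obtain wbc where wbc: "wbc \<in> V" "bracket b c - wbc \<in> H" using dec by blast
  have flip: "bracket y x - (- u) \<in> H" if "bracket x y - u \<in> H" for x y u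
    using subH(4)[OF that] antisym[of y x] by simp
  have perm: "H = span {b, a, c, z}" "H = span {c, a, b, z}" "H = span {a, c, b, z}" "H = span {b, c, a, z}"
    unfolding HB by (simp_all add: insert_commute)
  have negV: "- u \<in> V" if "u \<in> V" for u using that subV(4) by blast
  \<comment> \<open>\<omega> is given by its three values on pairs from \<open>a\<close>,
    \<open>b\<close>, \<open>c\<close>, one of which is nonzero and may be called \<omega>(a, b)
    after renaming. If only \<omega>(b, c) is independent of it, \<open>b\<close> takes the role of
    the common vector.\<close>
  have main: "listed bracket"
    if perms: "H = span {a, b, c, z}" "H = span {b, a, c, z}"
      and wab: "wab \<in> V" "bracket a b - wab \<in> H" and wac: "wac \<in> V" "bracket a c - wac \<in> H"
      and wbc: "wbc \<in> V" "bracket b c - wbc \<in> H" and nz: "wab \<noteq> 0" for a b c wab wac wbc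
  proof (cases "\<exists>p. wac = p *\<^sub>R wab")
    case False
    from plane[OF perms(1) wab(1) wac(1) wab(2) wac(2) nz False] show ?thesis .
  next
    case True
    then obtain p where p: "wac = p *\<^sub>R wab" by blast
    show ?thesis
    proof (cases "\<exists>q. wbc = q *\<^sub>R wab")
      case True
      then obtain q where q: "wbc = q *\<^sub>R wab" by blast
      from line[OF perms(1) wab(1) nz wab(2) wac(2)[unfolded p] wbc(2)[unfolded q]] show ?thesis .
    next
      case False
      have "\<nexists>q. wbc = q *\<^sub>R (- wab)"
      proof
        assume "\<exists>q. wbc = q *\<^sub>R (- wab)"
        then obtain q where "wbc = q *\<^sub>R (- wab)" by blast
        then have "wbc = (- q) *\<^sub>R wab" by simp
        then show False using False by blast
      qed
      from plane[OF perms(2) negV[OF wab(1)] wbc(1) flip[OF wab(2)] wbc(2) _ this] show ?thesis using nz by simp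
    qed
  qed
  have "wab \<noteq> 0 \<or> wac \<noteq> 0 \<or> wbc \<noteq> 0"
  proof (rule ccontr)
    assume "\<not> ?thesis"
    then have abc: "bracket a b \<in> H" "bracket a c \<in> H" "bracket b c \<in> H" using wab wac wbc by auto
    then have bac: "bracket b a \<in> H" "bracket c a \<in> H" "bracket c b \<in> H"
      using antisym[of b a] antisym[of c a] antisym[of c b] subH(4) by simp_all
    have zHH: "bracket z h \<in> H" if "h \<in> H" for h
    proof -
      have "bracket z h = bracket u1 (bracket u2 h) - bracket u2 (bracket u1 h)"
        using leibniz[of u1 u2 h] by (simp add: z_def)
      then show ?thesis using VH uV that subH by simp
    qed
    have in_H: "a \<in> H" "b \<in> H" "c \<in> H" "z \<in> H" unfolding HB by (auto intro: span_base)
    have hz: "bracket h z \<in> H" if "h \<in> H" for h using zHH[OF that] antisym[of h z] subH(4) by simp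
    have "bracket s h \<in> H" if "s \<in> {a, b, c, z}" "h \<in> H" for s h
    proof (rule bracket_in_span[OF _ sH that(2)[unfolded HB]])
      fix s' assume "s' \<in> {a, b, c, z}"
      then show "bracket s s' \<in> H"
        using that(1) abc bac zHH[OF in_H(1)] zHH[OF in_H(2)] zHH[OF in_H(3)] hz[OF in_H(1)] hz[OF in_H(2)] hz[OF in_H(3)]
          subH(5) by (elim insertE emptyE) simp_all
    qed
    then have hs: "bracket h s \<in> H" if "s \<in> {a, b, c, z}" "h \<in> H" for s h
      using that antisym[of h s] subH(4) by simp
    have "bracket h h' \<in> H" if "h \<in> H" "h' \<in> H" for h h'
      by (rule bracket_in_span[OF _ sH that(2)[unfolded HB]]) (use hs that(1) in blast)
    then show False using Hn by blast
  qed
  then consider "wab \<noteq> 0" | "wac \<noteq> 0" | "wbc \<noteq> 0" by blast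
  then show ?thesis
  proof cases
    case 1 from main[OF HB perm(1) wab wac wbc 1] show ?thesis .
  next
    case 2 from main[OF perm(3) perm(2) wac wab negV[OF wbc(1)] flip[OF wbc(2)] 2] show ?thesis .
  next
    case 3
    have "H = span {c, b, a, z}" unfolding HB by (simp add: insert_commute)
    from main[OF perm(4) this wbc negV[OF wab(1)] flip[OF wab(2)] negV[OF wac(1)] flip[OF wac(2)] 3] show ?thesis .
  qed
qed

theorem listed_if_open:
  fixes b :: "'a::real_vector \<Rightarrow> 'a \<Rightarrow> 'a"
  assumes "nilpotent_6_with_open_4_2 b"
  shows "listed b"
proof -
  obtain H V where dim: "dim (UNIV :: 'a set) = 6" "dim V = 2" "dim H = 4" and nil: "nilpotent_lie_algebra b"
    and open_dec: "open_respectful_decomposition b H V"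
    using assms unfolding nilpotent_6_with_open_4_2_def by blast
  interpret nilpotent_lie b
    using nil unfolding nilpotent_lie_algebra_def nilpotent_lie_def nilpotent_lie_axioms_def by blast
  have comp: "subspace H" "subspace V" "H \<inter> V = {0}" "{h + v | h v. h \<in> H \<and> v \<in> V} = UNIV"
    and VH: "bracket_span b V H \<subseteq> H" and nsub: "\<not> lie_subalgebra b H" "\<not> lie_subalgebra b V"
    using open_dec unfolding open_respectful_decomposition_def respectful_decomposition_def
      complementary_subspaces_def by auto
  have nclosed: "\<exists>x\<in>S. \<exists>y\<in>S. b x y \<notin> S" if "subspace S" "\<not> lie_subalgebra b S" for S
  proof (rule ccontr)
    assume "\<not> ?thesis"
    then have "bracket_span b S S \<subseteq> S"
      unfolding bracket_span_def using that(1) by (intro span_minimal) auto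
    then show False using that unfolding lie_subalgebra_def by blast
  qed
  obtain B where B: "B \<subseteq> V" "independent B" "V \<subseteq> span B" "card B = 2"
    using real_vector.basis_exists[of V] dim by metis
  then obtain u1 u2 where "B = {u1, u2}" by (auto simp: card_2_iff)
  then have V: "V = span {u1, u2}" using B(1,3) comp(2) span_minimal[of B V] by blast
  show ?thesis
  proof (rule listed_of_decomposition[OF dim(1) comp(1-3) _ _ nclosed[OF comp(1) nsub(1)] nclosed[OF comp(2) nsub(2)] V dim(3)])
    show "\<exists>h\<in>H. \<exists>v\<in>V. u = h + v" for u using comp(4) by blast
    show "b v h \<in> H" if "v \<in> V" "h \<in> H" for v h
    proof -
      have "b v h \<in> bracket_span b V H"
        unfolding bracket_span_def by (rule span_base) (use that in blast)
      then show ?thesis using VH by blast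
    qed
  qed
qed

section \<open>The listed algebras admit open decompositions\<close>

definition coord :: "6 set \<Rightarrow> (real^6) set" where
  "coord D = {u. \<forall>i. i \<notin> D \<longrightarrow> u $ i = 0}"

lemma subspace_coord: "subspace (coord D)"
  by (auto simp: coord_def subspace_def)

lemma dim_coord: "dim (coord D) = card D"
  unfolding coord_def dim_vec_eq[symmetric] by (rule dim_substandard_cart)

lemma lie_algebra_mk6:
  assumes "c = mk6 b12 b13 b14 b15 b23 b24 b25 b34 b35 b45"
    "\<And>u t s. c u (c t s) + c t (c s u) + c s (c u t) = 0"
  shows "lie_algebra c"
  using assms(2) bilinear_mk6 mk6_self unfolding assms(1) by unfold_locales

lemma lie_nform:
  assumes "a1 * mv + l * b = 0"
  shows "lie_algebra (nform l mx mv p q1 q2 a1 a2 b)" (is "lie_algebra ?b")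
proof (rule lie_algebra_mk6[OF nform_def])
  fix u t s :: "real^6"
  \<comment> \<open>The Jacobi sum is alternating and trilinear, and among basis triples only
    \<open>x\<close>, \<open>v\<close>, \<open>w\<close> contributes; \<open>d\<close> is the minor
    belonging to the coordinates 1, 2, 4.\<close>
  define d where "d = u$1 * (t$2 * s$4 - t$4 * s$2) - u$2 * (t$1 * s$4 - t$4 * s$1) + u$4 * (t$1 * s$2 - t$2 * s$1)"
  have "(?b u (?b t s) + ?b t (?b s u) + ?b s (?b u t)) $ 6 = - (a1 * mv + l * b) * d"
    by (simp add: nform_def mk6_nth d_def algebra_simps)
  then have "(?b u (?b t s) + ?b t (?b s u) + ?b s (?b u t)) $ 6 = 0" using assms by simp
  moreover have "(?b u (?b t s) + ?b t (?b s u) + ?b s (?b u t)) $ i = 0" if "i \<in> {1, 2, 3, 4, 5}" for i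
    using that by (auto simp: nform_def mk6_nth algebra_simps)
  ultimately show "?b u (?b t s) + ?b t (?b s u) + ?b s (?b u t) = 0"
    unfolding vec6_eq_iff zero_index by blast
qed

lemma lie_chain: "lie_algebra (chain_fam 1 0 1 1 0 0 0 0 0)"
  by (rule lie_algebra_mk6[OF chain_fam_def]) (simp add: chain_fam_def mk6_nth vec6_eq_iff algebra_simps)

text \<open>Brackets lose the first two coordinates at once and each further term of the lower
  central series loses one more, so the term with index 5 is zero.\<close>

lemma nilpotent_of_flag:
  fixes c :: "real^6 \<Rightarrow> real^6 \<Rightarrow> real^6"
  assumes lie: "lie_algebra c"
    and c: "\<And>u t. c u t $ 1 = 0" "\<And>u t. c u t $ 2 = 0"
      "\<And>u t. t$1 = 0 \<Longrightarrow> t$2 = 0 \<Longrightarrow> c u t $ 3 = 0"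
      "\<And>u t. t$1 = 0 \<Longrightarrow> t$2 = 0 \<Longrightarrow> t$3 = 0 \<Longrightarrow> c u t $ 4 = 0"
      "\<And>u t. t$1 = 0 \<Longrightarrow> t$2 = 0 \<Longrightarrow> t$3 = 0 \<Longrightarrow> t$4 = 0 \<Longrightarrow> c u t $ 5 = 0"
      "\<And>u t. t$1 = 0 \<Longrightarrow> t$2 = 0 \<Longrightarrow> t$3 = 0 \<Longrightarrow> t$4 = 0 \<Longrightarrow> t$5 = 0 \<Longrightarrow> c u t $ 6 = 0"
  shows "nilpotent_lie_algebra c"
proof -
  let ?L = "lower_central_series c"
  have step: "?L (Suc n) \<subseteq> S" if "subspace S" "\<And>u t. t \<in> ?L n \<Longrightarrow> c u t \<in> S" for n S
    unfolding lower_central_series.simps bracket_span_def using that by (intro span_minimal) auto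
  have 1: "?L 1 \<subseteq> {u. u$1 = 0 \<and> u$2 = 0}" unfolding One_nat_def
    by (rule step) (use c in \<open>auto simp: subspace_def\<close>)
  have 2: "?L (Suc 1) \<subseteq> {u. u$1 = 0 \<and> u$2 = 0 \<and> u$3 = 0}"
    by (rule step) (use c 1 in \<open>auto simp: subspace_def\<close>)
  have 3: "?L (Suc (Suc 1)) \<subseteq> {u. u$1 = 0 \<and> u$2 = 0 \<and> u$3 = 0 \<and> u$4 = 0}"
    by (rule step) (use c subsetD[OF 2] in \<open>auto simp: subspace_def\<close>)
  have 4: "?L (Suc (Suc (Suc 1))) \<subseteq> {u. u$1 = 0 \<and> u$2 = 0 \<and> u$3 = 0 \<and> u$4 = 0 \<and> u$5 = 0}"
    by (rule step) (use c subsetD[OF 3] in \<open>auto simp: subspace_def\<close>)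
  have "?L (Suc (Suc (Suc (Suc 1)))) \<subseteq> {0}"
    by (rule step) (use c subsetD[OF 4] in \<open>auto simp: vec6_eq_iff\<close>)
  moreover have "0 \<in> ?L (Suc (Suc (Suc (Suc 1))))" by (simp add: bracket_span_def span_zero)
  ultimately show ?thesis unfolding nilpotent_lie_algebra_def using lie by blast
qed

lemma open_4_2_of_subspaces:
  fixes c :: "real^6 \<Rightarrow> real^6 \<Rightarrow> real^6"
  assumes nil: "nilpotent_lie_algebra c" and sH: "subspace H" and sV: "subspace V"
    and int: "H \<inter> V = {0}" and sum: "\<And>u. \<exists>h\<in>H. \<exists>v\<in>V. u = h + v" and dH: "dim H = 4"
    and VH: "\<And>v h. v \<in> V \<Longrightarrow> h \<in> H \<Longrightarrow> c v h \<in> H"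
    and Hn: "h \<in> H" "h' \<in> H" "c h h' \<notin> H" and Vn: "v \<in> V" "v' \<in> V" "c v v' \<notin> V"
  shows "nilpotent_6_with_open_4_2 c"
proof -
  have UN: "{h + v | h v. h \<in> H \<and> v \<in> V} = UNIV" using sum by blast
  have "dim V = 2" using dim_sums_Int[OF sH sV] dH UN int by simp
  moreover have "\<not> lie_subalgebra c S" if "x \<in> S" "y \<in> S" "c x y \<notin> S" for x y S
  proof -
    have "c x y \<in> bracket_span c S S" unfolding bracket_span_def by (rule span_base) (use that in blast)
    then show ?thesis using that unfolding lie_subalgebra_def by blast
  qed
  moreover have "bracket_span c V H \<subseteq> H"
    unfolding bracket_span_def using VH sH by (intro span_minimal) auto
  ultimately show ?thesis
    unfolding nilpotent_6_with_open_4_2_def open_respectful_decomposition_def respectful_decomposition_def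
      complementary_subspaces_def using nil sH sV int UN Hn Vn dH by (simp, blast)
qed

text \<open>
  When \<open>[v, w] = 0\<close>, the subspace \<open>V\<close> is spanned by \<open>v\<close> and \<open>w + r\<^sub>1\<close> instead, hence the parameter \<open>k\<close>.
\<close>

lemma open_nform:
  assumes lie: "a1 * mv + l * b = 0" and c: "mx * q1 + k * mv \<noteq> 0"
  shows "nilpotent_6_with_open_4_2 (nform l mx mv p q1 q2 a1 a2 b)"
proof (rule open_4_2_of_subspaces)
  let ?H = "coord {1, 3, 5, 6}" and ?V = "{u :: real^6. u$1 = 0 \<and> u$3 = 0 \<and> u$6 = 0 \<and> u$5 = k * u$4}"
  note H = coord_def forall6
  show "nilpotent_lie_algebra (nform l mx mv p q1 q2 a1 a2 b)"
    by (rule nilpotent_of_flag[OF lie_nform[OF lie]]) (simp_all add: nform_def mk6_nth)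
  show "subspace ?H" by (rule subspace_coord)
  show "subspace ?V" by (auto simp: subspace_def algebra_simps)
  show "?H \<inter> ?V = {0}" by (auto simp: H vec6_eq_iff)
  show "dim ?H = 4" by (simp add: dim_coord)
  show "\<exists>h\<in>?H. \<exists>v\<in>?V. u = h + v" for u
    by (rule bexI[of _ "vec6 (u$1) 0 (u$3) 0 (u$5 - k * u$4) (u$6)"], rule bexI[of _ "vec6 0 (u$2) 0 (u$4) (k * u$4) 0"])
      (simp_all add: H vec6_eq_iff)
  show "nform l mx mv p q1 q2 a1 a2 b v h \<in> ?H" if "v \<in> ?V" "h \<in> ?H" for v h
    using that by (simp add: H nform_def mk6_nth)
  show "vec6 1 0 0 0 0 0 \<in> ?H" "vec6 0 0 1 0 0 0 \<in> ?H" by (simp_all add: H)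
  show "nform l mx mv p q1 q2 a1 a2 b (vec6 1 0 0 0 0 0) (vec6 0 0 1 0 0 0) \<notin> ?H"
    by (simp add: H nform_def mk6_nth)
  show "vec6 0 1 0 0 0 0 \<in> ?V" "vec6 0 0 0 1 k 0 \<in> ?V" by simp_all
  show "nform l mx mv p q1 q2 a1 a2 b (vec6 0 1 0 0 0 0) (vec6 0 0 0 1 k 0) \<notin> ?V"
    using c by (simp add: nform_def mk6_nth)
qed

text \<open>\<open>V\<close> is spanned by \<open>v\<close> and \<open>r + w\<close>, and
  \<open>H\<close> by \<open>x\<close>, \<open>r\<close>, \<open>y\<close>, \<open>z\<close>. The
  vector \<open>w\<close> alone commutes with \<open>v\<close>; the summand \<open>r\<close>
  provides \<open>[v, r + w] = z\<close>.\<close>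

lemma open_chain: "nilpotent_6_with_open_4_2 (chain_fam 1 0 1 1 0 0 0 0 0)"
proof (rule open_4_2_of_subspaces)
  let ?c = "chain_fam 1 0 1 1 0 0 0 0 0"
  let ?H = "coord {1, 3, 4, 6}" and ?V = "{u :: real^6. u$1 = 0 \<and> u$4 = 0 \<and> u$6 = 0 \<and> u$3 = u$5}"
  note H = coord_def forall6
  show "nilpotent_lie_algebra ?c"
    by (rule nilpotent_of_flag[OF lie_chain]) (simp_all add: chain_fam_def mk6_nth)
  show "subspace ?H" by (rule subspace_coord)
  show "subspace ?V" by (auto simp: subspace_def algebra_simps)
  show "?H \<inter> ?V = {0}" by (auto simp: H vec6_eq_iff)
  show "dim ?H = 4" by (simp add: dim_coord)
  show "\<exists>h\<in>?H. \<exists>v\<in>?V. u = h + v" for u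
    by (rule bexI[of _ "vec6 (u$1) 0 (u$3 - u$5) (u$4) 0 (u$6)"], rule bexI[of _ "vec6 0 (u$2) (u$5) 0 (u$5) 0"])
      (simp_all add: H vec6_eq_iff)
  show "?c v h \<in> ?H" if "v \<in> ?V" "h \<in> ?H" for v h
    using that by (simp add: H chain_fam_def mk6_nth)
  show "vec6 1 0 0 0 0 0 \<in> ?H" "vec6 0 0 0 1 0 0 \<in> ?H" by (simp_all add: H)
  show "?c (vec6 1 0 0 0 0 0) (vec6 0 0 0 1 0 0) \<notin> ?H"
    by (simp add: H chain_fam_def mk6_nth)
  show "vec6 0 1 0 0 0 0 \<in> ?V" "vec6 0 0 1 0 1 0 \<in> ?V" by simp_all
  show "?c (vec6 0 1 0 0 0 0) (vec6 0 0 1 0 1 0) \<notin> ?V"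
    by (simp add: chain_fam_def mk6_nth)
qed

lemma open_models:
  assumes "m \<in> set models"
  shows "nilpotent_6_with_open_4_2 m"
proof -
  \<comment> \<open>In these models either \<open>mx * q1 = 1\<close> and \<open>mv = 0\<close>, or
    \<open>mx = 0\<close> and \<open>mv = 1\<close>. The choice \<open>k = 1 - mx * q1\<close> makes
    \<open>[v, w + k r1] = r2\<close> in both cases.\<close>
  have *: "nilpotent_6_with_open_4_2 (nform l mx mv p q1 q2 a1 a2 b)"
    if "a1 * mv + l * b = 0" "mx * q1 + (1 - mx * q1) * mv \<noteq> 0" for l mx mv p q1 q2 a1 a2 b
    using open_nform[OF that] .
  show ?thesis using assms unfolding models_def
    by (auto intro!: * open_chain)
qed

section \<open>Invariants\<close>

text \<open>A common form of centralisers and of the steps of the upper central series, so that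
  transport along isomorphisms is proved once.\<close>

definition annih :: "('a \<Rightarrow> 'a \<Rightarrow> 'a) \<Rightarrow> 'a set \<Rightarrow> 'a set \<Rightarrow> 'a set" where
  "annih b A S = {u. \<forall>s\<in>A. b u s \<in> S}"

text \<open>Not a subspace in general; \<open>dim\<close> then means the dimension of its linear
  span.\<close>

definition ad_null :: "('a::zero \<Rightarrow> 'a \<Rightarrow> 'a) \<Rightarrow> nat \<Rightarrow> 'a set" where
  "ad_null b n = {u. \<forall>t. (b u ^^ n) t = 0}"

definition center1 :: "('a::zero \<Rightarrow> 'a \<Rightarrow> 'a) \<Rightarrow> 'a set" where "center1 b = annih b UNIV {0}"
definition center2 :: "('a::zero \<Rightarrow> 'a \<Rightarrow> 'a) \<Rightarrow> 'a set" where "center2 b = annih b UNIV (center1 b)"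
definition center3 :: "('a::zero \<Rightarrow> 'a \<Rightarrow> 'a) \<Rightarrow> 'a set" where "center3 b = annih b UNIV (center2 b)"
text \<open>For bilinear \<open>b\<close> this is the centraliser of the derived algebra, since
  single brackets span it.\<close>

definition centralizer :: "('a::zero \<Rightarrow> 'a \<Rightarrow> 'a) \<Rightarrow> 'a set" where "centralizer b = annih b {b t s | t s. True} {0}"
text \<open>The dimensions of the upper central series and of \<open>centralizer\<close> agree on
  models 10 and 16, and also on 3, 4 and 5; this subspace separates 10 from 16 and 3 from 4 and
  5.\<close>

definition transporter :: "('a::zero \<Rightarrow> 'a \<Rightarrow> 'a) \<Rightarrow> 'a set" where "transporter b = annih b (centralizer b) (center1 b)"

lemma bij_image_eqI:
  assumes "bij f" "\<And>u. f u \<in> S' \<longleftrightarrow> u \<in> S"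
  shows "S' = f ` S"
proof
  show "f ` S \<subseteq> S'" using assms(2) by blast
  show "S' \<subseteq> f ` S"
  proof
    fix x assume "x \<in> S'"
    moreover obtain u where "x = f u" using bij_is_surj[OF assms(1)] by blast
    ultimately show "x \<in> f ` S" using assms(2) by blast
  qed
qed

lemma annih_iso:
  assumes f: "bij f" "\<And>x y. f (b x y) = c (f x) (f y)"
  shows "annih c (f ` A) (f ` S) = f ` annih b A S"
  by (rule bij_image_eqI[OF f(1)])
    (simp add: annih_def f(2)[symmetric] inj_image_mem_iff[OF bij_is_inj[OF f(1)]])

lemma invariants_iso:
  fixes b c :: "real^6 \<Rightarrow> real^6 \<Rightarrow> real^6"
  assumes "lie_isomorphic b c"
  shows "dim (center1 c) = dim (center1 b)" "dim (center2 c) = dim (center2 b)" "dim (center3 c) = dim (center3 b)"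
    "dim (centralizer c) = dim (centralizer b)" "dim (transporter c) = dim (transporter b)" "dim (ad_null c n) = dim (ad_null b n)"
proof -
  obtain f where f: "linear f" "bij f" "\<And>x y. f (b x y) = c (f x) (f y)"
    using assms unfolding lie_isomorphic_def by blast
  have dim: "dim (f ` S) = dim S" for S
    by (rule dim_image_eq[OF f(1)]) (use bij_is_inj[OF f(2)] in \<open>simp add: inj_on_def\<close>)
  have f0: "f 0 = 0" and U: "f ` UNIV = UNIV"
    by (rule linear_0[OF f(1)], rule bij_is_surj[OF f(2)])
  then have Z: "f ` {0} = {0}" by simp
  note an = annih_iso[of f b c, OF f(2,3)]
  have 1: "center1 c = f ` center1 b" unfolding center1_def using an[of UNIV "{0}"] by (simp only: U Z)
  have 2: "center2 c = f ` center2 b" unfolding center2_def 1 using an[of UNIV "center1 b"] by (simp only: U)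
  have 3: "center3 c = f ` center3 b" unfolding center3_def 2 using an[of UNIV "center2 b"] by (simp only: U)
  have surj: "\<exists>u. x = f u" for x using bij_is_surj[OF f(2)] by blast
  have "{c t s | t s. True} = f ` {b t s | t s. True}"
  proof (intro equalityI subsetI)
    fix x assume "x \<in> {c t s | t s. True}"
    then obtain t s where "x = c t s" by blast
    moreover obtain t' s' where "t = f t'" "s = f s'" using surj[of t] surj[of s] by blast
    ultimately have "x = f (b t' s')" by (simp add: f(3))
    then show "x \<in> f ` {b t s | t s. True}" by blast
  next
    fix x assume "x \<in> f ` {b t s | t s. True}"
    then obtain t s where "x = c (f t) (f s)" using f(3) by blast
    then show "x \<in> {c t s | t s. True}" by blast
  qed
  then have 4: "centralizer c = f ` centralizer b" unfolding centralizer_def using an[of "{b t s | t s. True}" "{0}"] by (simp only: Z)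
  have 5: "transporter c = f ` transporter b" unfolding transporter_def 1 4 by (rule an)
  have it: "(c (f u) ^^ n) (f t) = f ((b u ^^ n) t)" for u t
    by (induction n) (simp_all add: f(3))
  have inj0: "f x = 0 \<longleftrightarrow> x = 0" for x
    using inj_eq[OF bij_is_inj[OF f(2)], of x 0] f0 by simp
  have 6: "ad_null c n = f ` ad_null b n"
  proof (rule bij_image_eqI[OF f(2)])
    fix u
    have "(\<forall>t. (c (f u) ^^ n) t = 0) \<longleftrightarrow> (\<forall>t. (c (f u) ^^ n) (f t) = 0)"
    proof
      assume *: "\<forall>t. (c (f u) ^^ n) (f t) = 0"
      show "\<forall>t. (c (f u) ^^ n) t = 0"
      proof
        fix t obtain t' where "t = f t'" using surj[of t] by blast
        then show "(c (f u) ^^ n) t = 0" using * by simp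
      qed
    qed simp
    then show "f u \<in> ad_null c n \<longleftrightarrow> u \<in> ad_null b n" by (simp add: ad_null_def it inj0)
  qed
  show "dim (center1 c) = dim (center1 b)" "dim (center2 c) = dim (center2 b)" "dim (center3 c) = dim (center3 b)"
    "dim (centralizer c) = dim (centralizer b)" "dim (transporter c) = dim (transporter b)" "dim (ad_null c n) = dim (ad_null b n)"
    unfolding 1 2 3 4 5 6 by (rule dim)+
qed

section \<open>Evaluating the invariants on basis vectors\<close>

lemma linear_axis_expansion:
  fixes g :: "real^'n \<Rightarrow> 'b::real_vector"
  assumes "linear g"
  shows "g t = (\<Sum>i\<in>UNIV. t $ i *\<^sub>R g (axis i 1))"
proof -
  have "t = (\<Sum>i\<in>UNIV. t $ i *\<^sub>R axis i 1)"
    using basis_expansion[of t] by (simp add: scalar_mult_eq_scaleR)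
  then have "g t = g (\<Sum>i\<in>UNIV. t $ i *\<^sub>R axis i 1)" by simp
  then show ?thesis by (simp add: linear_sum[OF assms] linear_scale[OF assms])
qed

lemma linear_coord_in_iff:
  assumes "linear g" "subspace S"
  shows "(\<forall>t\<in>coord D. g t \<in> S) \<longleftrightarrow> (\<forall>i\<in>D. g (axis i 1) \<in> S)"
proof
  assume "\<forall>t\<in>coord D. g t \<in> S"
  then show "\<forall>i\<in>D. g (axis i 1) \<in> S" by (auto simp: coord_def axis_def)
next
  assume *: "\<forall>i\<in>D. g (axis i 1) \<in> S"
  show "\<forall>t\<in>coord D. g t \<in> S"
  proof
    fix t assume t: "t \<in> coord D"
    have "t $ i *\<^sub>R g (axis i 1) \<in> S" for i
      using * t assms(2) by (cases "i \<in> D") (auto simp: coord_def subspace_scale subspace_0)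
    then show "g t \<in> S" by (subst linear_axis_expansion[OF assms(1)]) (simp add: subspace_sum[OF assms(2)])
  qed
qed

lemma linear_zero_iff:
  fixes g :: "real^6 \<Rightarrow> real^6"
  assumes "linear g"
  shows "(\<forall>t. g t = 0) \<longleftrightarrow> (\<forall>i. g (axis i 1) = 0)"
proof (intro iffI allI)
  fix t assume "\<forall>i. g (axis i 1) = 0"
  then show "g t = 0" by (subst linear_axis_expansion[OF assms]) simp
qed simp

lemma coord_UNIV: "UNIV = coord UNIV" and coord_empty: "{0} = coord {}"
  by (auto simp: coord_def vec_eq_iff)

lemma bilinear_right: "bilinear b \<Longrightarrow> linear (b u)" and bilinear_left: "bilinear b \<Longrightarrow> linear (\<lambda>t. b t u)"
  by (simp_all add: bilinear_def)

lemma annih_eqI: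
  assumes "bilinear b"
    "\<And>u. (\<forall>i\<in>D. \<forall>k. k \<notin> E \<longrightarrow> b u (axis i 1) $ k = 0) \<longleftrightarrow> (\<forall>k. k \<notin> F \<longrightarrow> u $ k = 0)"
  shows "annih b (coord D) (coord E) = coord F"
  unfolding annih_def linear_coord_in_iff[OF bilinear_right[OF assms(1)] subspace_coord]
  using assms(2) by (auto simp: coord_def)

lemma center1_eqI:
  assumes "bilinear b" "\<And>u. (\<forall>i k. b u (axis i 1) $ k = 0) \<longleftrightarrow> (\<forall>k. k \<notin> F \<longrightarrow> u $ k = 0)"
  shows "center1 b = coord F"
  unfolding center1_def coord_UNIV coord_empty by (rule annih_eqI[OF assms(1)]) (use assms(2) in simp)

lemma center2_eqI:
  assumes "bilinear b" "center1 b = coord E"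
    "\<And>u. (\<forall>i k. k \<notin> E \<longrightarrow> b u (axis i 1) $ k = 0) \<longleftrightarrow> (\<forall>k. k \<notin> F \<longrightarrow> u $ k = 0)"
  shows "center2 b = coord F"
  unfolding center2_def coord_UNIV assms(2) by (rule annih_eqI[OF assms(1)]) (use assms(3) in simp)

lemma center3_eqI:
  assumes "bilinear b" "center2 b = coord E"
    "\<And>u. (\<forall>i k. k \<notin> E \<longrightarrow> b u (axis i 1) $ k = 0) \<longleftrightarrow> (\<forall>k. k \<notin> F \<longrightarrow> u $ k = 0)"
  shows "center3 b = coord F"
  unfolding center3_def coord_UNIV assms(2) by (rule annih_eqI[OF assms(1)]) (use assms(3) in simp)

lemma transporter_eqI:
  assumes "bilinear b" "centralizer b = coord D" "center1 b = coord E"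
    "\<And>u. (\<forall>i\<in>D. \<forall>k. k \<notin> E \<longrightarrow> b u (axis i 1) $ k = 0) \<longleftrightarrow> (\<forall>k. k \<notin> F \<longrightarrow> u $ k = 0)"
  shows "transporter b = coord F"
  unfolding transporter_def assms(2,3) by (rule annih_eqI[OF assms(1,4)])

lemma centralizer_eqI:
  fixes b :: "real^6 \<Rightarrow> real^6 \<Rightarrow> real^6"
  assumes b: "bilinear b"
    and F: "\<And>u. (\<forall>i j. b u (b (axis i 1) (axis j 1)) = 0) \<longleftrightarrow> (\<forall>k. k \<notin> F \<longrightarrow> u $ k = 0)"
  shows "centralizer b = coord F"
proof -
  have r: "linear (\<lambda>s. b u (b t s))" for u t
    by (rule linear_compose[OF bilinear_right[OF b] bilinear_right[OF b], unfolded comp_def])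
  have l: "linear (\<lambda>t. b u (b t s))" for u s
    by (rule linear_compose[OF bilinear_left[OF b] bilinear_right[OF b], unfolded comp_def])
  have "(\<forall>t s. b u (b t s) = 0) \<longleftrightarrow> (\<forall>i j. b u (b (axis i 1) (axis j 1)) = 0)" for u
  proof -
    have "(\<forall>t s. b u (b t s) = 0) \<longleftrightarrow> (\<forall>s i. b u (b (axis i 1) s) = 0)"
      using linear_zero_iff[OF l] by blast
    also have "\<dots> \<longleftrightarrow> (\<forall>i j. b u (b (axis i 1) (axis j 1)) = 0)"
      using linear_zero_iff[OF r] by blast
    finally show ?thesis .
  qed
  moreover have "centralizer b = {u. \<forall>t s. b u (b t s) = 0}" unfolding centralizer_def annih_def by blast
  ultimately show ?thesis by (simp add: F coord_def)
qed

lemma ad_null_iff: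
  assumes "bilinear b"
  shows "u \<in> ad_null b n \<longleftrightarrow> (\<forall>i. (b u ^^ n) (axis i 1) = (0 :: real^6))"
proof -
  have "linear (b u ^^ n)"
  proof (induction n)
    case 0 then show ?case by (simp add: linear_id[unfolded id_def] id_def)
  next
    case (Suc n) show ?case unfolding funpow.simps by (rule linear_compose[OF Suc bilinear_right[OF assms]])
  qed
  from linear_zero_iff[OF this] show ?thesis by (simp add: ad_null_def)
qed

text \<open>Made for \<open>ad_null\<close> of the two models with an indefinite form: its isotropic
  vectors \<open>e_i + e_j\<close> and \<open>e_i - e_j\<close> belong to the set although
  \<open>e_i\<close> and \<open>e_j\<close> do not.\<close>

lemma dim_eq_6I:
  assumes "\<And>k. k \<noteq> i \<Longrightarrow> k \<noteq> j \<Longrightarrow> axis k 1 \<in> S" and ij: "axis i 1 + axis j 1 \<in> S" "axis i 1 - axis j 1 \<in> S"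
  shows "dim (S :: (real^6) set) = 6"
proof -
  have "(1/2) *\<^sub>R ((axis i 1 + axis j 1) + (axis i 1 - axis j 1)) \<in> span S"
    "(1/2) *\<^sub>R ((axis i 1 + axis j 1) - (axis i 1 - axis j 1)) \<in> span S"
    by (intro span_scale span_add[of _ _ "_ - _"] span_diff[of "_ + _"] span_base ij)+
  moreover have "(1/2) *\<^sub>R ((x + y) + (x - y)) = x" "(1/2) *\<^sub>R ((x + y) - (x - y)) = y" for x y :: "real^6"
    by (simp_all add: vec_eq_iff)
  ultimately have "axis k 1 \<in> span S" for k
    using assms(1) by (cases "k = i"; cases "k = j") (auto intro: span_base)
  then have "id t \<in> span S" for t :: "real^6"
    by (subst linear_axis_expansion[OF linear_id]) (simp add: span_sum span_scale)
  then have "span S = UNIV" by auto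
  then show ?thesis using dim_span[of S] by simp
qed

lemma neg_square_eq_square_iff: "- (x * x) = y * y \<longleftrightarrow> x = 0 \<and> y = 0" for x y :: real
  using sum_squares_eq_zero_iff[of x y] by (auto simp: add_eq_0_iff)

lemma cubic_form_eq_zero_iff:
  "x * (x * x) + y * (y * x) = 0 \<longleftrightarrow> x = 0" "- (y * (y * x)) = x * (x * x) \<longleftrightarrow> x = 0" for x y :: real
proof -
  have "x * (x * x) + y * (y * x) = x * (x * x + y * y)" by (simp add: algebra_simps)
  then show 1: "x * (x * x) + y * (y * x) = 0 \<longleftrightarrow> x = 0" by (auto simp: sum_squares_eq_zero_iff)
  show "- (y * (y * x)) = x * (x * x) \<longleftrightarrow> x = 0" unfolding 1[symmetric] by linarith
qed

section \<open>Explicit brackets and the separation of the 17 models\<close>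

lemma bilinear_nform: "bilinear (nform l mx mv p q1 q2 a1 a2 b)"
  unfolding nform_def by (rule bilinear_mk6)

lemma bilinear_chain_fam: "bilinear (chain_fam g t1 tau k e s eta k' th)"
  unfolding chain_fam_def by (rule bilinear_mk6)

lemma nform_eq:
  "nform l mx mv p q1 q2 a1 a2 b u t = vec6 0 0 (l * (u$1 * t$2 - u$2 * t$1)) (u$1 * t$3 - u$3 * t$1)
     (p * (u$1 * t$2 - u$2 * t$1) + a1 * (u$1 * t$4 - u$4 * t$1) + q1 * (u$2 * t$3 - u$3 * t$2))
     (a2 * (u$1 * t$4 - u$4 * t$1) + mx * (u$1 * t$5 - u$5 * t$1) + q2 * (u$2 * t$3 - u$3 * t$2)
      + mx * q1 * (u$2 * t$4 - u$4 * t$2) + mv * (u$2 * t$5 - u$5 * t$2) + b * (u$3 * t$4 - u$4 * t$3))"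
  by (simp add: nform_def mk6_nth vec6_eq_iff algebra_simps)

lemma chain_fam_eq:
  "chain_fam 1 0 1 1 0 0 0 0 0 u t = vec6 0 0 (u$1 * t$2 - u$2 * t$1) (u$1 * t$3 - u$3 * t$1)
     (u$1 * t$4 - u$4 * t$1) ((u$1 * t$5 - u$5 * t$1) + (u$2 * t$3 - u$3 * t$2))"
  by (simp add: chain_fam_def mk6_nth vec6_eq_iff algebra_simps)

lemmas eval_simps = nform_eq chain_fam_eq axis_def forall6

text \<open>A decision tree whose leaves are numbered like the entries of \<open>models\<close>, so
  that pairwise non-isomorphism becomes distinctness of \<open>[0..<17]\<close>.\<close>

definition class_index :: "(real^6 \<Rightarrow> real^6 \<Rightarrow> real^6) \<Rightarrow> nat" where
  "class_index b = (if dim (center1 b) = 2 then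
      if dim (center2 b) = 6 then 0 else if dim (center2 b) = 3 then 7 else if dim (centralizer b) = 5 then 2 else 13
    else if dim (center2 b) = 4 then 1
    else if dim (center2 b) = 2 then
      if dim (centralizer b) = 2 then if dim (ad_null b 3) = 5 then 15 else 11
      else if dim (center3 b) = 4 then 6 else if dim (transporter b) = 5 then 16 else 10
    else if dim (center3 b) = 6 then
      if dim (transporter b) = 5 then 3 else if dim (ad_null b 2) = 4 then 4 else 5
    else if dim (centralizer b) = 5 then 12
    else if dim (ad_null b 3) = 5 then 14
    else if dim (ad_null b 3) = 4 then 8 else 9)"

lemma class_index_iso: "lie_isomorphic b c \<Longrightarrow> class_index b = class_index c"
  unfolding class_index_def by (simp only: invariants_iso)

lemma class_index_0: "class_index (nform 0 0 1 0 0 0 0 0 0) = 0"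
proof -
  let ?b = "nform 0 0 1 0 0 0 0 0 0"
  have 1: "center1 ?b = coord {4, 6}" by (rule center1_eqI[OF bilinear_nform]) (auto simp: eval_simps)
  have 2: "center2 ?b = coord UNIV" by (rule center2_eqI[OF bilinear_nform 1]) (auto simp: eval_simps)
  show ?thesis by (simp add: class_index_def 1 2 dim_coord)
qed

lemma class_index_1: "class_index (nform 0 0 1 0 0 0 0 1 0) = 1"
proof -
  let ?b = "nform 0 0 1 0 0 0 0 1 0"
  have 1: "center1 ?b = coord {6}" by (rule center1_eqI[OF bilinear_nform]) (auto simp: eval_simps)
  have 2: "center2 ?b = coord {2, 4, 5, 6}" by (rule center2_eqI[OF bilinear_nform 1]) (auto simp: eval_simps)
  show ?thesis by (simp add: class_index_def 1 2 dim_coord)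
qed

lemma class_index_2: "class_index (nform 0 0 1 1 0 0 0 0 0) = 2"
proof -
  let ?b = "nform 0 0 1 1 0 0 0 0 0"
  have 1: "center1 ?b = coord {4, 6}" by (rule center1_eqI[OF bilinear_nform]) (auto simp: eval_simps)
  have 2: "center2 ?b = coord {3, 4, 5, 6}" by (rule center2_eqI[OF bilinear_nform 1]) (auto simp: eval_simps)
  have C: "centralizer ?b = coord {1, 3, 4, 5, 6}" by (rule centralizer_eqI[OF bilinear_nform]) (auto simp: eval_simps vec6_eq_iff)
  show ?thesis by (simp add: class_index_def 1 2 C dim_coord)
qed

lemma class_index_3: "class_index (nform 0 0 1 1 0 0 0 1 0) = 3"
proof -
  let ?b = "nform 0 0 1 1 0 0 0 1 0"
  have 1: "center1 ?b = coord {6}" by (rule center1_eqI[OF bilinear_nform]) (auto simp: eval_simps)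
  have 2: "center2 ?b = coord {4, 5, 6}" by (rule center2_eqI[OF bilinear_nform 1]) (auto simp: eval_simps)
  have 3: "center3 ?b = coord UNIV" by (rule center3_eqI[OF bilinear_nform 2]) (auto simp: eval_simps)
  have C: "centralizer ?b = coord {3, 4, 5, 6}" by (rule centralizer_eqI[OF bilinear_nform]) (auto simp: eval_simps vec6_eq_iff)
  have T: "transporter ?b = coord {2, 3, 4, 5, 6}" by (rule transporter_eqI[OF bilinear_nform C 1]) (auto simp: eval_simps)
  show ?thesis by (simp add: class_index_def 1 2 3 C T dim_coord)
qed

lemma class_index_4: "class_index (nform 0 0 1 1 0 0 0 0 1) = 4"
proof -
  let ?b = "nform 0 0 1 1 0 0 0 0 1"
  have 1: "center1 ?b = coord {6}" by (rule center1_eqI[OF bilinear_nform]) (auto simp: eval_simps)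
  have 2: "center2 ?b = coord {4, 5, 6}" by (rule center2_eqI[OF bilinear_nform 1]) (auto simp: eval_simps)
  have 3: "center3 ?b = coord UNIV" by (rule center3_eqI[OF bilinear_nform 2]) (auto simp: eval_simps)
  have C: "centralizer ?b = coord {1, 4, 5, 6}" by (rule centralizer_eqI[OF bilinear_nform]) (auto simp: eval_simps vec6_eq_iff)
  have T: "transporter ?b = coord {1, 4, 5, 6}" by (rule transporter_eqI[OF bilinear_nform C 1]) (auto simp: eval_simps)
  \<comment> \<open>\<open>(ad u)^2\<close> maps \<open>x\<close> to \<open>- (u2^2 + u3^2)\<close>
    times \<open>r2\<close>, and this form is definite.\<close>
  have "u \<in> ad_null ?b 2 \<longleftrightarrow> u \<in> coord {1, 4, 5, 6}" for u
    unfolding ad_null_iff[OF bilinear_nform] by (auto simp: eval_simps vec6_eq_iff coord_def numeral_2_eq_2 sum_squares_eq_zero_iff neg_square_eq_square_iff)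
  then have Q: "ad_null ?b 2 = coord {1, 4, 5, 6}" by blast
  show ?thesis by (simp add: class_index_def 1 2 3 C T Q dim_coord)
qed

lemma class_index_5: "class_index (nform 0 0 1 1 0 0 0 0 (- 1)) = 5"
proof -
  let ?b = "nform 0 0 1 1 0 0 0 0 (- 1)"
  have 1: "center1 ?b = coord {6}" by (rule center1_eqI[OF bilinear_nform]) (auto simp: eval_simps)
  have 2: "center2 ?b = coord {4, 5, 6}" by (rule center2_eqI[OF bilinear_nform 1]) (auto simp: eval_simps)
  have 3: "center3 ?b = coord UNIV" by (rule center3_eqI[OF bilinear_nform 2]) (auto simp: eval_simps)
  have C: "centralizer ?b = coord {1, 4, 5, 6}" by (rule centralizer_eqI[OF bilinear_nform]) (auto simp: eval_simps vec6_eq_iff)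
  have T: "transporter ?b = coord {1, 4, 5, 6}" by (rule transporter_eqI[OF bilinear_nform C 1]) (auto simp: eval_simps)
  \<comment> \<open>The form is now \<open>u2^2 - u3^2\<close>, with isotropic vectors
    \<open>v + y\<close> and \<open>v - y\<close>.\<close>
  have Q: "dim (ad_null ?b 2) = 6"
  proof (rule dim_eq_6I[of 2 3]; unfold ad_null_iff[OF bilinear_nform])
    show "\<forall>i. (?b (axis k 1) ^^ 2) (axis i 1) = 0" if "k \<noteq> 2" "k \<noteq> 3" for k
      using that exhaust6[of k] by (auto simp: eval_simps vec6_eq_iff numeral_2_eq_2)
  qed (simp_all add: eval_simps vec6_eq_iff numeral_2_eq_2)
  show ?thesis by (simp add: class_index_def 1 2 3 C T Q dim_coord)
qed

lemma class_index_6: "class_index (nform 0 1 0 0 1 0 1 0 0) = 6"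
proof -
  let ?b = "nform 0 1 0 0 1 0 1 0 0"
  have 1: "center1 ?b = coord {6}" by (rule center1_eqI[OF bilinear_nform]) (auto simp: eval_simps)
  have 2: "center2 ?b = coord {5, 6}" by (rule center2_eqI[OF bilinear_nform 1]) (auto simp: eval_simps)
  have 3: "center3 ?b = coord {2, 4, 5, 6}" by (rule center3_eqI[OF bilinear_nform 2]) (auto simp: eval_simps)
  have C: "centralizer ?b = coord {3, 4, 5, 6}" by (rule centralizer_eqI[OF bilinear_nform]) (auto simp: eval_simps vec6_eq_iff)
  show ?thesis by (simp add: class_index_def 1 2 3 C dim_coord)
qed

lemma class_index_7: "class_index (nform 1 0 1 0 1 0 0 0 0) = 7"
proof -
  let ?b = "nform 1 0 1 0 1 0 0 0 0"
  have 1: "center1 ?b = coord {4, 6}" by (rule center1_eqI[OF bilinear_nform]) (auto simp: eval_simps)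
  have 2: "center2 ?b = coord {4, 5, 6}" by (rule center2_eqI[OF bilinear_nform 1]) (auto simp: eval_simps)
  show ?thesis by (simp add: class_index_def 1 2 dim_coord)
qed

lemma class_index_8: "class_index (nform 1 0 1 0 1 0 0 1 0) = 8"
proof -
  let ?b = "nform 1 0 1 0 1 0 0 1 0"
  have 1: "center1 ?b = coord {6}" by (rule center1_eqI[OF bilinear_nform]) (auto simp: eval_simps)
  have 2: "center2 ?b = coord {4, 5, 6}" by (rule center2_eqI[OF bilinear_nform 1]) (auto simp: eval_simps)
  have 3: "center3 ?b = coord {3, 4, 5, 6}" by (rule center3_eqI[OF bilinear_nform 2]) (auto simp: eval_simps)
  have C: "centralizer ?b = coord {3, 4, 5, 6}" by (rule centralizer_eqI[OF bilinear_nform]) (auto simp: eval_simps vec6_eq_iff)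
  \<comment> \<open>\<open>(ad u)^3\<close> maps \<open>v\<close> to
    \<open>u1 * (u1^2 + u2^2)\<close> times \<open>r2\<close>, and \<open>x\<close> to a multiple
    with first factor \<open>- u2\<close>.\<close>
  have "u \<in> ad_null ?b 3 \<longleftrightarrow> u \<in> coord {3, 4, 5, 6}" for u
    unfolding ad_null_iff[OF bilinear_nform] by (auto simp: eval_simps vec6_eq_iff coord_def numeral_3_eq_3 cubic_form_eq_zero_iff)
  then have K: "ad_null ?b 3 = coord {3, 4, 5, 6}" by blast
  show ?thesis by (simp add: class_index_def 1 2 3 C K dim_coord)
qed

lemma class_index_9: "class_index (nform 1 0 1 0 1 0 0 (- 1) 0) = 9"
proof -
  let ?b = "nform 1 0 1 0 1 0 0 (- 1) 0"
  have 1: "center1 ?b = coord {6}" by (rule center1_eqI[OF bilinear_nform]) (auto simp: eval_simps)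
  have 2: "center2 ?b = coord {4, 5, 6}" by (rule center2_eqI[OF bilinear_nform 1]) (auto simp: eval_simps)
  have 3: "center3 ?b = coord {3, 4, 5, 6}" by (rule center3_eqI[OF bilinear_nform 2]) (auto simp: eval_simps)
  have C: "centralizer ?b = coord {3, 4, 5, 6}" by (rule centralizer_eqI[OF bilinear_nform]) (auto simp: eval_simps vec6_eq_iff)
  \<comment> \<open>The quadratic factor is now \<open>u2^2 - u1^2\<close>, which vanishes at
    \<open>x + v\<close> and \<open>x - v\<close>.\<close>
  have K: "dim (ad_null ?b 3) = 6"
  proof (rule dim_eq_6I[of 1 2]; unfold ad_null_iff[OF bilinear_nform])
    show "\<forall>i. (?b (axis k 1) ^^ 3) (axis i 1) = 0" if "k \<noteq> 1" "k \<noteq> 2" for k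
      using that exhaust6[of k] by (auto simp: eval_simps vec6_eq_iff numeral_3_eq_3)
  qed (simp_all add: eval_simps vec6_eq_iff numeral_3_eq_3)
  show ?thesis by (simp add: class_index_def 1 2 3 C K dim_coord)
qed

lemma class_index_10: "class_index (nform 1 1 0 0 1 0 1 0 0) = 10"
proof -
  let ?b = "nform 1 1 0 0 1 0 1 0 0"
  have 1: "center1 ?b = coord {6}" by (rule center1_eqI[OF bilinear_nform]) (auto simp: eval_simps)
  have 2: "center2 ?b = coord {5, 6}" by (rule center2_eqI[OF bilinear_nform 1]) (auto simp: eval_simps)
  have 3: "center3 ?b = coord {4, 5, 6}" by (rule center3_eqI[OF bilinear_nform 2]) (auto simp: eval_simps)
  have C: "centralizer ?b = coord {3, 4, 5, 6}" by (rule centralizer_eqI[OF bilinear_nform]) (auto simp: eval_simps vec6_eq_iff)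
  have T: "transporter ?b = coord {3, 4, 5, 6}" by (rule transporter_eqI[OF bilinear_nform C 1]) (auto simp: eval_simps)
  show ?thesis by (simp add: class_index_def 1 2 3 C T dim_coord)
qed

lemma class_index_11: "class_index (nform 1 0 1 0 1 0 1 0 (- 1)) = 11"
proof -
  let ?b = "nform 1 0 1 0 1 0 1 0 (- 1)"
  have 1: "center1 ?b = coord {6}" by (rule center1_eqI[OF bilinear_nform]) (auto simp: eval_simps)
  have 2: "center2 ?b = coord {5, 6}" by (rule center2_eqI[OF bilinear_nform 1]) (auto simp: eval_simps)
  have C: "centralizer ?b = coord {5, 6}" by (rule centralizer_eqI[OF bilinear_nform]) (auto simp: eval_simps vec6_eq_iff)
  have "u \<in> ad_null ?b 3 \<longleftrightarrow> u \<in> coord {3, 4, 5, 6}" for u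
    unfolding ad_null_iff[OF bilinear_nform] by (auto simp: eval_simps vec6_eq_iff coord_def numeral_3_eq_3)
  then have K: "ad_null ?b 3 = coord {3, 4, 5, 6}" by blast
  show ?thesis by (simp add: class_index_def 1 2 C K dim_coord)
qed

lemma class_index_12: "class_index (nform 1 0 1 0 0 0 0 1 0) = 12"
proof -
  let ?b = "nform 1 0 1 0 0 0 0 1 0"
  have 1: "center1 ?b = coord {6}" by (rule center1_eqI[OF bilinear_nform]) (auto simp: eval_simps)
  have 2: "center2 ?b = coord {4, 5, 6}" by (rule center2_eqI[OF bilinear_nform 1]) (auto simp: eval_simps)
  have 3: "center3 ?b = coord {3, 4, 5, 6}" by (rule center3_eqI[OF bilinear_nform 2]) (auto simp: eval_simps)
  have C: "centralizer ?b = coord {2, 3, 4, 5, 6}" by (rule centralizer_eqI[OF bilinear_nform]) (auto simp: eval_simps vec6_eq_iff)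
  show ?thesis by (simp add: class_index_def 1 2 3 C dim_coord)
qed

lemma class_index_13: "class_index (nform 1 0 1 0 0 1 0 0 0) = 13"
proof -
  let ?b = "nform 1 0 1 0 0 1 0 0 0"
  have 1: "center1 ?b = coord {4, 6}" by (rule center1_eqI[OF bilinear_nform]) (auto simp: eval_simps)
  have 2: "center2 ?b = coord {3, 4, 5, 6}" by (rule center2_eqI[OF bilinear_nform 1]) (auto simp: eval_simps)
  have C: "centralizer ?b = coord {3, 4, 5, 6}" by (rule centralizer_eqI[OF bilinear_nform]) (auto simp: eval_simps vec6_eq_iff)
  show ?thesis by (simp add: class_index_def 1 2 C dim_coord)
qed

lemma class_index_14: "class_index (nform 1 0 1 0 0 1 0 1 0) = 14"
proof -
  let ?b = "nform 1 0 1 0 0 1 0 1 0"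
  have 1: "center1 ?b = coord {6}" by (rule center1_eqI[OF bilinear_nform]) (auto simp: eval_simps)
  have 2: "center2 ?b = coord {4, 5, 6}" by (rule center2_eqI[OF bilinear_nform 1]) (auto simp: eval_simps)
  have 3: "center3 ?b = coord {3, 4, 5, 6}" by (rule center3_eqI[OF bilinear_nform 2]) (auto simp: eval_simps)
  have C: "centralizer ?b = coord {3, 4, 5, 6}" by (rule centralizer_eqI[OF bilinear_nform]) (auto simp: eval_simps vec6_eq_iff)
  have "u \<in> ad_null ?b 3 \<longleftrightarrow> u \<in> coord {2, 3, 4, 5, 6}" for u
    unfolding ad_null_iff[OF bilinear_nform] by (auto simp: eval_simps vec6_eq_iff coord_def numeral_3_eq_3)
  then have K: "ad_null ?b 3 = coord {2, 3, 4, 5, 6}" by blast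
  show ?thesis by (simp add: class_index_def 1 2 3 C K dim_coord)
qed

lemma class_index_15: "class_index (nform 1 0 1 0 0 0 1 0 (- 1)) = 15"
proof -
  let ?b = "nform 1 0 1 0 0 0 1 0 (- 1)"
  have 1: "center1 ?b = coord {6}" by (rule center1_eqI[OF bilinear_nform]) (auto simp: eval_simps)
  have 2: "center2 ?b = coord {5, 6}" by (rule center2_eqI[OF bilinear_nform 1]) (auto simp: eval_simps)
  have C: "centralizer ?b = coord {5, 6}" by (rule centralizer_eqI[OF bilinear_nform]) (auto simp: eval_simps vec6_eq_iff)
  have "u \<in> ad_null ?b 3 \<longleftrightarrow> u \<in> coord {2, 3, 4, 5, 6}" for u
    unfolding ad_null_iff[OF bilinear_nform] by (auto simp: eval_simps vec6_eq_iff coord_def numeral_3_eq_3)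
  then have K: "ad_null ?b 3 = coord {2, 3, 4, 5, 6}" by blast
  show ?thesis by (simp add: class_index_def 1 2 C K dim_coord)
qed

lemma class_index_16: "class_index (chain_fam 1 0 1 1 0 0 0 0 0) = 16"
proof -
  let ?b = "chain_fam 1 0 1 1 0 0 0 0 0"
  have 1: "center1 ?b = coord {6}" by (rule center1_eqI[OF bilinear_chain_fam]) (auto simp: eval_simps)
  have 2: "center2 ?b = coord {5, 6}" by (rule center2_eqI[OF bilinear_chain_fam 1]) (auto simp: eval_simps)
  have 3: "center3 ?b = coord {4, 5, 6}" by (rule center3_eqI[OF bilinear_chain_fam 2]) (auto simp: eval_simps)
  have C: "centralizer ?b = coord {3, 4, 5, 6}" by (rule centralizer_eqI[OF bilinear_chain_fam]) (auto simp: eval_simps vec6_eq_iff)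
  have T: "transporter ?b = coord {2, 3, 4, 5, 6}" by (rule transporter_eqI[OF bilinear_chain_fam C 1]) (auto simp: eval_simps)
  show ?thesis by (simp add: class_index_def 1 2 3 C T dim_coord)
qed

lemma class_index_models: "map class_index models = [0..<17]"
  by (simp add: models_def class_index_0 class_index_1 class_index_2 class_index_3 class_index_4 class_index_5 class_index_6 class_index_7 class_index_8 class_index_9 class_index_10
      class_index_11 class_index_12 class_index_13 class_index_14 class_index_15 class_index_16 upt_rec)

text \<open>Isomorphism classes are counted on the fixed carrier \<open>real^6\<close>, where they
  form a set; the second conjunct ensures that an algebra on any other carrier belongs to one of the
  counted classes.\<close>

theorem theorem2:
  shows "card ({b :: real ^ 6 \<Rightarrow> real ^ 6 \<Rightarrow> real ^ 6. nilpotent_6_with_open_4_2 b}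
                 // {(b, c). lie_isomorphic b c}) = 17 \<and>
         (\<forall>b :: 'a::real_vector \<Rightarrow> 'a \<Rightarrow> 'a. nilpotent_6_with_open_4_2 b \<longrightarrow>
            (\<exists>c :: real ^ 6 \<Rightarrow> real ^ 6 \<Rightarrow> real ^ 6.
               nilpotent_6_with_open_4_2 c \<and> lie_isomorphic b c))"
proof
  let ?A = "{b :: real ^ 6 \<Rightarrow> real ^ 6 \<Rightarrow> real ^ 6. nilpotent_6_with_open_4_2 b}"
  let ?r = "{(b, c). lie_isomorphic b (c :: real ^ 6 \<Rightarrow> real ^ 6 \<Rightarrow> real ^ 6)}"
  have cls: "?r `` {b} = ?r `` {c} \<longleftrightarrow> lie_isomorphic b c" for b c :: "real ^ 6 \<Rightarrow> real ^ 6 \<Rightarrow> real ^ 6"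
    using eq_equiv_class_iff[OF equiv_lie_isomorphic, of b c] by simp
  have "?A // ?r = (\<lambda>m. ?r `` {m}) ` set models"
  proof (intro equalityI subsetI)
    fix X assume "X \<in> ?A // ?r"
    then obtain b where "b \<in> ?A" and X: "X = ?r `` {b}" by (rule quotientE)
    then have b: "nilpotent_6_with_open_4_2 b" by simp
    then obtain m where "m \<in> set models" "lie_isomorphic b m"
      using listed_if_open unfolding listed_def by blast
    then show "X \<in> (\<lambda>m. ?r `` {m}) ` set models" using X cls by blast
  next
    fix X assume "X \<in> (\<lambda>m. ?r `` {m}) ` set models"
    then obtain m where m: "m \<in> set models" "X = ?r `` {m}" by blast
    then have "m \<in> ?A" using open_models by blast
    then show "X \<in> ?A // ?r" unfolding m(2) by (rule quotientI)
  qed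
  moreover have "inj_on (\<lambda>m. ?r `` {m}) (set models)"
  proof (rule inj_onI)
    fix m m' assume m: "m \<in> set models" "m' \<in> set models" and "?r `` {m} = ?r `` {m'}"
    then have "class_index m = class_index m'" using cls class_index_iso by blast
    moreover have "distinct (map class_index models)" by (simp add: class_index_models)
    ultimately show "m = m'" using m by (simp add: distinct_map inj_on_def)
  qed
  moreover have "card (set models) = 17"
  proof -
    have "distinct (map class_index models)" by (simp add: class_index_models)
    then have "distinct models" by (simp add: distinct_map)
    moreover have "length models = 17" by (simp add: models_def)
    ultimately show ?thesis using distinct_card by fastforce
  qed
  ultimately show "card (?A // ?r) = 17" by (simp add: card_image)
  show "\<forall>b :: 'a \<Rightarrow> 'a \<Rightarrow> 'a. nilpotent_6_with_open_4_2 b \<longrightarrow>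
      (\<exists>c :: real ^ 6 \<Rightarrow> real ^ 6 \<Rightarrow> real ^ 6. nilpotent_6_with_open_4_2 c \<and> lie_isomorphic b c)"
    using listed_if_open open_models unfolding listed_def by blast
qed

end
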